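(* Let $m<n$ be positive integers. Let $\phi_m\colon L_m\to K_m$ and $\phi_n\colon L_n\to K_n$ be the forgetful maps, $\iota\colon L_m\to L_n$ the augmentation map, and $\rho\colon K_n\to K_m$ the restriction map (the last two being associated to a fixed ordered basis $a_1,\dots,a_n$ of $F_n$). Then the following diagram of simplicial maps commutes: $$\begin{matrix} L_m & \stackrel{\iota}{\longrightarrow} & L_n\\ {\scriptstyle\phi_m}\downarrow & & \downarrow{\scriptstyle\phi_n}\\ K_m & \stackrel{\rho}{\longleftarrow} & K_n \end{matrix}$$ that is, $\rho\circ\phi_n\circ\iota=\phi_m$.
   Context: Complexes. Let $R_n$ be a fixed graph with one vertex and $n$ loops (a rose), with $\pi_1(R_n)$ identified with the free group $F_n$ so that the loops correspond to the ordered basis $a_1,\dots,a_n$. A marked graph of rank $n$ is a finite connected graph $\Gamma$ with a homotopy equivalence $g\colon R_n\to\Gamma$; two marked graphs $(g,\Gamma)$, $(g',\Gamma')$ are identified if there is a graph isomorphism $h\colon\Gamma\to\Gamma'$ with $h\circ g$ homotopic to $g'$. The spine of Outer space $K_n$ is the flag simplicial complex whose vertices are the (classes of) marked graphs $(g,\Gamma)$ of rank $n$ with all vertices of $\Gamma$ of valence at least 3 (separating edges are allowed); two distinct vertices are adjacent if one can be obtained from the other by a forest collapse, i.e. collapsing each component of a subforest of the graph to a point and composing the marking with the collapse. Equivalently, a vertex of $K_n$ is a free minimal simplicial action of $F_n$ on a simplicial tree $T$ with no vertices of valence 2 (the universal cover of $\Gamma$), up to equivariant isomorphism. The spine of Auter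 space $L_n$ is defined in the same way, except that each graph has a chosen basepoint vertex $v$ (which is allowed to have valence 2, all other vertices having valence at least 3), and markings, homotopies, isomorphisms and collapses respect basepoints. In rank 1, the circle with no vertices (respectively with the basepoint as only vertex) is regarded as representing the unique vertex of $K_1$ (respectively $L_1$). Maps. The forgetful map $\phi_n\colon L_n\to K_n$ forgets the basepoint (if the basepoint has valence 2, it is no longer considered a vertex). For $m<n$, identify $F_m$ with the subgroup of $F_n$ generated by $a_1,\dots,a_m$, and $R_m$ with the subrose of $R_n$ consisting of the first $m$ petals. The augmentation map $\iota\colon L_m\to L_n$ attaches a bouquet of $n-m$ circles to the basepoint of each marked graph and marks them with the last $n-m$ basis elements $a_{m+1},\dots,a_n$. The restriction map $\rho\colon K_n\to K_m$ sends the vertex given by a tree $T$ to the minimal $F_m$-invariant subtree $\rho(T)\subset T$, i.e. the union of the axes in $T$ of all nontrivial elements of $F_m$, where vertices that have valence 2 in $\rho(T)$ are no longer considered to be vertices. In terms of marked graphs: for a vertex $(g,\Gamma)$ of $K_n$, let $\widehat\Gamma\to\Gamma$ be the covering corresponding to $g_*(F_m)$, let $\widehat g\colon R_m\to\widehat\Gamma$ be the homotopy equivalence lifting $g|_{R_m}$, let $r$ be the canonical retraction of $\widehat\Gamma$ onto its compact core (the smallest connected subgraph containing all nontrivial embedded loops in $\widehat\Gamma$), and let $\widehat\Gamma_0$ be the graph obtained from the compact core by erasing all vertices of valence 2; then $\rho(g,\Gamma)=(r\circ\widehat g,\widehat\Gamma_0)$. Each map is defined on vertices as described and extended simplicially;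 a simplicial map may send adjacent vertices to the same vertex. *)

theory Defs
  imports "Graph_Theory.Bidirected_Digraph" "Graph_Theory.Digraph_Component"
begin

section \<open>Graphs, maps of graphs and homotopies\<close>

text \<open>
  Graphs (loops and multiple edges allowed) are graphs in the sense of Serre: every
  geometric edge is a pair of opposite arcs that are exchanged by the fixed-point-free
  involution \<open>bar\<close>.  In particular the valence of a vertex is its out-degree, so that
  a loop counts twice.
\<close>

record ('v, 'd) sgraph =
  dig :: "('v, 'd) pre_digraph"
  bar :: "'d \<Rightarrow> 'd"

abbreviation gverts :: "('v, 'd) sgraph \<Rightarrow> 'v set" where
  "gverts G \<equiv> verts (dig G)"

abbreviation garcs :: "('v, 'd) sgraph \<Rightarrow> 'd set" where
  "garcs G \<equiv> arcs (dig G)"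

abbreviation gtail :: "('v, 'd) sgraph \<Rightarrow> 'd \<Rightarrow> 'v" where
  "gtail G \<equiv> tail (dig G)"

abbreviation ghead :: "('v, 'd) sgraph \<Rightarrow> 'd \<Rightarrow> 'v" where
  "ghead G \<equiv> head (dig G)"

abbreviation gwalk :: "('v, 'd) sgraph \<Rightarrow> 'v \<Rightarrow> 'd list \<Rightarrow> 'v \<Rightarrow> bool" where
  "gwalk G \<equiv> pre_digraph.awalk (dig G)"

abbreviation valence :: "('v, 'd) sgraph \<Rightarrow> 'v \<Rightarrow> nat" where
  "valence G \<equiv> out_degree (dig G)"

definition finite_connected_graph :: "('v, 'd) sgraph \<Rightarrow> bool" where
  "finite_connected_graph G \<longleftrightarrow>
     bidirected_digraph (dig G) (bar G) \<and> fin_digraph (dig G) \<and> connected (dig G)"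

definition inv_path :: "('v, 'd) sgraph \<Rightarrow> 'd list \<Rightarrow> 'd list" where
  "inv_path G p = rev (map (bar G) p)"

definition reduced :: "('v, 'd) sgraph \<Rightarrow> 'd list \<Rightarrow> bool" where
  "reduced G p \<longleftrightarrow> (\<forall>i. Suc i < length p \<longrightarrow> p ! Suc i \<noteq> bar G (p ! i))"

text \<open>
  Homotopy of edge paths from \<open>u\<close> to \<open>v\<close> relative to their endpoints: the equivalence
  relation generated by inserting a backtracking \<open>d, bar d\<close>.
\<close>

definition backtrack_insertion ::
  "('v, 'd) sgraph \<Rightarrow> 'v \<Rightarrow> 'v \<Rightarrow> 'd list \<Rightarrow> 'd list \<Rightarrow> bool" where
  "backtrack_insertion G u v p q \<longleftrightarrow>
     gwalk G u p v \<and> gwalk G u q v \<and>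
     (\<exists>xs ys d. p = xs @ ys \<and> q = xs @ [d, bar G d] @ ys)"

definition path_homotopic ::
  "('v, 'd) sgraph \<Rightarrow> 'v \<Rightarrow> 'v \<Rightarrow> 'd list \<Rightarrow> 'd list \<Rightarrow> bool" where
  "path_homotopic G u v p q \<longleftrightarrow>
     gwalk G u p v \<and> gwalk G u q v \<and> equivclp (backtrack_insertion G u v) p q"

text \<open>
  A map of graphs is a cellular map: it sends vertices to vertices and arcs to edge paths
  (possibly empty or unreduced), compatibly with reversal.  By cellular approximation these
  maps, up to the homotopies below, represent all continuous maps between the geometric
  realizations up to homotopy.
\<close>

record ('v, 'd, 'w, 'e) gmap =
  vmap :: "'v \<Rightarrow> 'w"
  dmap :: "'d \<Rightarrow> 'e list"

definition map_path :: "('v, 'd, 'w, 'e) gmap \<Rightarrow> 'd list \<Rightarrow> 'e list" where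
  "map_path f p = concat (map (dmap f) p)"

definition is_gmap ::
  "('v, 'd) sgraph \<Rightarrow> ('w, 'e) sgraph \<Rightarrow> ('v, 'd, 'w, 'e) gmap \<Rightarrow> bool" where
  "is_gmap G H f \<longleftrightarrow>
     (\<forall>v \<in> gverts G. vmap f v \<in> gverts H) \<and>
     (\<forall>d \<in> garcs G. gwalk H (vmap f (gtail G d)) (dmap f d) (vmap f (ghead G d)) \<and>
        dmap f (bar G d) = inv_path H (dmap f d))"

definition id_gmap :: "('v, 'd, 'v, 'd) gmap" where
  "id_gmap = \<lparr>vmap = (\<lambda>v. v), dmap = (\<lambda>d. [d])\<rparr>"

definition comp_gmap ::
  "('w, 'e, 'x, 'f) gmap \<Rightarrow> ('v, 'd, 'w, 'e) gmap \<Rightarrow> ('v, 'd, 'x, 'f) gmap"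
  (infixl \<open>\<circ>\<^sub>g\<close> 55) where
  "k \<circ>\<^sub>g f = \<lparr>vmap = vmap k \<circ> vmap f, dmap = map_path k \<circ> dmap f\<rparr>"

text \<open>
  Homotopy relative to a set \<open>B\<close> of vertices: \<open>c v\<close> is the track of the vertex \<open>v\<close>, and
  across each arc the resulting square has to commute up to homotopy of edge paths.
\<close>

definition homotopic_gmaps ::
  "('v, 'd) sgraph \<Rightarrow> ('w, 'e) sgraph \<Rightarrow> 'v set \<Rightarrow>
   ('v, 'd, 'w, 'e) gmap \<Rightarrow> ('v, 'd, 'w, 'e) gmap \<Rightarrow> bool" where
  "homotopic_gmaps G H B f f' \<longleftrightarrow>
     is_gmap G H f \<and> is_gmap G H f' \<and>
     (\<exists>c. (\<forall>v \<in> gverts G. gwalk H (vmap f v) (c v) (vmap f' v)) \<and>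
          (\<forall>b \<in> B. c b = []) \<and>
          (\<forall>d \<in> garcs G.
             path_homotopic H (vmap f (gtail G d)) (vmap f' (ghead G d))
               (dmap f d @ c (ghead G d)) (c (gtail G d) @ dmap f' d)))"

text \<open>
  Homotopy equivalences, with all homotopies relative to \<open>B\<close> and its image
  (\<open>B = {}\<close>: free, \<open>B\<close> a singleton: pointed).
\<close>

definition homotopy_equivalence ::
  "('v, 'd) sgraph \<Rightarrow> ('w, 'e) sgraph \<Rightarrow> 'v set \<Rightarrow> ('v, 'd, 'w, 'e) gmap \<Rightarrow> bool" where
  "homotopy_equivalence G H B f \<longleftrightarrow>
     is_gmap G H f \<and>
     (\<exists>k. is_gmap H G k \<and>
          homotopic_gmaps G G B (k \<circ>\<^sub>g f) id_gmap \<and>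
          homotopic_gmaps H H (vmap f ` B) (f \<circ>\<^sub>g k) id_gmap)"

definition graph_iso ::
  "('v, 'd) sgraph \<Rightarrow> ('w, 'e) sgraph \<Rightarrow> ('v \<Rightarrow> 'w) \<Rightarrow> ('d \<Rightarrow> 'e) \<Rightarrow> bool" where
  "graph_iso G H \<alpha> \<beta> \<longleftrightarrow>
     bij_betw \<alpha> (gverts G) (gverts H) \<and> bij_betw \<beta> (garcs G) (garcs H) \<and>
     (\<forall>d \<in> garcs G. gtail H (\<beta> d) = \<alpha> (gtail G d) \<and> ghead H (\<beta> d) = \<alpha> (ghead G d) \<and>
        bar H (\<beta> d) = \<beta> (bar G d))"

definition iso_gmap :: "('v \<Rightarrow> 'w) \<Rightarrow> ('d \<Rightarrow> 'e) \<Rightarrow> ('v, 'd, 'w, 'e) gmap" where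
  "iso_gmap \<alpha> \<beta> = \<lparr>vmap = \<alpha>, dmap = (\<lambda>d. [\<beta> d])\<rparr>"

text \<open>Simple closed edge paths; going back and forth along one edge is excluded.\<close>

definition embedded_loop :: "('v, 'd) sgraph \<Rightarrow> 'd list \<Rightarrow> bool" where
  "embedded_loop G p \<longleftrightarrow> pre_digraph.cycle (dig G) p \<and> (\<forall>d \<in> set p. bar G d \<notin> set p)"

section \<open>Marked graphs\<close>

text \<open>
  The arcs \<open>(i, True)\<close> and \<open>(i, False)\<close> of the rose are the loop \<open>a\<^sub>i\<close> and its inverse.
  The rose on the first \<open>m\<close> petals is \<open>rose m\<close>, and the restriction of a map
  \<open>g\<close> on \<open>rose n\<close> to it is \<open>g\<close>, regarded as a map on \<open>rose m\<close>.
\<close>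

definition rose :: "nat \<Rightarrow> (unit, nat \<times> bool) sgraph" where
  "rose n =
     \<lparr>dig = \<lparr>verts = {()}, arcs = {1..n} \<times> UNIV, tail = (\<lambda>_. ()), head = (\<lambda>_. ())\<rparr>,
      bar = (\<lambda>(i, s). if i \<in> {1..n} then (i, \<not> s) else (i, s))\<rparr>"

type_synonym ('v, 'd) marking = "(unit, nat \<times> bool, 'v, 'd) gmap"

definition marked_graph :: "nat \<Rightarrow> ('v, 'd) sgraph \<times> ('v, 'd) marking \<Rightarrow> bool" where
  "marked_graph n = (\<lambda>(G, g).
     finite_connected_graph G \<and> homotopy_equivalence (rose n) G {} g)"

definition marked_equiv ::
  "nat \<Rightarrow> ('v, 'd) sgraph \<times> ('v, 'd) marking \<Rightarrow>
   ('w, 'e) sgraph \<times> ('w, 'e) marking \<Rightarrow> bool" where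
  "marked_equiv n = (\<lambda>(G, g) (H, h).
     \<exists>\<alpha> \<beta>. graph_iso G H \<alpha> \<beta> \<and>
       homotopic_gmaps (rose n) H {} (iso_gmap \<alpha> \<beta> \<circ>\<^sub>g g) h)"

definition pointed_marked_graph ::
  "nat \<Rightarrow> ('v, 'd) sgraph \<times> 'v \<times> ('v, 'd) marking \<Rightarrow> bool" where
  "pointed_marked_graph n = (\<lambda>(G, b, g).
     finite_connected_graph G \<and> b \<in> gverts G \<and> vmap g () = b \<and>
     homotopy_equivalence (rose n) G {()} g)"

definition pointed_marked_equiv ::
  "nat \<Rightarrow> ('v, 'd) sgraph \<times> 'v \<times> ('v, 'd) marking \<Rightarrow>
   ('w, 'e) sgraph \<times> 'w \<times> ('w, 'e) marking \<Rightarrow> bool" where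
  "pointed_marked_equiv n = (\<lambda>(G, b, g) (H, c, h).
     \<exists>\<alpha> \<beta>. graph_iso G H \<alpha> \<beta> \<and> \<alpha> b = c \<and>
       homotopic_gmaps (rose n) H {()} (iso_gmap \<alpha> \<beta> \<circ>\<^sub>g g) h)"

text \<open>
  In rank 1 the circle without vertices is encoded as the circle with one placeholder
  vertex (which has valence 2).
\<close>

definition K_graph :: "nat \<Rightarrow> ('v, 'd) sgraph \<times> ('v, 'd) marking \<Rightarrow> bool" where
  "K_graph n = (\<lambda>(G, g).
     marked_graph n (G, g) \<and>
     (if n = 1 then card (gverts G) = 1 else \<forall>v \<in> gverts G. 3 \<le> valence G v))"

definition L_graph :: "nat \<Rightarrow> ('v, 'd) sgraph \<times> 'v \<times> ('v, 'd) marking \<Rightarrow> bool" where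
  "L_graph n = (\<lambda>(G, b, g).
     pointed_marked_graph n (G, b, g) \<and>
     2 \<le> valence G b \<and> (\<forall>v \<in> gverts G - {b}. 3 \<le> valence G v))"

text \<open>
  Vertices of the complexes are equivalence classes.  Since all graphs involved are finite,
  it suffices to collect the representatives whose vertices and arcs are natural numbers;
  the argument of the class functions may live on arbitrary types.
\<close>

type_synonym K_vertex = "((nat, nat) sgraph \<times> (nat, nat) marking) set"

type_synonym L_vertex = "((nat, nat) sgraph \<times> nat \<times> (nat, nat) marking) set"

definition K_class :: "nat \<Rightarrow> ('v, 'd) sgraph \<times> ('v, 'd) marking \<Rightarrow> K_vertex" where
  "K_class n x = {y. K_graph n y \<and> marked_equiv n x y}"

definition L_class :: "nat \<Rightarrow> ('v, 'd) sgraph \<times> 'v \<times> ('v, 'd) marking \<Rightarrow> L_vertex" where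
  "L_class n x = {y. L_graph n y \<and> pointed_marked_equiv n x y}"

definition K_vertices :: "nat \<Rightarrow> K_vertex set" where
  "K_vertices n = K_class n ` {x :: (nat, nat) sgraph \<times> (nat, nat) marking. K_graph n x}"

definition L_vertices :: "nat \<Rightarrow> L_vertex set" where
  "L_vertices n =
     L_class n ` {x :: (nat, nat) sgraph \<times> nat \<times> (nat, nat) marking. L_graph n x}"

section \<open>Forest collapses and the two spines\<close>

definition is_subforest :: "('v, 'd) sgraph \<Rightarrow> 'd set \<Rightarrow> bool" where
  "is_subforest G F \<longleftrightarrow>
     F \<subseteq> garcs G \<and> bar G ` F \<subseteq> F \<and> \<not> (\<exists>p. embedded_loop G p \<and> set p \<subseteq> F)"

definition forest_component :: "('v, 'd) sgraph \<Rightarrow> 'd set \<Rightarrow> 'v \<Rightarrow> 'v set" where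
  "forest_component G F v = {w. \<exists>p. gwalk G v p w \<and> set p \<subseteq> F}"

definition collapse :: "('v, 'd) sgraph \<Rightarrow> 'd set \<Rightarrow> ('v set, 'd) sgraph" where
  "collapse G F =
     \<lparr>dig = \<lparr>verts = forest_component G F ` gverts G, arcs = garcs G - F,
             tail = forest_component G F \<circ> gtail G, head = forest_component G F \<circ> ghead G\<rparr>,
      bar = (\<lambda>d. if d \<in> garcs G - F then bar G d else d)\<rparr>"

definition collapse_gmap :: "('v, 'd) sgraph \<Rightarrow> 'd set \<Rightarrow> ('v, 'd, 'v set, 'd) gmap" where
  "collapse_gmap G F =
     \<lparr>vmap = forest_component G F, dmap = (\<lambda>d. if d \<in> F then [] else [d])\<rparr>"

definition K_collapses_to :: "nat \<Rightarrow> K_vertex \<Rightarrow> K_vertex \<Rightarrow> bool" where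
  "K_collapses_to n X Y \<longleftrightarrow>
     (\<exists>G g F. (G, g) \<in> X \<and> is_subforest G F \<and>
        Y = K_class n (collapse G F, collapse_gmap G F \<circ>\<^sub>g g))"

definition L_collapses_to :: "nat \<Rightarrow> L_vertex \<Rightarrow> L_vertex \<Rightarrow> bool" where
  "L_collapses_to n X Y \<longleftrightarrow>
     (\<exists>G b g F. (G, b, g) \<in> X \<and> is_subforest G F \<and>
        Y = L_class n (collapse G F, forest_component G F b, collapse_gmap G F \<circ>\<^sub>g g))"

definition flag_simplices :: "'a set \<Rightarrow> ('a \<Rightarrow> 'a \<Rightarrow> bool) \<Rightarrow> 'a set set" where
  "flag_simplices V adj =
     {\<sigma>. finite \<sigma> \<and> \<sigma> \<noteq> {} \<and> \<sigma> \<subseteq> V \<and> (\<forall>x \<in> \<sigma>. \<forall>y \<in> \<sigma>. x \<noteq> y \<longrightarrow> adj x y)}"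

definition K_simplices :: "nat \<Rightarrow> K_vertex set set" where
  "K_simplices n =
     flag_simplices (K_vertices n) (\<lambda>X Y. K_collapses_to n X Y \<or> K_collapses_to n Y X)"

definition L_simplices :: "nat \<Rightarrow> L_vertex set set" where
  "L_simplices n =
     flag_simplices (L_vertices n) (\<lambda>X Y. L_collapses_to n X Y \<or> L_collapses_to n Y X)"

section \<open>Erasing vertices of valence 2\<close>

text \<open>
  On a circle all vertices have valence 2; there one placeholder vertex is kept.
\<close>

definition kept_verts :: "('v, 'd) sgraph \<Rightarrow> 'v set" where
  "kept_verts G =
     (let W = {v \<in> gverts G. valence G v \<noteq> 2}
      in if W = {} then {SOME v. v \<in> gverts G} else W)"

text \<open>
  An arc of the new graph is a maximal chain of arcs of the old graph that are joined at
  erased vertices.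
\<close>

definition chains :: "('v, 'd) sgraph \<Rightarrow> 'd list set" where
  "chains G =
     {p. p \<noteq> [] \<and> reduced G p \<and> (\<forall>d \<in> set (tl p). gtail G d \<notin> kept_verts G) \<and>
         (\<exists>u \<in> kept_verts G. \<exists>v \<in> kept_verts G. gwalk G u p v)}"

definition erase :: "('v, 'd) sgraph \<Rightarrow> ('v, 'd list) sgraph" where
  "erase G =
     \<lparr>dig = \<lparr>verts = kept_verts G, arcs = chains G,
             tail = (\<lambda>p. gtail G (hd p)), head = (\<lambda>p. ghead G (last p))\<rparr>,
      bar = (\<lambda>p. if p \<in> chains G then inv_path G p else p)\<rparr>"

text \<open>
  Topologically \<open>erase G\<close> and \<open>G\<close> are the same space; \<open>subdivide\<close> is the identity map of
  this space, as a cellular map from \<open>erase G\<close> to \<open>G\<close>.  As a marking \<open>g\<close> of \<open>G\<close> may take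
  the base vertex to an erased vertex, it has to be replaced by a homotopic one that is
  cellular for \<open>erase G\<close> (unique up to homotopy).
\<close>

definition subdivide :: "('v, 'd list, 'v, 'd) gmap" where
  "subdivide = \<lparr>vmap = (\<lambda>v. v), dmap = (\<lambda>p. p)\<rparr>"

definition erase_marked ::
  "nat \<Rightarrow> ('v, 'd) sgraph \<times> ('v, 'd) marking \<Rightarrow>
   ('v, 'd list) sgraph \<times> ('v, 'd list) marking" where
  "erase_marked n = (\<lambda>(G, g).
     (erase G, SOME g0. is_gmap (rose n) (erase G) g0 \<and>
                        homotopic_gmaps (rose n) G {} (subdivide \<circ>\<^sub>g g0) g))"

section \<open>Forgetful map\<close>

text \<open>
  Maps on equivalence classes are obtained from maps on representatives: the value at a
  class is the unique value taken on its members.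
\<close>

definition forgetful :: "nat \<Rightarrow> L_vertex \<Rightarrow> K_vertex" where
  "forgetful n X = the_elem ((\<lambda>(G, b, g). K_class n (erase_marked n (G, g))) ` X)"

section \<open>Augmentation map\<close>

definition attach_bouquet ::
  "nat \<Rightarrow> nat \<Rightarrow> ('v, 'd) sgraph \<Rightarrow> 'v \<Rightarrow> ('v, 'd + nat \<times> bool) sgraph" where
  "attach_bouquet m n G b =
     \<lparr>dig = \<lparr>verts = gverts G, arcs = Inl ` garcs G \<union> Inr ` ({m<..n} \<times> UNIV),
             tail = case_sum (gtail G) (\<lambda>_. b), head = case_sum (ghead G) (\<lambda>_. b)\<rparr>,
      bar = case_sum (\<lambda>d. Inl (bar G d))
              (\<lambda>(i, s). Inr (if i \<in> {m<..n} then (i, \<not> s) else (i, s)))\<rparr>"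

definition augment_marking ::
  "nat \<Rightarrow> ('v, 'd) marking \<Rightarrow> ('v, 'd + nat \<times> bool) marking" where
  "augment_marking m g =
     \<lparr>vmap = vmap g,
      dmap = (\<lambda>(i, s). if i \<le> m then map Inl (dmap g (i, s)) else [Inr (i, s)])\<rparr>"

definition augmentation :: "nat \<Rightarrow> nat \<Rightarrow> L_vertex \<Rightarrow> L_vertex" where
  "augmentation m n X =
     the_elem ((\<lambda>(G, b, g). L_class n (attach_bouquet m n G b, b, augment_marking m g)) ` X)"

section \<open>Restriction map\<close>

text \<open>
  The covering of \<open>G\<close> corresponding to a subgroup of \<open>\<pi>\<^sub>1(G, u)\<close>.  The subgroup is given as
  a homotopy-invariant set \<open>S\<close> of closed edge paths at \<open>u\<close>.  The vertices of the covering
  are the edge paths starting at \<open>u\<close>, where two such paths \<open>p\<close> and \<open>q\<close> with the same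
  endpoint are identified if \<open>p\<close> followed by the inverse of \<open>q\<close> is in \<open>S\<close>; the covering
  projection takes (the class of) a path to its endpoint and an arc \<open>(X, d)\<close> to \<open>d\<close>.
\<close>

definition path_class :: "('v, 'd) sgraph \<Rightarrow> 'v \<Rightarrow> 'd list set \<Rightarrow> 'd list \<Rightarrow> 'd list set" where
  "path_class G u S p =
     {q. gwalk G u q (pre_digraph.awlast (dig G) u p) \<and> p @ inv_path G q \<in> S}"

definition cover_arcs :: "('v, 'd) sgraph \<Rightarrow> 'v \<Rightarrow> 'd list set \<Rightarrow> ('d list set \<times> 'd) set" where
  "cover_arcs G u S =
     {(path_class G u S p, d) | p d. d \<in> garcs G \<and> gwalk G u p (gtail G d)}"

definition cover_head ::
  "('v, 'd) sgraph \<Rightarrow> 'v \<Rightarrow> 'd list set \<Rightarrow> 'd list set \<times> 'd \<Rightarrow> 'd list set" where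
  "cover_head G u S = (\<lambda>(X, d). \<Union>q \<in> X. path_class G u S (q @ [d]))"

definition covering ::
  "('v, 'd) sgraph \<Rightarrow> 'v \<Rightarrow> 'd list set \<Rightarrow> ('d list set, 'd list set \<times> 'd) sgraph" where
  "covering G u S =
     \<lparr>dig = \<lparr>verts = {path_class G u S p | p v. gwalk G u p v}, arcs = cover_arcs G u S,
             tail = fst, head = cover_head G u S\<rparr>,
      bar = (\<lambda>e. if e \<in> cover_arcs G u S then (cover_head G u S e, bar G (snd e)) else e)\<rparr>"

primrec lift_path ::
  "('x, 'x \<times> 'd) sgraph \<Rightarrow> 'x \<Rightarrow> 'd list \<Rightarrow> ('x \<times> 'd) list" where
  "lift_path C x [] = []"
| "lift_path C x (d # p) = (x, d) # lift_path C (ghead C (x, d)) p"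

text \<open>The subgroup \<open>g\<^sub>*(F\<^sub>m)\<close>, where \<open>F\<^sub>m\<close> is the fundamental group of \<open>rose m\<close>.\<close>

definition image_subgroup :: "nat \<Rightarrow> ('v, 'd) sgraph \<Rightarrow> ('v, 'd) marking \<Rightarrow> 'd list set" where
  "image_subgroup m G g =
     {p. \<exists>w. gwalk (rose m) () w () \<and> path_homotopic G (vmap g ()) (vmap g ()) (map_path g w) p}"

definition restriction_cover ::
  "nat \<Rightarrow> ('v, 'd) sgraph \<times> ('v, 'd) marking \<Rightarrow>
   ('d list set, 'd list set \<times> 'd) sgraph \<times> ('d list set, 'd list set \<times> 'd) marking" where
  "restriction_cover m = (\<lambda>(G, g).
     let S = image_subgroup m G g; C = covering G (vmap g ()) S; x = path_class G (vmap g ()) S []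
     in (C, \<lparr>vmap = (\<lambda>_. x), dmap = (\<lambda>a. lift_path C x (dmap g a))\<rparr>))"

text \<open>
  The smallest connected subgraph containing all embedded loops, written as the
  intersection of all of them.
\<close>

definition core_candidates :: "('v, 'd) sgraph \<Rightarrow> ('v, 'd) pre_digraph set" where
  "core_candidates G =
     {H. subgraph H (dig G) \<and> bar G ` arcs H \<subseteq> arcs H \<and> connected H \<and>
         (\<forall>p. embedded_loop G p \<longrightarrow> set p \<subseteq> arcs H)}"

definition compact_core :: "('v, 'd) sgraph \<Rightarrow> ('v, 'd) sgraph" where
  "compact_core G =
     (let A = (\<Inter>H \<in> core_candidates G. arcs H)
      in \<lparr>dig = \<lparr>verts = (\<Inter>H \<in> core_candidates G. verts H), arcs = A,
                 tail = gtail G, head = ghead G\<rparr>,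
          bar = (\<lambda>d. if d \<in> A then bar G d else d)\<rparr>)"

text \<open>
  The complement of the core consists of trees, each attached to the core at one vertex;
  the retraction collapses each of them to that vertex.
\<close>

definition core_retraction :: "('v, 'd) sgraph \<Rightarrow> ('v, 'd, 'v, 'd) gmap" where
  "core_retraction G =
     \<lparr>vmap = (\<lambda>v. THE u. u \<in> gverts (compact_core G) \<and>
                 (\<exists>p. gwalk G v p u \<and> set p \<inter> garcs (compact_core G) = {})),
      dmap = (\<lambda>d. if d \<in> garcs (compact_core G) then [d] else [])\<rparr>"

definition restriction :: "nat \<Rightarrow> K_vertex \<Rightarrow> K_vertex" where
  "restriction m X =
     the_elem ((\<lambda>x. let (C, g) = restriction_cover m x
                    in K_class m (erase_marked m (compact_core C, core_retraction C \<circ>\<^sub>g g))) ` X)"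

end

theory Submission
  imports Defs "HOL-Library.Countable"
begin

text \<open>
  Let \<open>(G, b, g)\<close> represent a vertex of \<open>L\<^sub>m\<close>, and let \<open>A\<close> be \<open>G\<close> with the bouquet attached
  at \<open>b\<close>.  The base vertex of \<open>A\<close> has valence at least 4, so nothing has to be erased when it
  is forgotten (\<open>forgetful_L_class_trivalent\<close>), and the point is that restricting to \<open>F\<^sub>m\<close>
  gives back \<open>G\<close>.

  Let \<open>(H, h)\<close> be any marked graph equivalent to \<open>A\<close>.  Then \<open>H\<close> contains a copy \<open>K\<close> of \<open>G\<close>, and
  the homotopy between the two markings moves the base vertex along a path \<open>c\<close> of \<open>H\<close>.  As \<open>g\<close>
  is surjective on fundamental groups, the image of \<open>F\<^sub>m\<close> under \<open>h\<close> is the fundamental group of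
  \<open>K\<close>, conjugated by \<open>c\<close>.  Hence \<open>K\<close> lifts isomorphically to the covering \<open>C\<close> of \<open>H\<close> that
  belongs to this subgroup.  The lift is convex (\<open>convex_emb\<close>): a reduced path of \<open>C\<close> with both
  ends in the lift projects to a reduced path that is homotopic to a path in \<open>K\<close>, and since a
  homotopy class contains only one reduced path (\<open>reduced_homotopic_unique\<close>), it runs in \<open>K\<close>.
  So a reduced path that leaves the lift never returns, and \<open>C\<close> is the lift with trees attached.
  As \<open>G\<close> has no vertices of valence 1, the lift is the compact core (\<open>compact_core_eq\<close>), and
  the retraction onto it carries the homotopy between the markings into the core
  (\<open>restriction_cover_core\<close>).  The core with its marking is therefore equivalent to \<open>(G, g)\<close>.

  What remains on both sides of the square is to erase vertices of valence 2.  This respects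
  equivalence of marked graphs (\<open>marked_equiv_erase\<close>), because a graph and the graph with these
  vertices erased have the same reduced paths between kept vertices.

  The maps on classes are given by representatives, so each of these steps is carried out for
  all members of a class, and each class is shown to have a member.
\<close>

section \<open>Edge paths\<close>

abbreviation serre_graph :: "('v, 'd) sgraph \<Rightarrow> bool" where
  "serre_graph G \<equiv> bidirected_digraph (dig G) (bar G)"

lemma serre_wf: "serre_graph G \<Longrightarrow> wf_digraph (dig G)"
  by (simp add: bidirected_digraph_def)

lemma serre_bar_bar [simp]: "serre_graph G \<Longrightarrow> bar G (bar G d) = d"
  by (rule bidirected_digraph.arev_arev)

lemma serre_bar_in [simp]: "serre_graph G \<Longrightarrow> bar G d \<in> garcs G \<longleftrightarrow> d \<in> garcs G"
  by (metis bidirected_digraph.arev_arev bidirected_digraph.arev_in_arcs)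

lemma serre_bar_neq: "serre_graph G \<Longrightarrow> d \<in> garcs G \<Longrightarrow> bar G d \<noteq> d"
  by (rule bidirected_digraph.arev_neq)

lemma serre_tail_bar [simp]: "serre_graph G \<Longrightarrow> d \<in> garcs G \<Longrightarrow> gtail G (bar G d) = ghead G d"
  by (rule bidirected_digraph.tail_arev)

lemma serre_head_bar [simp]: "serre_graph G \<Longrightarrow> d \<in> garcs G \<Longrightarrow> ghead G (bar G d) = gtail G d"
  by (rule bidirected_digraph.head_arev)

lemma serre_tail_in [simp]: "serre_graph G \<Longrightarrow> d \<in> garcs G \<Longrightarrow> gtail G d \<in> gverts G"
  by (rule wf_digraph.tail_in_verts[OF serre_wf])

lemma serre_head_in [simp]: "serre_graph G \<Longrightarrow> d \<in> garcs G \<Longrightarrow> ghead G d \<in> gverts G"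
  by (rule wf_digraph.head_in_verts[OF serre_wf])

lemma serre_graphI:
  assumes "\<And>d. d \<in> garcs G \<Longrightarrow> gtail G d \<in> gverts G"
    and "\<And>d. d \<in> garcs G \<Longrightarrow> bar G d \<in> garcs G"
    and "\<And>d. d \<in> garcs G \<Longrightarrow> bar G d \<noteq> d"
    and "\<And>d. d \<in> garcs G \<Longrightarrow> bar G (bar G d) = d"
    and "\<And>d. d \<in> garcs G \<Longrightarrow> gtail G (bar G d) = ghead G d"
    and "\<And>d. d \<notin> garcs G \<Longrightarrow> bar G d = d"
  shows "serre_graph G"
proof -
  have "ghead G d \<in> gverts G" if "d \<in> garcs G" for d
    using assms(1,2,5) that by metis
  then have "wf_digraph (dig G)"
    using assms(1) by unfold_locales
  then show ?thesis
    using assms by (intro wf_digraph.bidirected_digraphI) auto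
qed

lemma gwalk_Nil [simp]: "gwalk G u [] v \<longleftrightarrow> u = v \<and> u \<in> gverts G"
  by (auto simp: pre_digraph.awalk_def pre_digraph.cas.simps)

lemma gwalk_Cons [simp]:
  assumes "serre_graph G"
  shows "gwalk G u (d # p) v \<longleftrightarrow> d \<in> garcs G \<and> gtail G d = u \<and> gwalk G (ghead G d) p v"
  using wf_digraph.awalk_Cons_iff[OF serre_wf[OF assms]] by metis

lemma gwalk_start: "gwalk G u p v \<Longrightarrow> u \<in> gverts G"
  by (simp add: pre_digraph.awalk_def)

lemma gwalk_end:
  assumes "serre_graph G" "gwalk G u p v"
  shows "v \<in> gverts G"
  using assms(2) by (induction p arbitrary: u) (auto simp: assms(1))

lemma gwalk_append_iff:
  assumes "serre_graph G"
  shows "gwalk G u (p @ q) v \<longleftrightarrow> (\<exists>w. gwalk G u p w \<and> gwalk G w q v)"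
  by (induction p arbitrary: u) (use assms in \<open>auto dest: gwalk_start\<close>)

lemma gwalk_appendI [intro]:
  "serre_graph G \<Longrightarrow> gwalk G u p w \<Longrightarrow> gwalk G w q v \<Longrightarrow> gwalk G u (p @ q) v"
  by (auto simp: gwalk_append_iff)

lemma gwalk_arcs: "gwalk G u p v \<Longrightarrow> set p \<subseteq> garcs G"
  by (simp add: pre_digraph.awalk_def)

lemma gwalk_end_unique:
  assumes "serre_graph G" "gwalk G u p v" "gwalk G u p w"
  shows "v = w"
  using assms(2,3) by (induction p arbitrary: u) (auto simp: assms(1))

lemma gwalk_start_unique:
  assumes "gwalk G u p v" "gwalk G w p v"
  shows "u = w"
  using assms by (cases p) (auto simp: pre_digraph.awalk_def pre_digraph.cas.simps)

lemma awlast_gwalk: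
  assumes "serre_graph G" "gwalk G u p v"
  shows "pre_digraph.awlast (dig G) u p = v"
  using assms wf_digraph.awlast_if_cas[OF serre_wf] by (auto simp: pre_digraph.awalk_def)

lemma inv_path_simps [simp]:
  "inv_path G [] = []"
  "inv_path G (d # p) = inv_path G p @ [bar G d]"
  "inv_path G (p @ q) = inv_path G q @ inv_path G p"
  by (simp_all add: inv_path_def)

lemma inv_path_eq_Nil [simp]: "inv_path G p = [] \<longleftrightarrow> p = []"
  by (simp add: inv_path_def)

lemma inv_path_inv_path [simp]: "serre_graph G \<Longrightarrow> inv_path G (inv_path G p) = p"
  by (induction p) simp_all

lemma set_inv_path: "set (inv_path G p) = bar G ` set p"
  by (simp add: inv_path_def)

lemma gwalk_inv_path:
  assumes "serre_graph G" "gwalk G u p v"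
  shows "gwalk G v (inv_path G p) u"
  using assms(2) by (induction p arbitrary: u) (auto simp: assms(1) gwalk_append_iff)

lemma gwalk_inv_path_iff [simp]:
  "serre_graph G \<Longrightarrow> gwalk G v (inv_path G p) u \<longleftrightarrow> gwalk G u p v"
  by (metis gwalk_inv_path inv_path_inv_path)

section \<open>Homotopy of edge paths\<close>

lemma equivclp_map:
  assumes "equivclp R x y" "\<And>a b. R a b \<Longrightarrow> equivclp S (f a) (f b)"
  shows "equivclp S (f x) (f y)"
  using assms(1)
proof (induction)
  case (step y z)
  then have "equivclp S (f y) (f z)"
    using assms(2) equivclp_sym by metis
  with step.IH show ?case
    by (rule equivclp_trans)
qed simp

lemma path_homotopic_refl [simp]: "path_homotopic G u v p p \<longleftrightarrow> gwalk G u p v"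
  by (simp add: path_homotopic_def)

lemma path_homotopic_sym: "path_homotopic G u v p q \<Longrightarrow> path_homotopic G u v q p"
  by (auto simp: path_homotopic_def intro: equivclp_sym)

lemma path_homotopic_trans [trans]:
  "path_homotopic G u v p q \<Longrightarrow> path_homotopic G u v q r \<Longrightarrow> path_homotopic G u v p r"
  by (auto simp: path_homotopic_def intro: equivclp_trans)

lemma path_homotopic_walks:
  assumes "path_homotopic G u v p q"
  shows "gwalk G u p v" "gwalk G u q v"
  using assms by (simp_all add: path_homotopic_def)

lemma path_homotopic_backtrack:
  assumes "serre_graph G" "gwalk G u (xs @ [d, bar G d] @ ys) v"
  shows "path_homotopic G u v (xs @ [d, bar G d] @ ys) (xs @ ys)"
proof -
  have "gwalk G u (xs @ ys) v"
    using assms by (auto simp: gwalk_append_iff)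
  with assms(2) have "backtrack_insertion G u v (xs @ ys) (xs @ [d, bar G d] @ ys)"
    unfolding backtrack_insertion_def by blast
  then have "equivclp (backtrack_insertion G u v) (xs @ ys) (xs @ [d, bar G d] @ ys)"
    by (rule r_into_equivclp)
  with assms(2) \<open>gwalk G u (xs @ ys) v\<close> show ?thesis
    unfolding path_homotopic_def by (metis equivclp_sym)
qed

lemma path_homotopic_context:
  assumes G: "serre_graph G" and r: "gwalk G u r v" and s: "gwalk G w s x"
    and pq: "path_homotopic G v w p q"
  shows "path_homotopic G u x (r @ p @ s) (r @ q @ s)"
proof -
  have "equivclp (backtrack_insertion G v w) p q"
    using pq by (simp add: path_homotopic_def)
  then have "equivclp (backtrack_insertion G u x) (r @ p @ s) (r @ q @ s)"
  proof (rule equivclp_map[where f = "\<lambda>p. r @ p @ s"])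
    fix a b
    assume "backtrack_insertion G v w a b"
    then obtain xs ys d where "gwalk G v a w" "gwalk G v b w"
      and ab: "a = xs @ ys" "b = xs @ [d, bar G d] @ ys"
      by (auto simp: backtrack_insertion_def)
    then have "gwalk G u (r @ a @ s) x" "gwalk G u (r @ b @ s) x"
      using gwalk_appendI[OF G r gwalk_appendI[OF G _ s]] by blast+
    then have "backtrack_insertion G u x (r @ a @ s) (r @ b @ s)"
      unfolding backtrack_insertion_def ab
      by (metis append.assoc)
    then show "equivclp (backtrack_insertion G u x) (r @ a @ s) (r @ b @ s)"
      by blast
  qed
  then show ?thesis
    using gwalk_appendI[OF G r gwalk_appendI[OF G _ s]] path_homotopic_walks[OF pq]
    by (simp add: path_homotopic_def)
qed

lemma path_homotopic_append_left:
  assumes "serre_graph G" "gwalk G u r v" "path_homotopic G v w p q"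
  shows "path_homotopic G u w (r @ p) (r @ q)"
  using path_homotopic_context[OF assms(1,2) _ assms(3), of "[]" w]
    gwalk_end[OF assms(1) path_homotopic_walks(1)[OF assms(3)]] by simp

lemma path_homotopic_append_right:
  assumes "serre_graph G" "gwalk G v r w" "path_homotopic G u v p q"
  shows "path_homotopic G u w (p @ r) (q @ r)"
  using path_homotopic_context[OF assms(1) _ assms(2,3), of u "[]"]
    gwalk_start[OF path_homotopic_walks(1)[OF assms(3)]] by simp

lemma path_homotopic_append:
  assumes "serre_graph G" "path_homotopic G u v p p'" "path_homotopic G v w q q'"
  shows "path_homotopic G u w (p @ q) (p' @ q')"
  by (meson assms path_homotopic_append_left path_homotopic_append_right path_homotopic_trans
      path_homotopic_walks)

lemma path_homotopic_cancel_right: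
  assumes "serre_graph G" "gwalk G u p v"
  shows "path_homotopic G u u (p @ inv_path G p) []"
  using assms(2)
proof (induction p arbitrary: v rule: rev_induct)
  case (snoc d p)
  then have p: "gwalk G u p (gtail G d)" "d \<in> garcs G" "v = ghead G d"
    using assms(1) by (auto simp: gwalk_append_iff)
  have "path_homotopic G u u (p @ [d, bar G d] @ inv_path G p) (p @ inv_path G p)"
    using p assms(1) by (intro path_homotopic_backtrack) (auto simp: gwalk_append_iff)
  also have "path_homotopic G u u (p @ inv_path G p) []"
    by (rule snoc.IH[OF p(1)])
  finally show ?case by simp
qed (use gwalk_start in simp)

lemma path_homotopic_cancel_left:
  assumes "serre_graph G" "gwalk G u p v"
  shows "path_homotopic G v v (inv_path G p @ p) []"
  using path_homotopic_cancel_right[OF assms(1) gwalk_inv_path[OF assms]] assms(1) by simp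

lemma path_homotopic_inv_path:
  assumes "serre_graph G" "path_homotopic G u v p q"
  shows "path_homotopic G v u (inv_path G p) (inv_path G q)"
proof -
  note w = path_homotopic_walks[OF assms(2)]
  have "path_homotopic G v u (inv_path G q @ p @ inv_path G p) (inv_path G q @ [])"
    by (rule path_homotopic_append_left[OF assms(1) gwalk_inv_path[OF assms(1) w(2)]
          path_homotopic_cancel_right[OF assms(1) w(1)]])
  then have 1: "path_homotopic G v u (inv_path G q) ((inv_path G q @ p) @ inv_path G p)"
    using path_homotopic_sym by fastforce
  have "path_homotopic G v v (inv_path G q @ p) (inv_path G q @ q)"
    using assms w by (intro path_homotopic_append_left) auto
  also have "path_homotopic G v v (inv_path G q @ q) []"
    using assms w by (intro path_homotopic_cancel_left) auto
  finally have "path_homotopic G v u ((inv_path G q @ p) @ inv_path G p) ([] @ inv_path G p)"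
    using assms w by (intro path_homotopic_append_right) auto
  with 1 show ?thesis
    using path_homotopic_trans path_homotopic_sym by fastforce
qed

lemma path_homotopic_swap:
  assumes "serre_graph G" "path_homotopic G u w (p @ r) q" "gwalk G v r w"
  shows "path_homotopic G u v p (q @ inv_path G r)"
proof -
  obtain v' where v': "gwalk G u p v'" "gwalk G v' r w"
    using path_homotopic_walks(1)[OF assms(2)] assms(1) by (auto simp: gwalk_append_iff)
  then have p: "gwalk G u p v"
    using gwalk_start_unique[OF v'(2) assms(3)] by simp
  have "path_homotopic G u v (p @ (r @ inv_path G r)) (p @ [])"
    by (rule path_homotopic_append_left[OF assms(1) p path_homotopic_cancel_right[OF assms(1,3)]])
  then have "path_homotopic G u v p ((p @ r) @ inv_path G r)"
    using path_homotopic_sym by fastforce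
  also have "path_homotopic G u v ((p @ r) @ inv_path G r) (q @ inv_path G r)"
    using assms by (intro path_homotopic_append_right) auto
  finally show ?thesis .
qed

lemma path_homotopic_swap_left:
  assumes "serre_graph G" "path_homotopic G u w (r @ p) q" "gwalk G u r v"
  shows "path_homotopic G v w p (inv_path G r @ q)"
proof -
  have p: "gwalk G v p w"
    using path_homotopic_walks(1)[OF assms(2)] assms(1,3) gwalk_end_unique[OF assms(1)]
    by (auto simp: gwalk_append_iff[OF assms(1)])
  have "path_homotopic G v w ((inv_path G r @ r) @ p) ([] @ p)"
    by (rule path_homotopic_append_right[OF assms(1) p path_homotopic_cancel_left[OF assms(1,3)]])
  moreover have "path_homotopic G v w (inv_path G r @ (r @ p)) (inv_path G r @ q)"
    by (rule path_homotopic_append_left[OF assms(1) gwalk_inv_path[OF assms(1,3)] assms(2)])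
  ultimately show ?thesis
    using path_homotopic_trans path_homotopic_sym by fastforce
qed

lemma path_homotopic_left_cancel:
  assumes "serre_graph G" "path_homotopic G u w (r @ p) (r @ q)" "gwalk G u r v"
  shows "path_homotopic G v w p q"
proof -
  have q: "gwalk G v q w"
    using path_homotopic_walks(2)[OF assms(2)] assms(1,3) gwalk_end_unique[OF assms(1)]
    by (auto simp: gwalk_append_iff[OF assms(1)])
  have "path_homotopic G v w p ((inv_path G r @ r) @ q)"
    using path_homotopic_swap_left[OF assms] by simp
  also have "path_homotopic G v w ((inv_path G r @ r) @ q) ([] @ q)"
    by (rule path_homotopic_append_right[OF assms(1) q path_homotopic_cancel_left[OF assms(1,3)]])
  finally show ?thesis by simp
qed

lemma path_homotopic_right_cancel:
  assumes "serre_graph G" "path_homotopic G u w (p @ r) (q @ r)" "gwalk G v r w"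
  shows "path_homotopic G u v p q"
proof -
  have q: "gwalk G u q v"
    using path_homotopic_walks(2)[OF assms(2)] assms(3) gwalk_start_unique
    unfolding gwalk_append_iff[OF assms(1)] by metis
  have "path_homotopic G u v p (q @ (r @ inv_path G r))"
    using path_homotopic_swap[OF assms] by simp
  also have "path_homotopic G u v (q @ (r @ inv_path G r)) (q @ [])"
    by (rule path_homotopic_append_left[OF assms(1) q path_homotopic_cancel_right[OF assms(1,3)]])
  finally show ?thesis by simp
qed

lemma path_homotopic_cancel_middle:
  assumes "serre_graph G" "gwalk G u p v" "gwalk G w q v" "gwalk G v r x"
  shows "path_homotopic G u x (p @ inv_path G q @ q @ r) (p @ r)"
proof -
  have "path_homotopic G u x (p @ (inv_path G q @ q) @ r) (p @ [] @ r)"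
    by (rule path_homotopic_append_left[OF assms(1,2) path_homotopic_append_right[OF assms(1,4)
          path_homotopic_cancel_left[OF assms(1,3)]]])
  then show ?thesis by simp
qed

section \<open>Reduced edge paths\<close>

lemma reduced_Nil [simp]: "reduced G []"
  by (simp add: reduced_def)

lemma reduced_Cons [simp]:
  "reduced G (d # p) \<longleftrightarrow> reduced G p \<and> (p \<noteq> [] \<longrightarrow> hd p \<noteq> bar G d)"
proof
  assume *: "reduced G (d # p)"
  have "reduced G p"
    unfolding reduced_def
  proof (intro allI impI)
    fix i
    assume "Suc i < length p"
    then show "p ! Suc i \<noteq> bar G (p ! i)"
      using *[unfolded reduced_def, rule_format, of "Suc i"] by simp
  qed
  moreover have "p \<noteq> [] \<longrightarrow> hd p \<noteq> bar G d"
    using *[unfolded reduced_def, rule_format, of 0] by (auto simp: hd_conv_nth)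
  ultimately show "reduced G p \<and> (p \<noteq> [] \<longrightarrow> hd p \<noteq> bar G d)" ..
next
  assume *: "reduced G p \<and> (p \<noteq> [] \<longrightarrow> hd p \<noteq> bar G d)"
  show "reduced G (d # p)"
    unfolding reduced_def
  proof (intro allI impI)
    fix i
    assume i: "Suc i < length (d # p)"
    then show "(d # p) ! Suc i \<noteq> bar G ((d # p) ! i)"
      using * by (cases i) (auto simp: hd_conv_nth reduced_def)
  qed
qed

lemma reduced_append [simp]:
  "reduced G (p @ q) \<longleftrightarrow>
     reduced G p \<and> reduced G q \<and> (p \<noteq> [] \<longrightarrow> q \<noteq> [] \<longrightarrow> hd q \<noteq> bar G (last p))"
  by (induction p) (auto simp: hd_append)

lemma reduced_inv_path:
  assumes "serre_graph G" "reduced G p"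
  shows "reduced G (inv_path G p)"
  using assms(2)
proof (induction p)
  case (Cons d p)
  then show ?case
    using assms(1) by (cases p) auto
qed simp

text \<open>
  The reduced representative of a homotopy class: the arcs are prepended one after the other,
  each cancelling against the first arc of what is already there.
\<close>

definition tighten :: "('v, 'd) sgraph \<Rightarrow> 'd list \<Rightarrow> 'd list" where
  "tighten G p = foldr (\<lambda>d r. if r \<noteq> [] \<and> hd r = bar G d then tl r else d # r) p []"

lemma tighten_simps [simp]:
  "tighten G [] = []"
  "tighten G (d # p) = (if tighten G p \<noteq> [] \<and> hd (tighten G p) = bar G d
     then tl (tighten G p) else d # tighten G p)"
  by (simp_all add: tighten_def)

lemma reduced_tighten [simp]: "reduced G (tighten G p)"
proof (induction p)
  case (Cons d p)
  then show ?case by (cases "tighten G p") auto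
qed simp

lemma tighten_reduced: "reduced G p \<Longrightarrow> tighten G p = p"
  by (induction p) auto

lemma tighten_append_cong: "tighten G q = tighten G q' \<Longrightarrow> tighten G (p @ q) = tighten G (p @ q')"
  by (induction p) auto

text \<open>
  If \<open>bar G d\<close> cancels against a first arc \<open>d\<close> of a reduced path, then the next arc is not
  \<open>bar G d\<close>, so prepending \<open>d\<close> puts the cancelled arc back instead of cancelling further.
\<close>

lemma tighten_backtrack:
  assumes "serre_graph G"
  shows "tighten G (p @ [d, bar G d] @ q) = tighten G (p @ q)"
proof (rule tighten_append_cong)
  have "reduced G (tighten G q)" by simp
  then show "tighten G ([d, bar G d] @ q) = tighten G q"
    using assms by (cases "tighten G q"; cases "tl (tighten G q)") auto
qed

lemma set_tighten: "set (tighten G p) \<subseteq> set p"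
proof (induction p)
  case (Cons d p)
  then show ?case by (cases "tighten G p") auto
qed simp

lemma path_homotopic_tighten:
  assumes "serre_graph G" "gwalk G u p v"
  shows "path_homotopic G u v p (tighten G p)"
  using assms(2)
proof (induction p arbitrary: u)
  case (Cons d p)
  let ?t = "tighten G p"
  have d: "d \<in> garcs G" "gtail G d = u" "gwalk G u [d] (ghead G d)"
    and p: "gwalk G (ghead G d) p v"
    using Cons.prems assms(1) by auto
  have "path_homotopic G u v ([d] @ p) ([d] @ ?t)"
    by (rule path_homotopic_append_left[OF assms(1) d(3) Cons.IH[OF p]])
  then have 1: "path_homotopic G u v (d # p) (d # ?t)" by simp
  show ?case
  proof (cases "?t \<noteq> [] \<and> hd ?t = bar G d")
    case True
    then have t: "?t = bar G d # tl ?t" by (metis list.collapse)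
    have w: "gwalk G u (d # bar G d # tl ?t) v"
      using path_homotopic_walks(2)[OF 1] t by simp
    then have "path_homotopic G u v (d # ?t) (tl ?t)"
      using path_homotopic_backtrack[OF assms(1), of u "[]" d "tl ?t" v] t by simp
    with 1 True show ?thesis
      using path_homotopic_trans by fastforce
  qed (use 1 in auto)
qed simp

lemma tighten_homotopic:
  assumes "serre_graph G" "path_homotopic G u v p q"
  shows "tighten G p = tighten G q"
proof -
  have "equivclp (backtrack_insertion G u v) p q"
    using assms(2) by (simp add: path_homotopic_def)
  then have "equivclp (=) (tighten G p) (tighten G q)"
    by (rule equivclp_map) (auto simp: backtrack_insertion_def tighten_backtrack[OF assms(1), simplified])
  then show ?thesis
    by (induction) auto
qed

lemma reduced_homotopic_unique:
  assumes "serre_graph G" "path_homotopic G u v p q" "reduced G p" "reduced G q"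
  shows "p = q"
  using tighten_homotopic[OF assms(1,2)] assms(3,4) by (simp add: tighten_reduced)

lemma path_homotopic_iff_tighten:
  assumes "serre_graph G" "gwalk G u p v" "gwalk G u q v"
  shows "path_homotopic G u v p q \<longleftrightarrow> tighten G p = tighten G q"
  using assms path_homotopic_tighten path_homotopic_trans path_homotopic_sym tighten_homotopic
  by metis

section \<open>Maps of graphs\<close>

lemma map_path_simps [simp]:
  "map_path f [] = []"
  "map_path f (d # p) = dmap f d @ map_path f p"
  "map_path f (p @ q) = map_path f p @ map_path f q"
  by (simp_all add: map_path_def)

lemma is_gmap_walk:
  assumes "serre_graph G" "serre_graph H" "is_gmap G H f" "gwalk G u p v"
  shows "gwalk H (vmap f u) (map_path f p) (vmap f v)"
  using assms(4)
proof (induction p arbitrary: u)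
  case Nil
  then show ?case using assms(3) by (auto simp: is_gmap_def)
next
  case (Cons d p)
  then show ?case
    using assms(1,2,3) by (auto simp: is_gmap_def gwalk_append_iff)
qed

lemma is_gmap_inv_path:
  assumes "is_gmap G H f" "set p \<subseteq> garcs G"
  shows "map_path f (inv_path G p) = inv_path H (map_path f p)"
  using assms(2) by (induction p) (use assms(1) in \<open>auto simp: is_gmap_def\<close>)

text \<open>
  A backtracking is mapped to an edge path followed by its inverse, which can be contracted arc
  by arc.
\<close>

lemma is_gmap_homotopic:
  assumes "serre_graph G" "serre_graph H" "is_gmap G H f" "path_homotopic G u v p q"
  shows "path_homotopic H (vmap f u) (vmap f v) (map_path f p) (map_path f q)"
proof -
  have "equivclp (backtrack_insertion H (vmap f u) (vmap f v)) (map_path f p) (map_path f q)"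
  proof (rule equivclp_map[where f = "map_path f"])
    show "equivclp (backtrack_insertion G u v) p q"
      using assms(4) by (simp add: path_homotopic_def)
    fix a b
    assume "backtrack_insertion G u v a b"
    then obtain xs ys d where w: "gwalk G u a v" "gwalk G u b v"
      and ab: "a = xs @ ys" "b = xs @ [d, bar G d] @ ys"
      by (auto simp: backtrack_insertion_def)
    have d: "d \<in> garcs G" using gwalk_arcs[OF w(2)] ab by auto
    have bar: "dmap f (bar G d) = inv_path H (dmap f d)"
      using d assms(3) by (auto simp: is_gmap_def)
    have xs: "gwalk G u xs (gtail G d)" and ys: "gwalk G (gtail G d) ys v"
      using w(2) ab assms(1) by (auto simp: gwalk_append_iff)
    have fd: "gwalk H (vmap f (gtail G d)) (dmap f d) (vmap f (ghead G d))"
      using d assms(3) by (auto simp: is_gmap_def)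
    have "path_homotopic H (vmap f u) (vmap f v)
      (map_path f xs @ (dmap f d @ inv_path H (dmap f d)) @ map_path f ys)
      (map_path f xs @ [] @ map_path f ys)"
      by (rule path_homotopic_append_left[OF assms(2) is_gmap_walk[OF assms(1-3) xs]
          path_homotopic_append_right[OF assms(2) is_gmap_walk[OF assms(1-3) ys]
          path_homotopic_cancel_right[OF assms(2) fd]]])
    then have "path_homotopic H (vmap f u) (vmap f v) (map_path f a) (map_path f b)"
      using ab bar by (simp add: path_homotopic_sym)
    then show "equivclp (backtrack_insertion H (vmap f u) (vmap f v)) (map_path f a) (map_path f b)"
      by (simp add: path_homotopic_def)
  qed
  then show ?thesis
    using assms by (auto simp: path_homotopic_def intro!: is_gmap_walk[OF assms(1-3)])
qed

lemma is_gmapD: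
  assumes "is_gmap G H f"
  shows "v \<in> gverts G \<Longrightarrow> vmap f v \<in> gverts H"
    and "d \<in> garcs G \<Longrightarrow> gwalk H (vmap f (gtail G d)) (dmap f d) (vmap f (ghead G d))"
    and "d \<in> garcs G \<Longrightarrow> dmap f (bar G d) = inv_path H (dmap f d)"
  using assms by (auto simp: is_gmap_def)

lemma comp_gmap_simps [simp]:
  "vmap (k \<circ>\<^sub>g f) v = vmap k (vmap f v)"
  "dmap (k \<circ>\<^sub>g f) d = map_path k (dmap f d)"
  by (simp_all add: comp_gmap_def)

lemma map_path_comp_gmap [simp]: "map_path (k \<circ>\<^sub>g f) p = map_path k (map_path f p)"
  by (induction p) simp_all

lemma comp_gmap_assoc: "h \<circ>\<^sub>g k \<circ>\<^sub>g f = h \<circ>\<^sub>g (k \<circ>\<^sub>g f)"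
  by (rule gmap.equality) (auto simp: fun_eq_iff)

lemma id_gmap_simps [simp]: "vmap id_gmap v = v" "dmap id_gmap d = [d]"
  by (simp_all add: id_gmap_def)

lemma map_path_id_gmap [simp]: "map_path id_gmap p = p"
  by (induction p) simp_all

lemma is_gmap_comp:
  assumes "serre_graph H" "serre_graph K" "is_gmap G H f" "is_gmap H K k"
  shows "is_gmap G K (k \<circ>\<^sub>g f)"
  using assms(3,4) is_gmap_walk[OF assms(1,2,4)] is_gmap_inv_path[OF assms(4)]
  by (fastforce simp: is_gmap_def dest: gwalk_arcs)

lemma is_gmap_id: "serre_graph G \<Longrightarrow> is_gmap G G id_gmap"
  by (auto simp: is_gmap_def)

section \<open>Homotopies of maps\<close>

text \<open>
  The track \<open>c\<close> of the vertices is made explicit, as the track of the base vertex is the path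
  along which subgroups of the fundamental group get conjugated.
\<close>

definition homotopy_along ::
  "('v, 'd) sgraph \<Rightarrow> ('w, 'e) sgraph \<Rightarrow> ('v \<Rightarrow> 'e list) \<Rightarrow>
   ('v, 'd, 'w, 'e) gmap \<Rightarrow> ('v, 'd, 'w, 'e) gmap \<Rightarrow> bool" where
  "homotopy_along G H c f f' \<longleftrightarrow> is_gmap G H f \<and> is_gmap G H f' \<and>
     (\<forall>v \<in> gverts G. gwalk H (vmap f v) (c v) (vmap f' v)) \<and>
     (\<forall>d \<in> garcs G. path_homotopic H (vmap f (gtail G d)) (vmap f' (ghead G d))
        (dmap f d @ c (ghead G d)) (c (gtail G d) @ dmap f' d))"

lemma homotopic_gmaps_iff:
  "homotopic_gmaps G H B f f' \<longleftrightarrow> (\<exists>c. homotopy_along G H c f f' \<and> (\<forall>b \<in> B. c b = []))"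
  unfolding homotopic_gmaps_def homotopy_along_def by blast

lemma homotopy_alongD:
  assumes "homotopy_along G H c f f'"
  shows "is_gmap G H f" "is_gmap G H f'"
    and "v \<in> gverts G \<Longrightarrow> gwalk H (vmap f v) (c v) (vmap f' v)"
    and "d \<in> garcs G \<Longrightarrow> path_homotopic H (vmap f (gtail G d)) (vmap f' (ghead G d))
      (dmap f d @ c (ghead G d)) (c (gtail G d) @ dmap f' d)"
  using assms by (auto simp: homotopy_along_def)

lemma homotopic_gmapsI:
  assumes "is_gmap G H f" "is_gmap G H f'"
    "\<And>v. v \<in> gverts G \<Longrightarrow> gwalk H (vmap f v) (c v) (vmap f' v)"
    "\<And>b. b \<in> B \<Longrightarrow> c b = []"
    "\<And>d. d \<in> garcs G \<Longrightarrow> path_homotopic H (vmap f (gtail G d)) (vmap f' (ghead G d))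
               (dmap f d @ c (ghead G d)) (c (gtail G d) @ dmap f' d)"
  shows "homotopic_gmaps G H B f f'"
  using assms by (auto simp: homotopic_gmaps_def)

lemma homotopic_gmaps_is_gmap:
  assumes "homotopic_gmaps G H B f f'"
  shows "is_gmap G H f" "is_gmap G H f'"
  using assms by (auto simp: homotopic_gmaps_def)

text \<open>
  The squares over the arcs of \<open>p\<close> are pasted together.
\<close>

lemma homotopic_gmaps_path:
  assumes "serre_graph G" "serre_graph H" and c: "homotopy_along G H c f f'" and p: "gwalk G u p v"
  shows "path_homotopic H (vmap f u) (vmap f' v) (map_path f p @ c v) (c u @ map_path f' p)"
  using p
proof (induction p arbitrary: u)
  case Nil
  then show ?case using homotopy_alongD(3)[OF c] by auto
next
  case (Cons e p)
  then have e: "e \<in> garcs G" "gtail G e = u" and p: "gwalk G (ghead G e) p v"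
    using assms(1) by auto
  have "path_homotopic H (vmap f u) (vmap f' v) (dmap f e @ (map_path f p @ c v))
      (dmap f e @ (c (ghead G e) @ map_path f' p))"
    by (rule path_homotopic_append_left[OF assms(2) is_gmapD(2)[OF homotopy_alongD(1)[OF c] e(1), unfolded e(2)]
        Cons.IH[OF p]])
  also have "path_homotopic H (vmap f u) (vmap f' v) (dmap f e @ (c (ghead G e) @ map_path f' p))
      ((c u @ dmap f' e) @ map_path f' p)"
    using path_homotopic_append_right[OF assms(2) is_gmap_walk[OF assms(1,2) homotopy_alongD(2)[OF c] p]
        homotopy_alongD(4)[OF c e(1)]] e(2)
    by simp
  finally show ?case by simp
qed

lemma homotopic_gmaps_refl:
  assumes "is_gmap G H f"
  shows "homotopic_gmaps G H B f f"
proof (rule homotopic_gmapsI[where c = "\<lambda>_. []"])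
qed (use assms in \<open>auto simp: is_gmap_def\<close>)

text \<open>Homotopies see only the values of maps on the vertices and arcs of the domain.\<close>

lemma homotopic_gmaps_eq:
  assumes "is_gmap G H f" "is_gmap G H f'"
    "\<And>v. v \<in> gverts G \<Longrightarrow> vmap f v = vmap f' v" "\<And>d. d \<in> garcs G \<Longrightarrow> dmap f d = dmap f' d"
    "serre_graph G"
  shows "homotopic_gmaps G H B f f'"
proof (rule homotopic_gmapsI[where c = "\<lambda>_. []"])
qed (use assms in \<open>auto simp: is_gmap_def\<close>)

lemma homotopic_gmaps_sym:
  assumes "serre_graph G" "serre_graph H" "homotopic_gmaps G H B f f'"
  shows "homotopic_gmaps G H B f' f"
proof -
  from assms(3) obtain c where hom: "homotopy_along G H c f f'"
    and B: "\<forall>b \<in> B. c b = []"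
    unfolding homotopic_gmaps_iff by blast
  note f = homotopy_alongD(1,2)[OF hom] and c = homotopy_alongD(3)[OF hom]
    and d = homotopy_alongD(4)[OF hom]
  show ?thesis
  proof (rule homotopic_gmapsI[where c = "\<lambda>v. inv_path H (c v)"])
    fix e
    assume e: "e \<in> garcs G"
    let ?t = "gtail G e" and ?h = "ghead G e"
    have t: "gwalk H (vmap f ?t) (c ?t) (vmap f' ?t)" and h: "gwalk H (vmap f ?h) (c ?h) (vmap f' ?h)"
      using c e assms(1) by auto
    have fe: "gwalk H (vmap f' ?t) (dmap f' e) (vmap f' ?h)"
      using f(2) e by (auto simp: is_gmap_def)
    have 1: "path_homotopic H (vmap f ?t) (vmap f ?h) (dmap f e)
        ((c ?t @ dmap f' e) @ inv_path H (c ?h))"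
      by (rule path_homotopic_swap[OF assms(2) d[OF e] h])
    have "path_homotopic H (vmap f' ?t) (vmap f ?h) (inv_path H (c ?t) @ dmap f e)
        (inv_path H (c ?t) @ ((c ?t @ dmap f' e) @ inv_path H (c ?h)))"
      using 1 t assms(2) by (intro path_homotopic_append_left) auto
    moreover have "path_homotopic H (vmap f' ?t) (vmap f ?h)
        ((inv_path H (c ?t) @ c ?t) @ (dmap f' e @ inv_path H (c ?h)))
        ([] @ (dmap f' e @ inv_path H (c ?h)))"
      by (rule path_homotopic_append_right[OF assms(2)
          gwalk_appendI[OF assms(2) fe gwalk_inv_path[OF assms(2) h]]
          path_homotopic_cancel_left[OF assms(2) t]])
    ultimately have "path_homotopic H (vmap f' ?t) (vmap f ?h) (inv_path H (c ?t) @ dmap f e)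
        (dmap f' e @ inv_path H (c ?h))"
      using path_homotopic_trans by fastforce
    then show "path_homotopic H (vmap f' ?t) (vmap f ?h)
        (dmap f' e @ inv_path H (c ?h)) (inv_path H (c ?t) @ dmap f e)"
      by (rule path_homotopic_sym)
  qed (use f c B assms(2) in auto)
qed

lemma homotopic_gmaps_trans:
  assumes "serre_graph G" "serre_graph H" "homotopic_gmaps G H B f f'" "homotopic_gmaps G H B f' f''"
  shows "homotopic_gmaps G H B f f''"
proof -
  from assms(3) obtain c where hom: "homotopy_along G H c f f'"
    and B: "\<forall>b \<in> B. c b = []"
    unfolding homotopic_gmaps_iff by blast
  note f = homotopy_alongD(1,2)[OF hom] and c = homotopy_alongD(3)[OF hom]
    and d = homotopy_alongD(4)[OF hom]
  from assms(4) obtain c' where hom': "homotopy_along G H c' f' f''"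
    and B': "\<forall>b \<in> B. c' b = []"
    unfolding homotopic_gmaps_iff by blast
  note f' = homotopy_alongD(2)[OF hom'] and c' = homotopy_alongD(3)[OF hom']
    and d' = homotopy_alongD(4)[OF hom']
  show ?thesis
  proof (rule homotopic_gmapsI[where c = "\<lambda>v. c v @ c' v"])
    fix e
    assume e: "e \<in> garcs G"
    let ?t = "gtail G e" and ?h = "ghead G e"
    have t: "?t \<in> gverts G" and h: "?h \<in> gverts G"
      using e assms(1) by auto
    have "path_homotopic H (vmap f ?t) (vmap f'' ?h) ((dmap f e @ c ?h) @ c' ?h)
       ((c ?t @ dmap f' e) @ c' ?h)"
      by (rule path_homotopic_append_right[OF assms(2) c'[OF h] d[OF e]])
    moreover have "path_homotopic H (vmap f ?t) (vmap f'' ?h) (c ?t @ (dmap f' e @ c' ?h))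
       (c ?t @ (c' ?t @ dmap f'' e))"
      by (rule path_homotopic_append_left[OF assms(2) c[OF t] d'[OF e]])
    ultimately show "path_homotopic H (vmap f ?t) (vmap f'' ?h)
        (dmap f e @ c ?h @ c' ?h) ((c ?t @ c' ?t) @ dmap f'' e)"
      using path_homotopic_trans by fastforce
  qed (use f f' c c' B B' assms(2) in auto)
qed

lemma homotopic_gmaps_comp_left:
  assumes "serre_graph G" "serre_graph H" "serre_graph K" "is_gmap H K k" "homotopic_gmaps G H B f f'"
  shows "homotopic_gmaps G K B (k \<circ>\<^sub>g f) (k \<circ>\<^sub>g f')"
proof -
  from assms(5) obtain c where hom: "homotopy_along G H c f f'"
    and B: "\<forall>b \<in> B. c b = []"
    unfolding homotopic_gmaps_iff by blast
  note f = homotopy_alongD(1,2)[OF hom] and c = homotopy_alongD(3)[OF hom]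
    and d = homotopy_alongD(4)[OF hom]
  show ?thesis
  proof (rule homotopic_gmapsI[where c = "\<lambda>v. map_path k (c v)"])
    fix e
    assume "e \<in> garcs G"
    from is_gmap_homotopic[OF assms(2-4) d[OF this]]
    show "path_homotopic K (vmap (k \<circ>\<^sub>g f) (gtail G e)) (vmap (k \<circ>\<^sub>g f') (ghead G e))
        (dmap (k \<circ>\<^sub>g f) e @ map_path k (c (ghead G e))) (map_path k (c (gtail G e)) @ dmap (k \<circ>\<^sub>g f') e)"
      by simp
  qed (use f c B assms is_gmap_comp is_gmap_walk[OF assms(2-4)] in auto)
qed

lemma homotopic_gmaps_comp_right:
  assumes "serre_graph G" "serre_graph H" "serre_graph K" "is_gmap G H f"
    "homotopic_gmaps H K (vmap f ` B) k k'"
  shows "homotopic_gmaps G K B (k \<circ>\<^sub>g f) (k' \<circ>\<^sub>g f)"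
proof -
  from assms(5) obtain c where hom: "homotopy_along H K c k k'"
    and B: "\<forall>b \<in> vmap f ` B. c b = []"
    unfolding homotopic_gmaps_iff by blast
  note k = homotopy_alongD(1,2)[OF hom] and c = homotopy_alongD(3)[OF hom]
    and d = homotopy_alongD(4)[OF hom]
  show ?thesis
  proof (rule homotopic_gmapsI[where c = "\<lambda>v. c (vmap f v)"])
    fix e
    assume "e \<in> garcs G"
    from homotopic_gmaps_path[OF assms(2,3) hom is_gmapD(2)[OF assms(4) this]]
    show "path_homotopic K (vmap (k \<circ>\<^sub>g f) (gtail G e)) (vmap (k' \<circ>\<^sub>g f) (ghead G e))
        (dmap (k \<circ>\<^sub>g f) e @ c (vmap f (ghead G e))) (c (vmap f (gtail G e)) @ dmap (k' \<circ>\<^sub>g f) e)"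
      by simp
  next
    show "is_gmap G K (k \<circ>\<^sub>g f)" "is_gmap G K (k' \<circ>\<^sub>g f)"
      using k assms(2-4) by (auto intro: is_gmap_comp)
  qed (use c B is_gmapD(1)[OF assms(4)] in auto)
qed

lemma homotopic_gmaps_free: "homotopic_gmaps G H B f f' \<Longrightarrow> homotopic_gmaps G H {} f f'"
  by (auto simp: homotopic_gmaps_def)

lemma homotopy_equivalence_free: "homotopy_equivalence G H B f \<Longrightarrow> homotopy_equivalence G H {} f"
  unfolding homotopy_equivalence_def by (auto dest: homotopic_gmaps_free)

section \<open>Isomorphisms of graphs and equivalence of marked graphs\<close>

lemma connected_iff_gwalk:
  assumes "wf_digraph D" "symmetric D"
  shows "connected D \<longleftrightarrow>
    verts D \<noteq> {} \<and> (\<forall>u \<in> verts D. \<forall>v \<in> verts D. \<exists>p. pre_digraph.awalk D u p v)"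
  unfolding connected_def strongly_connected_def
  by (simp add: wf_digraph.reachable_mk_symmetric_eq[OF assms] wf_digraph.reachable_awalk[OF assms(1)])

lemma serre_symmetric: "serre_graph G \<Longrightarrow> symmetric (dig G)"
  unfolding symmetric_conv by (metis serre_bar_in serre_head_bar serre_tail_bar)

lemma serre_connected_iff:
  assumes "serre_graph G"
  shows "connected (dig G) \<longleftrightarrow>
    gverts G \<noteq> {} \<and> (\<forall>u \<in> gverts G. \<forall>v \<in> gverts G. \<exists>p. gwalk G u p v)"
  by (rule connected_iff_gwalk[OF serre_wf[OF assms] serre_symmetric[OF assms]])

lemma iso_gmap_simps [simp]:
  "vmap (iso_gmap \<alpha> \<beta>) v = \<alpha> v" "dmap (iso_gmap \<alpha> \<beta>) d = [\<beta> d]"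
  by (simp_all add: iso_gmap_def)

lemma map_path_iso_gmap [simp]: "map_path (iso_gmap \<alpha> \<beta>) p = map \<beta> p"
  by (induction p) simp_all

lemma iso_gmap_comp: "iso_gmap \<alpha>' \<beta>' \<circ>\<^sub>g iso_gmap \<alpha> \<beta> = iso_gmap (\<alpha>' \<circ> \<alpha>) (\<beta>' \<circ> \<beta>)"
  by (rule gmap.equality) (auto simp: fun_eq_iff)

lemma graph_isoD:
  assumes "graph_iso G H \<alpha> \<beta>"
  shows "bij_betw \<alpha> (gverts G) (gverts H)" "bij_betw \<beta> (garcs G) (garcs H)"
    and "v \<in> gverts G \<Longrightarrow> \<alpha> v \<in> gverts H"
    and "d \<in> garcs G \<Longrightarrow> \<beta> d \<in> garcs H"
    and "d \<in> garcs G \<Longrightarrow> gtail H (\<beta> d) = \<alpha> (gtail G d)"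
    and "d \<in> garcs G \<Longrightarrow> ghead H (\<beta> d) = \<alpha> (ghead G d)"
    and "d \<in> garcs G \<Longrightarrow> bar H (\<beta> d) = \<beta> (bar G d)"
  using assms by (auto simp: graph_iso_def bij_betw_apply)

lemma graph_iso_walk:
  assumes "serre_graph G" "serre_graph H" "graph_iso G H \<alpha> \<beta>" "gwalk G u p v"
  shows "gwalk H (\<alpha> u) (map \<beta> p) (\<alpha> v)"
  using assms(4) by (induction p arbitrary: u) (auto simp: assms(1,2) graph_isoD[OF assms(3)])

lemma graph_iso_inv_path:
  assumes "graph_iso G H \<alpha> \<beta>" "set p \<subseteq> garcs G"
  shows "map \<beta> (inv_path G p) = inv_path H (map \<beta> p)"
  using assms(2) by (induction p) (auto simp: graph_isoD[OF assms(1)])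

lemma is_gmap_iso:
  assumes "serre_graph G" "serre_graph H" "graph_iso G H \<alpha> \<beta>"
  shows "is_gmap G H (iso_gmap \<alpha> \<beta>)"
  using assms by (auto simp: is_gmap_def graph_isoD[OF assms(3)])

lemma graph_iso_id: "graph_iso G G (\<lambda>v. v) (\<lambda>d. d)"
  by (auto simp: graph_iso_def bij_betw_def)

lemma graph_iso_comp:
  assumes "graph_iso G H \<alpha> \<beta>" "graph_iso H K \<alpha>' \<beta>'"
  shows "graph_iso G K (\<alpha>' \<circ> \<alpha>) (\<beta>' \<circ> \<beta>)"
  using assms unfolding graph_iso_def
  by (auto intro: bij_betw_trans simp: bij_betw_apply)

lemma graph_iso_inverse:
  assumes "serre_graph G" "graph_iso G H \<alpha> \<beta>"
  obtains \<alpha>' \<beta>' where "graph_iso H G \<alpha>' \<beta>'"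
    "\<And>v. v \<in> gverts G \<Longrightarrow> \<alpha>' (\<alpha> v) = v" "\<And>d. d \<in> garcs G \<Longrightarrow> \<beta>' (\<beta> d) = d"
    "\<And>v. v \<in> gverts H \<Longrightarrow> \<alpha> (\<alpha>' v) = v" "\<And>d. d \<in> garcs H \<Longrightarrow> \<beta> (\<beta>' d) = d"
proof -
  note iso = graph_isoD[OF assms(2)]
  let ?\<alpha> = "the_inv_into (gverts G) \<alpha>" and ?\<beta> = "the_inv_into (garcs G) \<beta>"
  have \<alpha>: "inj_on \<alpha> (gverts G)" "\<alpha> ` gverts G = gverts H"
    and \<beta>: "inj_on \<beta> (garcs G)" "\<beta> ` garcs G = garcs H"
    using iso(1,2) by (auto simp: bij_betw_def)
  have 1: "?\<alpha> (\<alpha> v) = v" if "v \<in> gverts G" for v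
    using \<alpha> that by (simp add: the_inv_into_f_f)
  have 2: "?\<beta> (\<beta> d) = d" if "d \<in> garcs G" for d
    using \<beta> that by (simp add: the_inv_into_f_f)
  have 3: "\<alpha> (?\<alpha> v) = v" if "v \<in> gverts H" for v
    using \<alpha> that by (metis f_the_inv_into_f)
  have 4: "\<beta> (?\<beta> d) = d" if "d \<in> garcs H" for d
    using \<beta> that by (metis f_the_inv_into_f)
  have "graph_iso H G ?\<alpha> ?\<beta>"
    unfolding graph_iso_def
  proof (intro conjI ballI)
    fix e
    assume "e \<in> garcs H"
    then obtain d where "d \<in> garcs G" "e = \<beta> d"
      using \<beta> by auto
    then show "gtail G (?\<beta> e) = ?\<alpha> (gtail H e)" "ghead G (?\<beta> e) = ?\<alpha> (ghead H e)"
      "bar G (?\<beta> e) = ?\<beta> (bar H e)"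
      using 1 2 iso assms(1) by auto
  qed (intro bij_betw_the_inv_into iso)+
  then show thesis
    using that 1 2 3 4 by blast
qed

lemma graph_iso_valence:
  assumes "graph_iso G H \<alpha> \<beta>" "v \<in> gverts G" "serre_graph G"
  shows "valence H (\<alpha> v) = valence G v"
proof -
  note iso = graph_isoD[OF assms(1)]
  have "out_arcs (dig H) (\<alpha> v) = \<beta> ` out_arcs (dig G) v"
  proof
    show "out_arcs (dig H) (\<alpha> v) \<subseteq> \<beta> ` out_arcs (dig G) v"
    proof
      fix e
      assume e: "e \<in> out_arcs (dig H) (\<alpha> v)"
      then obtain d where d: "d \<in> garcs G" "e = \<beta> d"
        using iso(2) by (auto simp: bij_betw_def)
      then have "\<alpha> (gtail G d) = \<alpha> v"
        using e iso by auto
      then have "gtail G d = v"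
        using iso(1) assms d by (auto simp: bij_betw_def inj_on_def)
      then show "e \<in> \<beta> ` out_arcs (dig G) v"
        using d by auto
    qed
  qed (use iso in auto)
  moreover have "inj_on \<beta> (out_arcs (dig G) v)"
    using iso(2) by (auto simp: bij_betw_def inj_on_def)
  ultimately show ?thesis
    by (simp add: out_degree_def card_image)
qed

lemma finite_connected_graph_iso:
  assumes "finite_connected_graph G" "serre_graph H" "graph_iso G H \<alpha> \<beta>"
  shows "finite_connected_graph H"
proof -
  note iso = graph_isoD[OF assms(3)]
  have G: "serre_graph G" "fin_digraph (dig G)" "connected (dig G)"
    using assms(1) by (auto simp: finite_connected_graph_def)
  have \<alpha>: "\<alpha> ` gverts G = gverts H" and \<beta>: "\<beta> ` garcs G = garcs H"
    using iso(1,2) by (auto simp: bij_betw_def)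
  have "fin_digraph (dig H)"
  proof (rule wf_digraph.fin_digraphI[OF serre_wf[OF assms(2)]])
    show "finite (gverts H)"
      using finite_imageI[OF fin_digraph.finite_verts[OF G(2)], of \<alpha>] unfolding \<alpha> .
    show "finite (garcs H)"
      using finite_imageI[OF fin_digraph.finite_arcs[OF G(2)], of \<beta>] unfolding \<beta> .
  qed
  moreover have conn: "gverts G \<noteq> {}" "\<And>u v. u \<in> gverts G \<Longrightarrow> v \<in> gverts G \<Longrightarrow> \<exists>p. gwalk G u p v"
    using G(3) unfolding serre_connected_iff[OF G(1)] by auto
  have "connected (dig H)"
    unfolding serre_connected_iff[OF assms(2)]
  proof (intro conjI ballI)
    show "gverts H \<noteq> {}"
      using \<alpha> conn(1) by blast
    fix u v
    assume "u \<in> gverts H" "v \<in> gverts H"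
    then obtain u' v' where uv: "u' \<in> gverts G" "v' \<in> gverts G" "u = \<alpha> u'" "v = \<alpha> v'"
      using \<alpha> by blast
    with conn(2) obtain p where "gwalk G u' p v'"
      by blast
    then show "\<exists>p. gwalk H u p v"
      using graph_iso_walk[OF G(1) assms(2,3)] uv by blast
  qed
  ultimately show ?thesis
    using assms(2) by (simp add: finite_connected_graph_def)
qed

lemma iso_homotopic_sym:
  assumes "serre_graph R" "serre_graph G" "serre_graph H" "graph_iso G H \<alpha> \<beta>"
    "is_gmap R G g" "homotopic_gmaps R H B (iso_gmap \<alpha> \<beta> \<circ>\<^sub>g g) h"
  obtains \<alpha>' \<beta>' where "graph_iso H G \<alpha>' \<beta>'" "\<And>v. v \<in> gverts G \<Longrightarrow> \<alpha>' (\<alpha> v) = v"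
    "homotopic_gmaps R G B (iso_gmap \<alpha>' \<beta>' \<circ>\<^sub>g h) g"
proof -
  obtain \<alpha>' \<beta>' where inv: "graph_iso H G \<alpha>' \<beta>'"
    "\<And>v. v \<in> gverts G \<Longrightarrow> \<alpha>' (\<alpha> v) = v" "\<And>d. d \<in> garcs G \<Longrightarrow> \<beta>' (\<beta> d) = d"
    using graph_iso_inverse[OF assms(2,4)] by metis
  note i = is_gmap_iso[OF assms(2,3,4)] and i' = is_gmap_iso[OF assms(3,2) inv(1)]
  have ig: "is_gmap R H (iso_gmap \<alpha> \<beta> \<circ>\<^sub>g g)"
    using assms i is_gmap_comp by blast
  have "homotopic_gmaps R G B (iso_gmap \<alpha>' \<beta>' \<circ>\<^sub>g h) (iso_gmap \<alpha>' \<beta>' \<circ>\<^sub>g (iso_gmap \<alpha> \<beta> \<circ>\<^sub>g g))"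
    by (rule homotopic_gmaps_comp_left[OF assms(1,3,2) i' homotopic_gmaps_sym[OF assms(1,3,6)]])
  moreover have "homotopic_gmaps R G B (iso_gmap \<alpha>' \<beta>' \<circ>\<^sub>g (iso_gmap \<alpha> \<beta> \<circ>\<^sub>g g)) g"
  proof (rule homotopic_gmaps_eq)
    show "is_gmap R G (iso_gmap \<alpha>' \<beta>' \<circ>\<^sub>g (iso_gmap \<alpha> \<beta> \<circ>\<^sub>g g))"
      by (rule is_gmap_comp[OF assms(3,2) ig i'])
    fix d
    assume "d \<in> garcs R"
    then have "set (dmap g d) \<subseteq> garcs G"
      using is_gmapD(2)[OF assms(5)] gwalk_arcs by fast
    then show "dmap (iso_gmap \<alpha>' \<beta>' \<circ>\<^sub>g (iso_gmap \<alpha> \<beta> \<circ>\<^sub>g g)) d = dmap g d"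
      using inv(3) by (auto intro!: map_idI)
  qed (use assms inv is_gmapD(1)[OF assms(5)] in auto)
  ultimately have "homotopic_gmaps R G B (iso_gmap \<alpha>' \<beta>' \<circ>\<^sub>g h) g"
    using homotopic_gmaps_trans assms by blast
  with inv that show thesis by blast
qed

lemma iso_homotopic_trans:
  assumes "serre_graph R" "serre_graph H" "serre_graph K"
    "homotopic_gmaps R H B (iso_gmap \<alpha> \<beta> \<circ>\<^sub>g g) h"
    "graph_iso H K \<alpha>' \<beta>'" "homotopic_gmaps R K B (iso_gmap \<alpha>' \<beta>' \<circ>\<^sub>g h) k"
  shows "homotopic_gmaps R K B (iso_gmap (\<alpha>' \<circ> \<alpha>) (\<beta>' \<circ> \<beta>) \<circ>\<^sub>g g) k"
proof -
  have "homotopic_gmaps R K B (iso_gmap \<alpha>' \<beta>' \<circ>\<^sub>g (iso_gmap \<alpha> \<beta> \<circ>\<^sub>g g)) (iso_gmap \<alpha>' \<beta>' \<circ>\<^sub>g h)"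
    by (rule homotopic_gmaps_comp_left[OF assms(1-3) is_gmap_iso[OF assms(2,3,5)] assms(4)])
  from homotopic_gmaps_trans[OF assms(1,3) this assms(6)]
  show ?thesis by (simp add: comp_gmap_assoc flip: iso_gmap_comp)
qed

lemma rose_simps [simp]:
  "gverts (rose n) = {()}" "garcs (rose n) = {1..n} \<times> UNIV"
  by (simp_all add: rose_def)

lemma serre_rose [simp]: "serre_graph (rose n)"
  by (rule serre_graphI) (auto simp: rose_def split: if_splits)

lemma marked_equiv_sym:
  assumes "serre_graph G" "serre_graph H" "is_gmap (rose n) G g" "marked_equiv n (G, g) (H, h)"
  shows "marked_equiv n (H, h) (G, g)"
proof -
  from assms(4) obtain \<alpha> \<beta> where iso: "graph_iso G H \<alpha> \<beta>"
    and h: "homotopic_gmaps (rose n) H {} (iso_gmap \<alpha> \<beta> \<circ>\<^sub>g g) h"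
    unfolding marked_equiv_def prod.case by blast
  obtain \<alpha>' \<beta>' where "graph_iso H G \<alpha>' \<beta>'" "\<And>v. v \<in> gverts G \<Longrightarrow> \<alpha>' (\<alpha> v) = v"
    "homotopic_gmaps (rose n) G {} (iso_gmap \<alpha>' \<beta>' \<circ>\<^sub>g h) g"
    by (rule iso_homotopic_sym[OF serre_rose assms(1,2) iso assms(3) h]) (rule that)
  then show ?thesis
    unfolding marked_equiv_def prod.case by blast
qed

lemma marked_equiv_trans:
  assumes "serre_graph H" "serre_graph K"
    "marked_equiv n (G, g) (H, h)" "marked_equiv n (H, h) (K, k)"
  shows "marked_equiv n (G, g) (K, k)"
proof -
  from assms(3,4) obtain \<alpha> \<beta> \<alpha>' \<beta>' where
    1: "graph_iso G H \<alpha> \<beta>" "homotopic_gmaps (rose n) H {} (iso_gmap \<alpha> \<beta> \<circ>\<^sub>g g) h" and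
    2: "graph_iso H K \<alpha>' \<beta>'" "homotopic_gmaps (rose n) K {} (iso_gmap \<alpha>' \<beta>' \<circ>\<^sub>g h) k"
    unfolding marked_equiv_def prod.case by blast
  show ?thesis
    using graph_iso_comp[OF 1(1) 2(1)] iso_homotopic_trans[OF serre_rose assms(1,2) 1(2) 2]
    unfolding marked_equiv_def prod.case by blast
qed

lemma pointed_marked_equiv_refl:
  assumes "serre_graph G" "is_gmap (rose n) G g"
  shows "pointed_marked_equiv n (G, b, g) (G, b, g)"
proof -
  have "homotopic_gmaps (rose n) G {()} (iso_gmap (\<lambda>v. v) (\<lambda>d. d) \<circ>\<^sub>g g) g"
    using assms is_gmap_comp[OF assms(1,1) assms(2) is_gmap_iso[OF assms(1,1) graph_iso_id]]
    by (intro homotopic_gmaps_eq) auto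
  then show ?thesis
    unfolding pointed_marked_equiv_def using graph_iso_id by fast
qed

lemma pointed_marked_equiv_sym:
  assumes "serre_graph G" "serre_graph H" "is_gmap (rose n) G g" "b \<in> gverts G"
    "pointed_marked_equiv n (G, b, g) (H, c, h)"
  shows "pointed_marked_equiv n (H, c, h) (G, b, g)"
proof -
  from assms(5) obtain \<alpha> \<beta> where iso: "graph_iso G H \<alpha> \<beta>" "\<alpha> b = c"
    and h: "homotopic_gmaps (rose n) H {()} (iso_gmap \<alpha> \<beta> \<circ>\<^sub>g g) h"
    unfolding pointed_marked_equiv_def prod.case by blast
  obtain \<alpha>' \<beta>' where "graph_iso H G \<alpha>' \<beta>'" "\<And>v. v \<in> gverts G \<Longrightarrow> \<alpha>' (\<alpha> v) = v"
    "homotopic_gmaps (rose n) G {()} (iso_gmap \<alpha>' \<beta>' \<circ>\<^sub>g h) g"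
    by (rule iso_homotopic_sym[OF serre_rose assms(1,2) iso(1) assms(3) h]) (rule that)
  then show ?thesis
    using iso(2) assms(4) unfolding pointed_marked_equiv_def prod.case by blast
qed

lemma pointed_marked_equiv_trans:
  assumes "serre_graph H" "serre_graph K"
    "pointed_marked_equiv n (G, b, g) (H, c, h)" "pointed_marked_equiv n (H, c, h) (K, d, k)"
  shows "pointed_marked_equiv n (G, b, g) (K, d, k)"
proof -
  from assms(3,4) obtain \<alpha> \<beta> \<alpha>' \<beta>' where
    1: "graph_iso G H \<alpha> \<beta>" "homotopic_gmaps (rose n) H {()} (iso_gmap \<alpha> \<beta> \<circ>\<^sub>g g) h" "\<alpha> b = c" and
    2: "graph_iso H K \<alpha>' \<beta>'" "homotopic_gmaps (rose n) K {()} (iso_gmap \<alpha>' \<beta>' \<circ>\<^sub>g h) k" "\<alpha>' c = d"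
    unfolding pointed_marked_equiv_def prod.case by blast
  have "(\<alpha>' \<circ> \<alpha>) b = d" using 1(3) 2(3) by simp
  then show ?thesis
    using graph_iso_comp[OF 1(1) 2(1)] iso_homotopic_trans[OF serre_rose assms(1,2) 1(2) 2(1,2)]
    unfolding pointed_marked_equiv_def prod.case by blast
qed

lemma pointed_marked_equiv_free:
  "pointed_marked_equiv n (G, b, g) (H, c, h) \<Longrightarrow> marked_equiv n (G, g) (H, h)"
  unfolding pointed_marked_equiv_def marked_equiv_def prod.case
  by (blast dest: homotopic_gmaps_free)

text \<open>
  A homotopy inverse is obtained by composing with the inverse isomorphism.  The two
  isomorphisms are inverse to each other only on vertices and arcs, so their composition is
  replaced by the identity up to homotopy.
\<close>

lemma homotopy_equivalence_iso:
  assumes "serre_graph R" "serre_graph G" "serre_graph H" "graph_iso G H \<alpha> \<beta>"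
    "homotopy_equivalence R G B f" "B \<subseteq> gverts R"
  shows "homotopy_equivalence R H B (iso_gmap \<alpha> \<beta> \<circ>\<^sub>g f)"
proof -
  let ?i = "iso_gmap \<alpha> \<beta>"
  obtain \<alpha>' \<beta>' where inv: "graph_iso H G \<alpha>' \<beta>'"
    "\<And>v. v \<in> gverts G \<Longrightarrow> \<alpha>' (\<alpha> v) = v" "\<And>d. d \<in> garcs G \<Longrightarrow> \<beta>' (\<beta> d) = d"
    "\<And>v. v \<in> gverts H \<Longrightarrow> \<alpha> (\<alpha>' v) = v" "\<And>d. d \<in> garcs H \<Longrightarrow> \<beta> (\<beta>' d) = d"
    by (rule graph_iso_inverse[OF assms(2,4)]) (rule that)
  let ?j = "iso_gmap \<alpha>' \<beta>'"
  note i = is_gmap_iso[OF assms(2-4)] and j = is_gmap_iso[OF assms(3,2) inv(1)]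
  obtain k where f: "is_gmap R G f" and k: "is_gmap G R k"
    and kf: "homotopic_gmaps R R B (k \<circ>\<^sub>g f) id_gmap"
    and fk: "homotopic_gmaps G G (vmap f ` B) (f \<circ>\<^sub>g k) id_gmap"
    using assms(5) by (auto simp: homotopy_equivalence_def)
  have if': "is_gmap R H (?i \<circ>\<^sub>g f)" by (rule is_gmap_comp[OF assms(2,3) f i])
  have kj: "is_gmap H R (k \<circ>\<^sub>g ?j)" by (rule is_gmap_comp[OF assms(2,1) j k])
  have fB: "vmap f ` B \<subseteq> gverts G"
    using assms(6) is_gmapD(1)[OF f] by blast
  have "homotopic_gmaps R R B (k \<circ>\<^sub>g ?j \<circ>\<^sub>g (?i \<circ>\<^sub>g f)) (k \<circ>\<^sub>g f)"
  proof (rule homotopic_gmaps_eq)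
    show "is_gmap R R (k \<circ>\<^sub>g ?j \<circ>\<^sub>g (?i \<circ>\<^sub>g f))" by (rule is_gmap_comp[OF assms(3,1) if' kj])
    show "is_gmap R R (k \<circ>\<^sub>g f)" by (rule is_gmap_comp[OF assms(2,1) f k])
    fix d
    assume "d \<in> garcs R"
    then have "set (dmap f d) \<subseteq> garcs G"
      using is_gmapD(2)[OF f] gwalk_arcs by fast
    then have "map (\<beta>' \<circ> \<beta>) (dmap f d) = dmap f d"
      using inv(3) by (auto intro!: map_idI)
    then show "dmap (k \<circ>\<^sub>g ?j \<circ>\<^sub>g (?i \<circ>\<^sub>g f)) d = dmap (k \<circ>\<^sub>g f) d"
      by simp
  qed (use assms(1) inv is_gmapD(1)[OF f] in auto)
  from homotopic_gmaps_trans[OF assms(1,1) this kf]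
  have 1: "homotopic_gmaps R R B (k \<circ>\<^sub>g ?j \<circ>\<^sub>g (?i \<circ>\<^sub>g f)) id_gmap" .
  have jB: "\<alpha>' ` (vmap (?i \<circ>\<^sub>g f) ` B) = vmap f ` B"
    using fB inv(2) by (force simp: image_image)
  have "homotopic_gmaps G H (vmap f ` B) (?i \<circ>\<^sub>g (f \<circ>\<^sub>g k)) (?i \<circ>\<^sub>g id_gmap)"
    by (rule homotopic_gmaps_comp_left[OF assms(2,2,3) i fk])
  then have "homotopic_gmaps H H (vmap (?i \<circ>\<^sub>g f) ` B) (?i \<circ>\<^sub>g (f \<circ>\<^sub>g k) \<circ>\<^sub>g ?j) (?i \<circ>\<^sub>g id_gmap \<circ>\<^sub>g ?j)"
    using jB by (intro homotopic_gmaps_comp_right[OF assms(3,2,3) j]) simp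
  moreover have "homotopic_gmaps H H (vmap (?i \<circ>\<^sub>g f) ` B) (?i \<circ>\<^sub>g id_gmap \<circ>\<^sub>g ?j) id_gmap"
  proof (rule homotopic_gmaps_eq)
    show "is_gmap H H (?i \<circ>\<^sub>g id_gmap \<circ>\<^sub>g ?j)"
      by (intro is_gmap_comp[of G] is_gmap_id assms i j)
  qed (use assms(3) inv is_gmap_id in auto)
  ultimately have "homotopic_gmaps H H (vmap (?i \<circ>\<^sub>g f) ` B) (?i \<circ>\<^sub>g f \<circ>\<^sub>g (k \<circ>\<^sub>g ?j)) id_gmap"
    using homotopic_gmaps_trans[OF assms(3,3)] by (simp add: comp_gmap_assoc)
  with 1 if' kj show ?thesis
    unfolding homotopy_equivalence_def by blast
qed

lemma K_graph_serre: "K_graph n (G, g) \<Longrightarrow> serre_graph G"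
  and K_graph_gmap: "K_graph n (G, g) \<Longrightarrow> is_gmap (rose n) G g"
  by (auto simp: K_graph_def marked_graph_def finite_connected_graph_def homotopy_equivalence_def)

lemma L_graph_serre: "L_graph n (G, b, g) \<Longrightarrow> serre_graph G"
  and L_graph_gmap: "L_graph n (G, b, g) \<Longrightarrow> is_gmap (rose n) G g"
  and L_graph_base: "L_graph n (G, b, g) \<Longrightarrow> b \<in> gverts G"
  and L_graph_base_eq: "L_graph n (G, b, g) \<Longrightarrow> vmap g () = b"
  by (auto simp: L_graph_def pointed_marked_graph_def finite_connected_graph_def
      homotopy_equivalence_def)

lemma K_class_eq:
  assumes "serre_graph G" "serre_graph H" "is_gmap (rose n) G g" "marked_equiv n (G, g) (H, h)"
  shows "K_class n (G, g) = K_class n (H, h)"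
proof -
  have "marked_equiv n (G, g) (K, k) \<longleftrightarrow> marked_equiv n (H, h) (K, k)" if "K_graph n (K, k)"
    for K :: "(nat, nat) sgraph" and k
    using marked_equiv_trans[OF assms(1) K_graph_serre[OF that] marked_equiv_sym[OF assms]]
      marked_equiv_trans[OF assms(2) K_graph_serre[OF that] assms(4)] by blast
  then show ?thesis
    by (auto simp: K_class_def)
qed

lemma L_class_eq:
  assumes "serre_graph G" "serre_graph H" "is_gmap (rose n) G g" "b \<in> gverts G"
    "pointed_marked_equiv n (G, b, g) (H, c, h)"
  shows "L_class n (G, b, g) = L_class n (H, c, h)"
proof -
  have "pointed_marked_equiv n (G, b, g) (K, d, k) \<longleftrightarrow> pointed_marked_equiv n (H, c, h) (K, d, k)"
    if "L_graph n (K, d, k)" for K :: "(nat, nat) sgraph" and d k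
    using pointed_marked_equiv_trans[OF assms(1) L_graph_serre[OF that]
        pointed_marked_equiv_sym[OF assms]]
      pointed_marked_equiv_trans[OF assms(2) L_graph_serre[OF that] assms(5)] by blast
  then show ?thesis
    by (auto simp: L_class_def)
qed

section \<open>Embedded loops\<close>

lemma gwalk_nth_tail:
  assumes "serre_graph G" "gwalk G u p v" "Suc i < length p"
  shows "gtail G (p ! Suc i) = ghead G (p ! i)"
proof -
  have p: "p = take i p @ p ! i # p ! Suc i # drop (Suc (Suc i)) p"
    using assms(3) by (metis Cons_nth_drop_Suc Suc_lessD id_take_nth_drop)
  have "gwalk G u (take i p @ p ! i # p ! Suc i # drop (Suc (Suc i)) p) v"
    using assms(2) p by simp
  then show ?thesis
    using assms(1) by (auto simp: gwalk_append_iff)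
qed

lemma gwalk_last_head:
  assumes "serre_graph G" "gwalk G u p v" "p \<noteq> []"
  shows "ghead G (last p) = v"
  using assms(2,3) by (induction p arbitrary: u) (auto simp: assms(1) split: if_splits)

lemma gwalk_hd_tail:
  assumes "serre_graph G" "gwalk G u p v" "p \<noteq> []"
  shows "gtail G (hd p) = u"
  using assms by (cases p) auto

lemma closed_gwalk_nth_head:
  assumes "serre_graph G" "gwalk G u p u" "i < length p"
  shows "ghead G (p ! i) = gtail G (p ! (Suc i mod length p))"
proof (cases "Suc i < length p")
  case True
  then show ?thesis using gwalk_nth_tail[OF assms(1,2) True] by simp
next
  case False
  with assms(3) have i: "Suc i = length p" by simp
  have "p \<noteq> []" using i by auto
  moreover from this have "p ! i = last p" "p ! 0 = hd p"
    by (simp_all add: last_conv_nth hd_conv_nth flip: i)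
  ultimately show ?thesis
    using gwalk_last_head[OF assms(1,2)] gwalk_hd_tail[OF assms(1,2)] i by simp
qed

text \<open>
  The vertices of a closed path without the first one are a rotation of the tails of its arcs.
\<close>

lemma embedded_loop_iff:
  assumes "serre_graph G"
  shows "embedded_loop G p \<longleftrightarrow> p \<noteq> [] \<and> (\<exists>u. gwalk G u p u) \<and> distinct (map (gtail G) p) \<and>
    (\<forall>d \<in> set p. bar G d \<notin> set p)"
proof -
  have "distinct (tl (pre_digraph.awalk_verts (dig G) u p)) \<longleftrightarrow> distinct (map (gtail G) p)"
    if "gwalk G u p u" "p \<noteq> []" for u
  proof -
    have "pre_digraph.awalk_verts (dig G) u p = map (gtail G) p @ [gtail G (hd p)]"
      using gwalk_last_head[OF assms that] gwalk_hd_tail[OF assms that] that(2)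
      by (simp add: pre_digraph.awalk_verts_conv)
    moreover have "tl (xs @ [hd xs]) = rotate1 xs" if "xs \<noteq> []" for xs :: "'a list"
      using that by (cases xs) auto
    ultimately have "tl (pre_digraph.awalk_verts (dig G) u p) = rotate1 (map (gtail G) p)"
      using that(2) by (metis hd_map list.map_disc_iff)
    then show ?thesis by simp
  qed
  then show ?thesis
    unfolding embedded_loop_def pre_digraph.cycle_def by blast
qed

text \<open>
  If an arc and its inverse both occur in a closed path with distinct vertices, then each of
  them is the cyclic successor of the other, so the path is a backtracking of length 2.
\<close>

lemma embedded_loopI:
  assumes "serre_graph G" "gwalk G u p u" "p \<noteq> []" "distinct (map (gtail G) p)"
    "\<And>d. p \<noteq> [d, bar G d]"
  shows "embedded_loop G p"
proof -
  let ?n = "length p"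
  have succ: "j = Suc i mod ?n" if ij: "i < ?n" "j < ?n" "p ! j = bar G (p ! i)" for i j
  proof -
    have "p ! i \<in> garcs G"
      using gwalk_arcs[OF assms(2)] ij by auto
    then have "gtail G (p ! j) = gtail G (p ! (Suc i mod ?n))"
      using closed_gwalk_nth_head[OF assms(1,2) ij(1)] ij assms(1) by simp
    moreover have "Suc i mod ?n < ?n" using assms(3) by simp
    ultimately show ?thesis
      using assms(4) ij(2) by (metis distinct_conv_nth length_map nth_map)
  qed
  have "bar G d \<notin> set p" if "d \<in> set p" for d
  proof
    assume "bar G d \<in> set p"
    with that obtain i j where ij: "i < ?n" "j < ?n" "p ! i = d" "p ! j = bar G d"
      by (metis in_set_conv_nth)
    have d: "d \<in> garcs G" using gwalk_arcs[OF assms(2)] that by auto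
    have j: "j = Suc i mod ?n" using succ[of i j] ij by simp
    have i: "i = Suc j mod ?n" using succ[of j i] ij assms(1) by simp
    have "i = Suc (Suc i mod ?n) mod ?n"
      using i unfolding j .
    then have "(i + 2) mod ?n = (i + 0) mod ?n"
      using ij(1) by (simp add: mod_Suc_eq)
    then have "?n dvd 2"
      by (metis add_diff_cancel_left' diff_zero mod_eq_dvd_iff_nat le_add1 Nat.add_0_right)
    then have "?n \<le> 2" by (simp add: dvd_imp_le)
    moreover have "?n \<noteq> 1" using ij serre_bar_neq[OF assms(1) d] by (metis less_one)
    ultimately have n: "?n = 2" using assms(3) by (cases p) (auto simp: le_Suc_eq numeral_2_eq_2)
    then obtain a b where p: "p = [a, b]"
      by (auto simp: length_Suc_conv numeral_2_eq_2)
    have "i \<noteq> j" using ij serre_bar_neq[OF assms(1) d] by metis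
    then have "i = 0 \<and> j = 1 \<or> i = 1 \<and> j = 0"
      using ij(1,2) unfolding n by linarith
    then have "a = d \<and> b = bar G d \<or> a = bar G d \<and> b = d"
      using ij(3,4) p by auto
    then show False
      using assms(1) assms(5)[of a] p by auto
  qed
  then show ?thesis
    using assms by (auto simp: embedded_loop_iff)
qed

text \<open>
  The walk \<open>t\<close> shrinks to a path without repeated vertices that uses only arcs of \<open>t\<close>, and the
  arc \<open>e\<close> closes it up.
\<close>

lemma embedded_loop_through_arc:
  assumes G: "serre_graph G" and e: "e \<in> garcs G"
    and t: "gwalk G (ghead G e) t (gtail G e)" "e \<notin> set t" "bar G e \<notin> set t"
  obtains p where "embedded_loop G p" "e \<in> set p"
proof -
  let ?t = "wf_digraph.awalk_to_apath (dig G) t"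
  note wf = serre_wf[OF G]
  have path: "pre_digraph.apath (dig G) (ghead G e) ?t (gtail G e)"
    by (rule wf_digraph.apath_awalk_to_apath[OF wf t(1)])
  have sub: "set ?t \<subseteq> set t"
    by (rule wf_digraph.awalk_to_apath_subset[OF wf t(1)])
  have w: "gwalk G (ghead G e) ?t (gtail G e)"
    and dist: "distinct (pre_digraph.awalk_verts (dig G) (ghead G e) ?t)"
    using path by (auto simp: pre_digraph.apath_def)
  have "embedded_loop G (e # ?t)"
  proof (rule embedded_loopI[OF G])
    show "gwalk G (gtail G e) (e # ?t) (gtail G e)"
      using G e w by simp
    show "distinct (map (gtail G) (e # ?t))"
      using dist gwalk_last_head[OF G w]
      by (cases "?t = []") (auto simp: pre_digraph.awalk_verts_conv)
    show "e # ?t \<noteq> [d, bar G d]" for d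
      using t(3) sub by auto
  qed simp
  then show thesis
    using that by (metis list.set_intros(1))
qed

text \<open>
  A maximal embedded path that starts with the arc \<open>e\<close> can be prolonged by a further arc, as
  there are no vertices of valence 1, and this arc has to lead back to the path.
\<close>

lemma lasso:
  assumes K: "serre_graph K" and fin: "finite (gverts K)"
    and val: "\<forall>v \<in> gverts K. 2 \<le> valence K v" and e: "e \<in> garcs K"
  obtains (loop) p where "embedded_loop K p" "e \<in> set p"
  | (stem) p q d where "embedded_loop K p" "d \<in> set p" "gwalk K (ghead K e) q (gtail K d)"
      "e \<notin> set q" "bar K e \<notin> set q"
proof (cases "gtail K e = ghead K e")
  case True
  show thesis
    by (rule embedded_loop_through_arc[OF K e, of "[]"]) (use K e True loop in auto)
next
  case False
  \<comment> \<open>\<open>e\<close> followed by \<open>q\<close> is a reduced path without repeated vertices\<close>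
  define P where "P q \<longleftrightarrow> reduced K (e # q) \<and> (\<exists>z. gwalk K (gtail K e) (e # q) z \<and>
    distinct (map (gtail K) (e # q) @ [z]))" for q
  have "P []"
    using False K e by (auto simp: P_def)
  moreover have "length q < Suc (card (gverts K))" if "P q" for q
  proof -
    from that obtain z where z: "gwalk K (gtail K e) (e # q) z"
      "distinct (map (gtail K) (e # q) @ [z])"
      by (auto simp: P_def)
    have "set (map (gtail K) (e # q) @ [z]) \<subseteq> gverts K"
      using gwalk_end[OF K z(1)] gwalk_arcs[OF z(1)] serre_tail_in[OF K] by auto
    then have "card (set (map (gtail K) (e # q) @ [z])) \<le> card (gverts K)"
      by (rule card_mono[OF fin])
    then show ?thesis
      using distinct_card[OF z(2)] by simp
  qed
  ultimately obtain q where q: "P q" and max: "\<And>q'. P q' \<Longrightarrow> length q' \<le> length q"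
    using ex_has_greatest_nat[of P "[]" length "Suc (card (gverts K))"] by (metis less_imp_le)
  then obtain z where red: "reduced K (e # q)" and z: "gwalk K (gtail K e) (e # q) z"
    and dist: "distinct (map (gtail K) (e # q) @ [z])"
    by (auto simp: P_def)
  have qw: "gwalk K (ghead K e) q z" using z K by simp
  have eq: "e \<notin> set q" using dist by auto
  have beq: "bar K e \<notin> set q"
  proof
    assume b: "bar K e \<in> set q"
    then obtain c q' where qc: "q = c # q'" by (cases q) auto
    then have "gtail K c = gtail K (bar K e)"
      using qw K e by simp
    then have "c = bar K e"
      using b dist qc by auto
    then show False using red qc by simp
  qed
  let ?f = "last (e # q)"
  have f: "?f \<in> garcs K" "ghead K ?f = z"
    using subsetD[OF gwalk_arcs[OF z] last_in_set] gwalk_last_head[OF K z]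
    by (simp_all del: last.simps)
  have "\<not> out_arcs (dig K) z \<subseteq> {bar K ?f}"
  proof
    assume "out_arcs (dig K) z \<subseteq> {bar K ?f}"
    then have "valence K z \<le> card {bar K ?f}"
      unfolding out_degree_def by (rule card_mono[rotated]) simp
    then show False using bspec[OF val gwalk_end[OF K z]] by simp
  qed
  then obtain d where "d \<in> out_arcs (dig K) z" and "d \<noteq> bar K ?f"
    by blast
  then have d: "d \<in> garcs K" "gtail K d = z" "d \<noteq> bar K ?f"
    by simp_all
  have zd: "gwalk K (gtail K e) (e # q @ [d]) (ghead K d)"
    using qw d e K by (auto simp: gwalk_append_iff)
  have redd: "reduced K (e # q @ [d])"
    using red d(3) by (auto split: if_splits)
  have "\<not> P (q @ [d])" using max[of "q @ [d]"] by auto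
  then have "\<not> distinct (map (gtail K) (e # q @ [d]) @ [ghead K d])"
    using zd redd by (auto simp: P_def)
  then have ret: "ghead K d \<in> set (map (gtail K) (e # q @ [d]))"
    using dist d(2) by auto
  then obtain g where "g \<in> set (e # q @ [d])" and g: "gtail K g = ghead K d"
    by (metis (no_types, lifting) image_iff list.set_map)
  then obtain xs ys where split: "e # q @ [d] = xs @ g # ys"
    by (meson split_list)
  have lw: "gwalk K (gtail K g) (g # ys) (gtail K g)"
    using zd g K unfolding split gwalk_append_iff[OF K] by auto
  have "embedded_loop K (g # ys)"
  proof (rule embedded_loopI[OF K lw])
    have "distinct (map (gtail K) (e # q @ [d]))"
      using dist d(2) by simp
    then show "distinct (map (gtail K) (g # ys))"
      unfolding split by simp
    have "reduced K (g # ys)"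
      using redd unfolding split by simp
    then show "g # ys \<noteq> [c, bar K c]" for c
      by auto
  qed simp
  show thesis
  proof (cases xs)
    case Nil
    with split have "e = g" by simp
    then show thesis
      using loop[OF \<open>embedded_loop K (g # ys)\<close>] by simp
  next
    case (Cons e' xs')
    with split have xs: "q @ [d] = xs' @ g # ys" by simp
    then have "set xs' \<subseteq> set q"
      by (cases ys rule: rev_cases) auto
    moreover have "gwalk K (ghead K e) xs' (gtail K g)"
      using zd K unfolding split Cons using split Cons by (auto simp: gwalk_append_iff)
    ultimately show thesis
      using stem[OF \<open>embedded_loop K (g # ys)\<close>, of g xs'] eq beq by auto
  qed
qed

section \<open>The compact core\<close>

definition subgraph_on :: "('v, 'd) sgraph \<Rightarrow> 'v set \<Rightarrow> 'd set \<Rightarrow> ('v, 'd) sgraph" where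
  "subgraph_on G V E =
     \<lparr>dig = \<lparr>verts = V, arcs = E, tail = gtail G, head = ghead G\<rparr>,
      bar = (\<lambda>d. if d \<in> E then bar G d else d)\<rparr>"

definition closed_subgraph :: "('v, 'd) sgraph \<Rightarrow> 'v set \<Rightarrow> 'd set \<Rightarrow> bool" where
  "closed_subgraph G V E \<longleftrightarrow>
     V \<subseteq> gverts G \<and> E \<subseteq> garcs G \<and> (\<forall>d \<in> E. gtail G d \<in> V \<and> bar G d \<in> E)"

text \<open>
  Reduced paths take the role of geodesics.
\<close>

definition convex_subgraph :: "('v, 'd) sgraph \<Rightarrow> 'v set \<Rightarrow> 'd set \<Rightarrow> bool" where
  "convex_subgraph G V E \<longleftrightarrow> closed_subgraph G V E \<and>
     (\<forall>u \<in> V. \<forall>v \<in> V. \<forall>p. gwalk G u p v \<longrightarrow> reduced G p \<longrightarrow> set p \<subseteq> E)"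

lemma subgraph_on_simps [simp]:
  "gverts (subgraph_on G V E) = V" "garcs (subgraph_on G V E) = E"
  "gtail (subgraph_on G V E) = gtail G" "ghead (subgraph_on G V E) = ghead G"
  "d \<in> E \<Longrightarrow> bar (subgraph_on G V E) d = bar G d"
  by (simp_all add: subgraph_on_def)

lemma closed_subgraphD:
  assumes "closed_subgraph G V E"
  shows "v \<in> V \<Longrightarrow> v \<in> gverts G" "d \<in> E \<Longrightarrow> d \<in> garcs G" "d \<in> E \<Longrightarrow> gtail G d \<in> V"
    "d \<in> E \<Longrightarrow> bar G d \<in> E"
  using assms by (auto simp: closed_subgraph_def)

lemma closed_subgraph_bar_iff:
  assumes "serre_graph G" "closed_subgraph G V E"
  shows "bar G d \<in> E \<longleftrightarrow> d \<in> E"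
  using closed_subgraphD(4)[OF assms(2)] serre_bar_bar[OF assms(1)] by metis

lemma closed_subgraph_head:
  assumes "serre_graph G" "closed_subgraph G V E" "d \<in> E"
  shows "ghead G d \<in> V"
  using closed_subgraphD[OF assms(2)] serre_tail_bar[OF assms(1)] assms(3) by metis

lemma serre_subgraph_on:
  assumes "serre_graph G" "closed_subgraph G V E"
  shows "serre_graph (subgraph_on G V E)"
proof (rule serre_graphI)
  fix d
  assume "d \<notin> garcs (subgraph_on G V E)"
  then show "bar (subgraph_on G V E) d = d" by (simp add: subgraph_on_def)
qed (use closed_subgraphD[OF assms(2)] assms(1) serre_bar_neq[OF assms(1)] in auto)

lemma gwalk_subgraph_on:
  assumes "serre_graph G" "closed_subgraph G V E"
  shows "gwalk (subgraph_on G V E) u p v \<longleftrightarrow> u \<in> V \<and> set p \<subseteq> E \<and> gwalk G u p v"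
  by (induction p arbitrary: u)
    (use closed_subgraphD[OF assms(2)] closed_subgraph_head[OF assms] assms(1)
      serre_subgraph_on[OF assms] in auto)

lemma inv_path_subgraph_on:
  "set p \<subseteq> E \<Longrightarrow> inv_path (subgraph_on G V E) p = inv_path G p"
  by (induction p) auto

lemma embedded_loop_subgraph_on:
  assumes "serre_graph G" "closed_subgraph G V E" "embedded_loop (subgraph_on G V E) p"
  shows "embedded_loop G p" "set p \<subseteq> E"
proof -
  have p: "p \<noteq> []" "\<exists>u. gwalk (subgraph_on G V E) u p u" "distinct (map (gtail G) p)"
    "\<forall>d \<in> set p. bar (subgraph_on G V E) d \<notin> set p"
    using assms(3) unfolding embedded_loop_iff[OF serre_subgraph_on[OF assms(1,2)]] by auto
  then show E: "set p \<subseteq> E"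
    by (auto simp: gwalk_subgraph_on[OF assms(1,2)])
  have "bar (subgraph_on G V E) d = bar G d" if "d \<in> set p" for d
    using E that by auto
  with p show "embedded_loop G p"
    by (auto simp: embedded_loop_iff[OF assms(1)] gwalk_subgraph_on[OF assms(1,2)])
qed

text \<open>
  Join the loop to the subgraph by a shortest path \<open>r\<close>.  Then \<open>r\<close>, the loop and the inverse
  of \<open>r\<close> compose to a reduced path with both ends in the subgraph.
\<close>

lemma embedded_loop_in_convex:
  assumes G: "serre_graph G" and conn: "connected (dig G)"
    and conv: "convex_subgraph G V E" and V: "V \<noteq> {}" and p: "embedded_loop G p"
  shows "set p \<subseteq> E"
proof -
  have cl: "closed_subgraph G V E"
    and cv: "\<And>u v p. u \<in> V \<Longrightarrow> v \<in> V \<Longrightarrow> gwalk G u p v \<Longrightarrow> reduced G p \<Longrightarrow> set p \<subseteq> E"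
    using conv by (auto simp: convex_subgraph_def)
  from p obtain u where pw: "gwalk G u p u" "p \<noteq> []"
    and bp: "\<And>d. d \<in> set p \<Longrightarrow> bar G d \<notin> set p"
    unfolding embedded_loop_iff[OF G] by blast
  have parcs: "set p \<subseteq> garcs G" using gwalk_arcs[OF pw(1)] .
  define P where "P r \<longleftrightarrow> (\<exists>v \<in> V. \<exists>d \<in> set p. gwalk G v r (gtail G d))" for r
  obtain v0 where v0: "v0 \<in> V" using V by blast
  have "\<exists>r. gwalk G v0 r (gtail G (hd p))"
    using conn v0 closed_subgraphD(1)[OF cl] pw parcs G
    unfolding serre_connected_iff[OF G] by (metis hd_in_set serre_tail_in subsetD)
  then obtain r0 where "P r0"
    unfolding P_def using v0 pw(2) hd_in_set by blast
  then obtain r1 where r1: "P r1" "\<And>r'. P r' \<Longrightarrow> length r1 \<le> length r'"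
    using ex_has_least_nat[of P r0 length] by blast
  \<comment> \<open>tightening keeps the ends and does not increase the length, so \<open>r\<close> is still shortest\<close>
  define r where "r = tighten G r1"
  have len: "length (tighten G q) \<le> length q" for q
    by (induction q) auto
  from r1(1) obtain v d where v: "v \<in> V" and d: "d \<in> set p" and "gwalk G v r1 (gtail G d)"
    unfolding P_def by blast
  then have r: "gwalk G v r (gtail G d)" "reduced G r"
    using path_homotopic_walks(2)[OF path_homotopic_tighten[OF G]] by (auto simp: r_def)
  have min: "length r \<le> length r'" if "P r'" for r'
    using r1(2)[OF that] len[of r1] by (simp add: r_def)
  \<comment> \<open>otherwise the loop would already be reached without the last arc of \<open>r\<close>\<close>
  have off: "gtail G (last r) \<notin> gtail G ` set p" if "r \<noteq> []"
  proof
    assume "gtail G (last r) \<in> gtail G ` set p"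
    then obtain c where c: "c \<in> set p" "gtail G (last r) = gtail G c" by auto
    have "gwalk G v (butlast r @ [last r]) (gtail G d)"
      using r(1) that by simp
    then have "gwalk G v (butlast r) (gtail G c)"
      using c G by (auto simp: gwalk_append_iff simp del: append_butlast_last_id)
    then have "P (butlast r)" unfolding P_def using v c by blast
    then have "length r \<le> length (butlast r)" by (rule min)
    then show False using that by (cases r rule: rev_cases) auto
  qed
  have heads: "ghead G c \<in> gtail G ` set p" if "c \<in> set p" for c
  proof -
    from that obtain i where "i < length p" "p ! i = c" by (metis in_set_conv_nth)
    then show ?thesis
      using closed_gwalk_nth_head[OF G pw(1)] pw(2) by auto
  qed
  obtain xs ys where split: "p = xs @ d # ys" using d by (meson split_list)
  define q where "q = d # ys @ xs"
  have setq: "set q = set p" by (auto simp: q_def split)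
  have qne: "q \<noteq> []" by (simp add: q_def)
  have q: "gwalk G (gtail G d) q (gtail G d)"
    using pw(1) G unfolding q_def split by (auto simp: gwalk_append_iff)
  have qred: "reduced G q"
    unfolding reduced_def
  proof (intro allI impI)
    fix i assume "Suc i < length q"
    then have "q ! Suc i \<in> set p" "q ! i \<in> set p"
      unfolding setq[symmetric] by (meson Suc_lessD nth_mem)+
    then show "q ! Suc i \<noteq> bar G (q ! i)" using bp by metis
  qed
  have "reduced G (r @ q @ inv_path G r)"
  proof (cases "r = []")
    case False
    have lr: "last r \<in> garcs G" using gwalk_arcs[OF r(1)] False by auto
    have "hd q \<noteq> bar G (last r)"
    proof
      assume "hd q = bar G (last r)"
      then have "ghead G d = gtail G (last r)" using lr G by (simp add: q_def)
      then show False using off[OF False] heads[OF d] by simp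
    qed
    moreover have "hd (inv_path G r) = bar G (last r)"
      using False by (simp add: inv_path_def hd_rev last_map)
    moreover have "bar G (last r) \<noteq> bar G (last q)"
    proof
      assume "bar G (last r) = bar G (last q)"
      then have "last r = last q" using G by (metis serre_bar_bar)
      then have "last r \<in> set p" using qne setq last_in_set by metis
      then show False using off[OF False] by simp
    qed
    ultimately show ?thesis
      using qred r(2) reduced_inv_path[OF G r(2)] qne by auto
  qed (use qred in simp)
  moreover have "gwalk G v (r @ q @ inv_path G r) v"
    by (rule gwalk_appendI[OF G r(1) gwalk_appendI[OF G q gwalk_inv_path[OF G r(1)]]])
  ultimately have "set (r @ q @ inv_path G r) \<subseteq> E"
    using cv v by blast
  then show ?thesis using setq by simp
qed

text \<open>
  If an arc \<open>e\<close> of a graph without vertices of valence 1 lies on no embedded loop, there are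
  embedded loops on both of its sides, and a connected subgraph that contains both has to
  contain \<open>e\<close>.
\<close>

lemma core_candidate_contains:
  assumes G: "serre_graph G" and cl: "closed_subgraph G V E" and fin: "finite V"
    and val: "\<And>v. v \<in> V \<Longrightarrow> 2 \<le> valence (subgraph_on G V E) v"
    and H: "H \<in> core_candidates G"
  shows "V \<subseteq> verts H" "E \<subseteq> arcs H"
proof -
  let ?K = "subgraph_on G V E"
  note K = serre_subgraph_on[OF G cl]
  have H': "subgraph H (dig G)" "bar G ` arcs H \<subseteq> arcs H" "connected H"
    "\<And>p. embedded_loop G p \<Longrightarrow> set p \<subseteq> arcs H"
    using H by (auto simp: core_candidates_def)
  have wfH: "wf_digraph H" and arcsH: "arcs H \<subseteq> garcs G"
    and endsH: "tail H = gtail G" "head H = ghead G"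
    using H'(1) by (auto simp: subgraph_def compatible_def)
  have "symmetric H"
    unfolding symmetric_conv
  proof
    fix d assume d: "d \<in> arcs H"
    then have "bar G d \<in> arcs H" "d \<in> garcs G" using H'(2) arcsH by auto
    then show "\<exists>d' \<in> arcs H. tail H d = head H d' \<and> head H d = tail H d'"
      using G endsH by (intro bexI[of _ "bar G d"]) auto
  qed
  then have connH: "\<exists>p. pre_digraph.awalk H u p v" if "u \<in> verts H" "v \<in> verts H" for u v
    using H'(3) that connected_iff_gwalk[OF wfH] by blast
  have sub_walk: "gwalk G u p v \<and> set p \<subseteq> arcs H" if "pre_digraph.awalk H u p v" for u p v
    using wf_digraph.subgraph_awalk_imp_awalk[OF serre_wf[OF G] that H'(1)] that
    by (simp add: pre_digraph.awalk_def)
  have loopH: "set p \<subseteq> arcs H" if "embedded_loop ?K p" for p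
    using embedded_loop_subgraph_on(1)[OF G cl that] H'(4) by blast
  \<comment> \<open>from the head of \<open>e\<close>, an embedded loop and hence \<open>H\<close> is reached without crossing \<open>e\<close>\<close>
  have reach: "e \<in> arcs H \<or> (\<exists>q w. gwalk G (ghead G e) q w \<and> e \<notin> set q \<and> bar G e \<notin> set q \<and> w \<in> verts H)"
    if e: "e \<in> E" for e
  proof -
    have finK: "finite (gverts ?K)" and valK: "\<forall>v \<in> gverts ?K. 2 \<le> valence ?K v"
      and eK: "e \<in> garcs ?K"
      using fin val e by auto
    show ?thesis
    proof (cases rule: lasso[OF K finK valK eK])
      case (1 p)
      then show ?thesis using loopH by blast
    next
      case (2 p q d)
      then have "d \<in> arcs H" using loopH by blast
      then have "gtail G d \<in> verts H"
        using wf_digraph.tail_in_verts[OF wfH] endsH by metis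
      moreover have "gwalk G (ghead G e) q (gtail G d)"
        using 2(3) by (simp add: gwalk_subgraph_on[OF G cl])
      ultimately show ?thesis using 2 e by auto
    qed
  qed
  show EH: "E \<subseteq> arcs H"
  proof (rule ccontr)
    assume "\<not> E \<subseteq> arcs H"
    then obtain e where e: "e \<in> E" "e \<notin> arcs H" by blast
    have eG: "e \<in> garcs G" "bar G e \<in> E" using e closed_subgraphD[OF cl] by auto
    have be: "bar G e \<notin> arcs H"
    proof
      assume "bar G e \<in> arcs H"
      then have "bar G (bar G e) \<in> arcs H" using H'(2) by blast
      then show False using e G by simp
    qed
    from reach[OF e(1)] e(2) obtain q w where q: "gwalk G (ghead G e) q w" "e \<notin> set q"
      "bar G e \<notin> set q" "w \<in> verts H" by blast
    from reach[OF eG(2)] be obtain q' w' where q': "gwalk G (gtail G e) q' w'" "e \<notin> set q'"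
      "bar G e \<notin> set q'" "w' \<in> verts H" using G eG by auto
    from connH[OF q(4) q'(4)] sub_walk obtain t where t: "gwalk G w t w'" "set t \<subseteq> arcs H"
      by blast
    have "e \<notin> set (inv_path G q')" "bar G e \<notin> set (inv_path G q')"
      using q' G by (auto simp: set_inv_path) (metis serre_bar_bar)+
    then have "e \<notin> set (q @ t @ inv_path G q')" "bar G e \<notin> set (q @ t @ inv_path G q')"
      using q t e be by auto
    moreover have "gwalk G (ghead G e) (q @ t @ inv_path G q') (gtail G e)"
      by (rule gwalk_appendI[OF G q(1) gwalk_appendI[OF G t(1) gwalk_inv_path[OF G q'(1)]]])
    ultimately obtain p where "embedded_loop G p" "e \<in> set p"
      using embedded_loop_through_arc[OF G eG(1)] by metis
    then show False using H'(4) e by blast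
  qed
  show "V \<subseteq> verts H"
  proof
    fix v assume "v \<in> V"
    then have "out_arcs (dig ?K) v \<noteq> {}" using val[of v] by (auto simp: out_degree_def)
    then have "\<exists>d \<in> E. gtail G d = v" by auto
    then show "v \<in> verts H"
      using EH wf_digraph.tail_in_verts[OF wfH] endsH by (metis subsetD)
  qed
qed

text \<open>
  By convexity the subgraph is itself one of the subgraphs whose intersection is the core, and
  it is contained in all of them.
\<close>

lemma compact_core_eq:
  assumes G: "serre_graph G" and conn: "connected (dig G)"
    and conv: "convex_subgraph G V E" and fin: "finite V"
    and connK: "connected (dig (subgraph_on G V E))"
    and val: "\<And>v. v \<in> V \<Longrightarrow> 2 \<le> valence (subgraph_on G V E) v"
  shows "compact_core G = subgraph_on G V E"
proof -
  let ?K = "subgraph_on G V E"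
  have cl: "closed_subgraph G V E" using conv by (simp add: convex_subgraph_def)
  note K = serre_subgraph_on[OF G cl]
  have V: "V \<noteq> {}" using connK unfolding serre_connected_iff[OF K] by simp
  have "dig ?K \<in> core_candidates G"
    unfolding core_candidates_def
  proof (intro CollectI conjI allI impI)
    show "subgraph (dig ?K) (dig G)"
      using closed_subgraphD[OF cl] serre_wf[OF G] serre_wf[OF K]
      by (auto simp: subgraph_def compatible_def)
    show "bar G ` garcs ?K \<subseteq> garcs ?K"
      using closed_subgraphD[OF cl] by auto
    show "set p \<subseteq> garcs ?K" if "embedded_loop G p" for p
      using embedded_loop_in_convex[OF G conn conv V that] by simp
  qed (rule connK)
  then have "(\<Inter>H \<in> core_candidates G. verts H) = V" "(\<Inter>H \<in> core_candidates G. arcs H) = E"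
    using core_candidate_contains[OF G cl fin val] by fastforce+
  then show ?thesis
    by (simp add: compact_core_def subgraph_on_def Let_def)
qed

text \<open>
  The two exits are joined by a reduced path that avoids \<open>E\<close> and, by convexity, lies in \<open>E\<close>.
\<close>

lemma convex_unique_exit:
  assumes G: "serre_graph G" and conv: "convex_subgraph G V E"
    and u: "u \<in> V" "gwalk G x p u" "set p \<inter> E = {}"
    and u': "u' \<in> V" "gwalk G x p' u'" "set p' \<inter> E = {}"
  shows "u = u'"
proof -
  have cl: "closed_subgraph G V E" using conv by (simp add: convex_subgraph_def)
  let ?q = "tighten G (inv_path G p @ p')"
  have w: "gwalk G u (inv_path G p @ p') u'" using u u' G by auto
  have q: "gwalk G u ?q u'" by (rule path_homotopic_walks(2)[OF path_homotopic_tighten[OF G w]])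
  then have "set ?q \<subseteq> E"
    using conv u(1) u'(1) unfolding convex_subgraph_def by simp
  moreover have "set (inv_path G p @ p') \<inter> E = {}"
    using u(3) u'(3) closed_subgraph_bar_iff[OF G cl] by (auto simp: set_inv_path)
  then have "set ?q \<inter> E = {}" using set_tighten[of G "inv_path G p @ p'"] by blast
  ultimately have "?q = []" by (cases ?q) auto
  then show ?thesis using q by simp
qed

lemma exists_exit:
  assumes G: "serre_graph G" and cl: "closed_subgraph G V E"
    and "gwalk G x p v" "v \<in> V"
  obtains u q where "u \<in> V" "gwalk G x q u" "set q \<inter> E = {}"
proof -
  have "\<exists>u q. u \<in> V \<and> gwalk G x q u \<and> set q \<inter> E = {}"
    using assms(3)
  proof (induction p arbitrary: x)
    case Nil
    then show ?case using assms(4) by (intro exI[of _ v] exI[of _ "[]"]) auto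
  next
    case (Cons d p)
    show ?case
    proof (cases "x \<in> V")
      case True
      then show ?thesis using gwalk_start[OF Cons.prems] by (intro exI[of _ x] exI[of _ "[]"]) auto
    next
      case False
      then have "d \<notin> E" using Cons.prems G closed_subgraphD(3)[OF cl] by auto
      moreover from Cons obtain u q where "u \<in> V" "gwalk G (ghead G d) q u" "set q \<inter> E = {}"
        using G by fastforce
      ultimately show ?thesis
        using Cons.prems G by (intro exI[of _ u] exI[of _ "d # q"]) auto
    qed
  qed
  then show thesis using that by blast
qed

text \<open>
  The retraction onto the core is a map of graphs, as the two ends of an arc outside a convex
  subgraph have the same exit point.
\<close>

lemma
  assumes G: "serre_graph G" and conn: "connected (dig G)"
    and conv: "convex_subgraph G V E" and V: "V \<noteq> {}"
    and core: "compact_core G = subgraph_on G V E"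
  shows core_retraction_gmap: "is_gmap G (compact_core G) (core_retraction G)"
    and core_retraction_vertex: "v \<in> V \<Longrightarrow> vmap (core_retraction G) v = v"
    and core_retraction_path: "set p \<subseteq> E \<Longrightarrow> map_path (core_retraction G) p = p"
proof -
  let ?r = "core_retraction G"
  have cl: "closed_subgraph G V E" using conv by (simp add: convex_subgraph_def)
  have r: "vmap ?r x = u" if "u \<in> V" "gwalk G x p u" "set p \<inter> E = {}" for x u p
    unfolding core_retraction_def core using that convex_unique_exit[OF G conv]
    by (auto intro!: the_equality)
  have exit: "\<exists>u p. u \<in> V \<and> gwalk G x p u \<and> set p \<inter> E = {}" if x: "x \<in> gverts G" for x
  proof -
    obtain v where v: "v \<in> V" using V by blast
    then obtain p where "gwalk G x p v"
      using conn x closed_subgraphD(1)[OF cl] unfolding serre_connected_iff[OF G] by blast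
    then show ?thesis using exists_exit[OF G cl _ v] by blast
  qed
  show rv: "vmap ?r v = v" if "v \<in> V" for v
    by (rule r[of v v "[]"]) (use that closed_subgraphD[OF cl] in auto)
  have rd: "dmap ?r d = (if d \<in> E then [d] else [])" for d
    by (simp add: core_retraction_def core)
  show "set p \<subseteq> E \<Longrightarrow> map_path ?r p = p"
    by (induction p) (auto simp: rd)
  show "is_gmap G (compact_core G) ?r"
    unfolding is_gmap_def core
  proof (intro conjI ballI)
    fix v assume "v \<in> gverts G"
    then show "vmap ?r v \<in> gverts (subgraph_on G V E)"
      using exit[of v] r by fastforce
  next
    fix d assume d: "d \<in> garcs G"
    show "gwalk (subgraph_on G V E) (vmap ?r (gtail G d)) (dmap ?r d) (vmap ?r (ghead G d))"
    proof (cases "d \<in> E")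
      case True
      then show ?thesis
        using closed_subgraphD[OF cl] closed_subgraph_head[OF G cl] d G
        by (auto simp: rd rv gwalk_subgraph_on[OF G cl])
    next
      case False
      obtain u p where u: "u \<in> V" "gwalk G (ghead G d) p u" "set p \<inter> E = {}"
        using exit[of "ghead G d"] d G by auto
      then have "vmap ?r (ghead G d) = u" by (rule r)
      moreover have "vmap ?r (gtail G d) = u"
        by (rule r[of u _ "d # p"]) (use u d False G in auto)
      ultimately show ?thesis using False u(1) by (simp add: rd)
    qed
    show "dmap ?r (bar G d) = inv_path (subgraph_on G V E) (dmap ?r d)"
      using closed_subgraph_bar_iff[OF G cl] by (auto simp: rd)
  qed
qed

section \<open>Coverings\<close>

text \<open>
  The homotopy invariant set \<open>S\<close> of closed paths at \<open>u\<close> stands for a subgroup of the fundamental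
  group.
\<close>

locale covering_space =
  fixes G :: "('v, 'd) sgraph" and u :: 'v and S :: "'d list set"
  assumes G: "serre_graph G"
    and base: "u \<in> gverts G"
    and S_loops: "p \<in> S \<Longrightarrow> gwalk G u p u"
    and S_Nil: "[] \<in> S"
    and S_append: "p \<in> S \<Longrightarrow> q \<in> S \<Longrightarrow> p @ q \<in> S"
    and S_inv: "p \<in> S \<Longrightarrow> inv_path G p \<in> S"
    and S_homotopic: "p \<in> S \<Longrightarrow> path_homotopic G u u p q \<Longrightarrow> q \<in> S"
begin

abbreviation cls :: "'d list \<Rightarrow> 'd list set" where
  "cls \<equiv> path_class G u S"

abbreviation C :: "('d list set, 'd list set \<times> 'd) sgraph" where
  "C \<equiv> covering G u S"

lemma S_trans:
  assumes "gwalk G u p v" "gwalk G u q v" "gwalk G u r v"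
    and "p @ inv_path G q \<in> S" "q @ inv_path G r \<in> S"
  shows "p @ inv_path G r \<in> S"
proof -
  have "(p @ inv_path G q) @ (q @ inv_path G r) \<in> S"
    using assms(4,5) by (rule S_append)
  moreover have "path_homotopic G u u (p @ inv_path G q @ q @ inv_path G r) (p @ inv_path G r)"
    by (rule path_homotopic_cancel_middle[OF G assms(1,2) gwalk_inv_path[OF G assms(3)]])
  ultimately show ?thesis
    using S_homotopic by simp
qed

lemma S_sym:
  assumes "p @ inv_path G q \<in> S"
  shows "q @ inv_path G p \<in> S"
  using S_inv[OF assms] G by simp

lemma S_refl: "gwalk G u p v \<Longrightarrow> p @ inv_path G p \<in> S"
  by (rule S_homotopic[OF S_Nil path_homotopic_sym[OF path_homotopic_cancel_right[OF G]]])

lemma cls_mem: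
  assumes "gwalk G u p v"
  shows "q \<in> cls p \<longleftrightarrow> gwalk G u q v \<and> p @ inv_path G q \<in> S"
  by (simp add: path_class_def awlast_gwalk[OF G assms])

lemma cls_eq_iff:
  assumes p: "gwalk G u p v" and q: "gwalk G u q w"
  shows "cls p = cls q \<longleftrightarrow> v = w \<and> p @ inv_path G q \<in> S"
proof
  assume "cls p = cls q"
  then have "q \<in> cls p"
    using cls_mem[OF q] S_refl[OF q] q by simp
  then have "gwalk G u q v" "p @ inv_path G q \<in> S"
    using cls_mem[OF p] by simp_all
  then show "v = w \<and> p @ inv_path G q \<in> S"
    using gwalk_end_unique[OF G _ q] by simp
next
  assume *: "v = w \<and> p @ inv_path G q \<in> S"
  then have pq: "p @ inv_path G q \<in> S" and w: "gwalk G u q v"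
    using q by auto
  have "r \<in> cls p \<longleftrightarrow> r \<in> cls q" for r
    unfolding cls_mem[OF p] cls_mem[OF w]
    using S_trans[OF p w _ pq] S_trans[OF w p _ S_sym[OF pq]] by metis
  then show "cls p = cls q" by blast
qed

lemma cls_homotopic:
  assumes "path_homotopic G u v p q"
  shows "cls p = cls q"
proof -
  note w = path_homotopic_walks[OF assms]
  have "path_homotopic G u u (q @ inv_path G q) (p @ inv_path G q)"
    by (rule path_homotopic_append_right[OF G gwalk_inv_path[OF G w(2)] path_homotopic_sym[OF assms]])
  then have "p @ inv_path G q \<in> S"
    by (rule S_homotopic[OF S_refl[OF w(2)]])
  then show ?thesis
    using cls_eq_iff[OF w] by simp
qed

lemma cls_backtrack:
  assumes "gwalk G u p (gtail G d)" "d \<in> garcs G"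
  shows "cls (p @ [d, bar G d]) = cls p"
  using assms path_homotopic_backtrack[OF G, of u p d "[]" "gtail G d"] G
  by (intro cls_homotopic) (auto simp: gwalk_append_iff)

lemma verts_C: "gverts C = {cls p | p v. gwalk G u p v}"
  by (simp add: covering_def)

lemma arcs_C: "garcs C = cover_arcs G u S"
  by (simp add: covering_def)

lemma tail_C [simp]: "gtail C e = fst e"
  by (simp add: covering_def)

lemma arc_C_iff:
  assumes "gwalk G u p v"
  shows "(cls p, d) \<in> garcs C \<longleftrightarrow> d \<in> garcs G \<and> gtail G d = v"
  unfolding arcs_C cover_arcs_def using cls_eq_iff[OF assms] assms by blast

lemma arc_CE:
  assumes "e \<in> garcs C"
  obtains p d where "e = (cls p, d)" "d \<in> garcs G" "gwalk G u p (gtail G d)"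
  using assms unfolding arcs_C cover_arcs_def by blast

text \<open>
  \<open>cover_head\<close> is a union over all representatives of a class; they all contribute the same
  class.
\<close>

lemma head_C:
  assumes d: "d \<in> garcs G" and p: "gwalk G u p (gtail G d)"
  shows "ghead C (cls p, d) = cls (p @ [d])"
proof -
  have "cls (q @ [d]) = cls (p @ [d])" if "q \<in> cls p" for q
  proof -
    from that have q: "gwalk G u q (gtail G d)" "p @ inv_path G q \<in> S"
      using cls_mem[OF p] by simp_all
    have w: "gwalk G u (p @ [d]) (ghead G d)" "gwalk G u (q @ [d]) (ghead G d)"
      using p q d G by (auto simp: gwalk_append_iff)
    have "path_homotopic G u u (p @ [d, bar G d] @ inv_path G q) (p @ inv_path G q)"
      using p d gwalk_inv_path[OF G q(1)] G
      by (intro path_homotopic_backtrack) (auto simp: gwalk_append_iff)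
    then have "(p @ [d]) @ inv_path G (q @ [d]) \<in> S"
      using S_homotopic[OF q(2)] path_homotopic_sym by fastforce
    then show ?thesis
      using cls_eq_iff[OF w] by simp
  qed
  moreover have "p \<in> cls p"
    using cls_mem[OF p] p S_refl by simp
  ultimately have "(\<Union>q \<in> cls p. cls (q @ [d])) = cls (p @ [d])"
    by blast
  then show ?thesis
    by (simp add: covering_def cover_head_def)
qed

lemma bar_C:
  assumes d: "d \<in> garcs G" and p: "gwalk G u p (gtail G d)"
  shows "bar C (cls p, d) = (cls (p @ [d]), bar G d)"
proof -
  have "(cls p, d) \<in> cover_arcs G u S"
    using arc_C_iff[OF p] d by (simp add: arcs_C)
  then show ?thesis
    using head_C[OF assms] by (simp add: covering_def)
qed

lemma serre_C: "serre_graph C"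
proof (rule serre_graphI)
  fix e
  assume "e \<in> garcs C"
  then obtain p d where e: "e = (cls p, d)" and d: "d \<in> garcs G" and p: "gwalk G u p (gtail G d)"
    by (rule arc_CE)
  have bd: "bar G d \<in> garcs G" and pd: "gwalk G u (p @ [d]) (gtail G (bar G d))"
    using p d G by (auto simp: gwalk_append_iff)
  show "gtail C e \<in> gverts C"
    using p unfolding verts_C e by auto
  show "bar C e \<in> garcs C"
    using arc_C_iff[OF pd] bd unfolding e bar_C[OF d p] by simp
  show "bar C e \<noteq> e"
    using serre_bar_neq[OF G d] unfolding e bar_C[OF d p] by simp
  show "bar C (bar C e) = e"
    using cls_backtrack[OF p d] G unfolding e bar_C[OF d p] bar_C[OF bd pd] by simp
  show "gtail C (bar C e) = ghead C e"
    unfolding e bar_C[OF d p] head_C[OF d p] by simp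
next
  fix e
  assume "e \<notin> garcs C"
  then show "bar C e = e" by (simp add: covering_def)
qed

lemma lift_path_walk:
  assumes "gwalk G u p v" "gwalk G v q w"
  shows "gwalk C (cls p) (lift_path C (cls p) q) (cls (p @ q))"
  using assms
proof (induction q arbitrary: p v)
  case Nil
  then show ?case using verts_C by auto
next
  case (Cons d q)
  then have d: "d \<in> garcs G" "gtail G d = v" and q: "gwalk G (ghead G d) q w"
    and p: "gwalk G u p (gtail G d)"
    using G by auto
  have pd: "gwalk G u (p @ [d]) (ghead G d)"
    using p d G by (auto simp: gwalk_append_iff)
  show ?case
    using Cons.IH[OF pd q] d arc_C_iff[OF p] head_C[OF d(1) p] serre_C by simp
qed

lemma lift_path_append:
  assumes "gwalk G u p v" "gwalk G v q w"
  shows "lift_path C (cls p) (q @ r) = lift_path C (cls p) q @ lift_path C (cls (p @ q)) r"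
  using assms
proof (induction q arbitrary: p v)
  case (Cons d q)
  then have d: "d \<in> garcs G" "gtail G d = v" and q: "gwalk G (ghead G d) q w"
    and p: "gwalk G u p (gtail G d)"
    using G by auto
  have pd: "gwalk G u (p @ [d]) (ghead G d)"
    using p d G by (auto simp: gwalk_append_iff)
  show ?case
    using Cons.IH[OF pd q] head_C[OF d(1) p] by simp
qed simp

lemma lift_path_inv_path:
  assumes "gwalk G u p v" "gwalk G v q w"
  shows "lift_path C (cls (p @ q)) (inv_path G q) = inv_path C (lift_path C (cls p) q)"
  using assms
proof (induction q arbitrary: p v)
  case (Cons d q)
  then have d: "d \<in> garcs G" "gtail G d = v" and q: "gwalk G (ghead G d) q w"
    and p: "gwalk G u p (gtail G d)"
    using G by auto
  have pd: "gwalk G u (p @ [d]) (ghead G d)" and pdq: "gwalk G u (p @ [d] @ q) w"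
    using p d q G by (auto simp: gwalk_append_iff)
  have "lift_path C (cls (p @ d # q)) (inv_path G (d # q)) =
    lift_path C (cls (p @ [d] @ q)) (inv_path G q) @
    lift_path C (cls ((p @ [d] @ q) @ inv_path G q)) [bar G d]"
    using lift_path_append[OF pdq gwalk_inv_path[OF G q]] by simp
  moreover have "cls ((p @ [d] @ q) @ inv_path G q) = cls (p @ [d])"
    using path_homotopic_append_left[OF G pd path_homotopic_cancel_right[OF G q]]
    by (intro cls_homotopic[of "ghead G d"]) simp
  ultimately show ?case
    using Cons.IH[OF pd q] head_C[OF d(1) p] bar_C[OF d(1) p] by simp
qed simp

text \<open>
  A path in the covering is the lift of its projection, and a backtracking of the projection
  lifts to a backtracking.
\<close>

lemma walk_C_lift:
  assumes "gwalk G u p v" "gwalk C (cls p) w Y"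
  shows "\<exists>v'. gwalk G v (map snd w) v' \<and> Y = cls (p @ map snd w) \<and>
    w = lift_path C (cls p) (map snd w) \<and> (reduced C w \<longrightarrow> reduced G (map snd w))"
  using assms
proof (induction w arbitrary: p v)
  case Nil
  then show ?case using gwalk_end[OF G] by auto
next
  case (Cons e w)
  obtain X d where e: "e = (X, d)" by (cases e)
  then have X: "X = cls p" and "(cls p, d) \<in> garcs C" and w: "gwalk C (ghead C (cls p, d)) w Y"
    using Cons.prems serre_C by auto
  then have d: "d \<in> garcs G" "gtail G d = v"
    using arc_C_iff[OF Cons.prems(1)] by auto
  with Cons.prems have p: "gwalk G u p (gtail G d)" by simp
  have pd: "gwalk G u (p @ [d]) (ghead G d)"
    using p d G by (auto simp: gwalk_append_iff)
  have w': "gwalk C (cls (p @ [d])) w Y"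
    using w head_C[OF d(1) p] by simp
  have "hd w = bar C e" if "w \<noteq> []" "snd (hd w) = bar G d"
    using gwalk_hd_tail[OF serre_C w' that(1)] that(2) unfolding e X bar_C[OF d(1) p]
    by (simp add: prod_eq_iff)
  moreover from Cons.IH[OF pd w'] obtain v' where
    "gwalk G (ghead G d) (map snd w) v'" "Y = cls ((p @ [d]) @ map snd w)"
    "w = lift_path C (cls (p @ [d])) (map snd w)" "reduced C w \<longrightarrow> reduced G (map snd w)"
    by blast
  ultimately show ?case
    using d G e X head_C[OF d(1) p] by (auto simp: hd_map)
qed

text \<open>
  Inserting a backtracking into a path inserts a backtracking into its lift and does not change
  the class in which the lift ends.
\<close>

lemma lift_path_homotopic:
  assumes p: "gwalk G u p v" and q: "path_homotopic G v w q q'"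
  shows "path_homotopic C (cls p) (cls (p @ q)) (lift_path C (cls p) q) (lift_path C (cls p) q')"
proof -
  have end_eq: "cls (p @ a) = cls (p @ q)" if "path_homotopic G v w q a" for a
    using path_homotopic_append_left[OF G p that] cls_homotopic by metis
  have wC: "gwalk C (cls p) (lift_path C (cls p) a) (cls (p @ a))" if "gwalk G v a w" for a
    by (rule lift_path_walk[OF p that])
  have backtrack_step: "path_homotopic C (cls p) (cls (p @ a)) (lift_path C (cls p) b) (lift_path C (cls p) a) \<and>
      cls (p @ b) = cls (p @ a)"
    if ab: "backtrack_insertion G v w a b" for a b
  proof -
    from ab obtain xs ys d where w: "gwalk G v a w" "gwalk G v b w"
      and ab: "a = xs @ ys" "b = xs @ [d, bar G d] @ ys"
      by (auto simp: backtrack_insertion_def)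
    then have d: "d \<in> garcs G" and xs: "gwalk G v xs (gtail G d)" and ys: "gwalk G (gtail G d) ys w"
      using G by (auto simp: gwalk_append_iff)
    have pxs: "gwalk G u (p @ xs) (gtail G d)"
      using gwalk_appendI[OF G p xs] .
    have dd: "gwalk G (gtail G d) [d, bar G d] (gtail G d)"
      using d G by simp
    have pxd: "gwalk G u (p @ xs @ [d]) (gtail G (bar G d))"
      using pxs d G by (auto simp: gwalk_append_iff)
    let ?e = "(cls (p @ xs), d)"
    have "lift_path C (cls p) b = lift_path C (cls p) xs @
      lift_path C (cls (p @ xs)) [d, bar G d] @ lift_path C (cls ((p @ xs) @ [d, bar G d])) ys"
      unfolding ab lift_path_append[OF p xs] lift_path_append[OF pxs dd] ..
    also have "lift_path C (cls (p @ xs)) [d, bar G d] = [?e, bar C ?e]"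
      using head_C[OF d pxs] bar_C[OF d pxs] by simp
    also have "cls ((p @ xs) @ [d, bar G d]) = cls (p @ xs)"
      by (rule cls_backtrack[OF pxs d])
    finally have b: "lift_path C (cls p) b =
      lift_path C (cls p) xs @ [?e, bar C ?e] @ lift_path C (cls (p @ xs)) ys" .
    have a: "lift_path C (cls p) a = lift_path C (cls p) xs @ lift_path C (cls (p @ xs)) ys"
      unfolding ab lift_path_append[OF p xs] ..
    have eq: "cls (p @ b) = cls (p @ a)"
    proof (rule cls_homotopic)
      have "path_homotopic G v w b a"
        using path_homotopic_backtrack[OF G] w unfolding ab by blast
      then show "path_homotopic G u w (p @ b) (p @ a)"
        by (rule path_homotopic_append_left[OF G p])
    qed
    have "path_homotopic C (cls p) (cls (p @ b)) (lift_path C (cls p) b) (lift_path C (cls p) a)"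
      using wC[OF w(2)] unfolding a b by (rule path_homotopic_backtrack[OF serre_C])
    then show ?thesis using eq by simp
  qed
  have "equivclp (backtrack_insertion G v w) q q'"
    using q by (simp add: path_homotopic_def)
  then show ?thesis
  proof (induction)
    case base
    then show ?case using wC[OF path_homotopic_walks(1)[OF q]] by simp
  next
    case (step y z)
    then have w: "gwalk G v y w" "gwalk G v z w"
      by (auto simp: backtrack_insertion_def)
    then have "path_homotopic G v w q y"
      using step.hyps(1) q by (simp add: path_homotopic_def)
    then have y: "cls (p @ y) = cls (p @ q)" by (rule end_eq)
    have "path_homotopic C (cls p) (cls (p @ q)) (lift_path C (cls p) y) (lift_path C (cls p) z)"
      using step.hyps(2)
    proof
      assume "backtrack_insertion G v w y z"
      from backtrack_step[OF this] y show ?thesis by (simp add: path_homotopic_sym)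
    next
      assume "backtrack_insertion G v w z y"
      from backtrack_step[OF this] y show ?thesis by simp
    qed
    with step.IH show ?case by (rule path_homotopic_trans)
  qed
qed

lemma connected_C: "connected (dig C)"
  unfolding serre_connected_iff[OF serre_C]
proof (intro conjI ballI)
  show "gverts C \<noteq> {}"
    unfolding verts_C using base by (auto intro!: exI[of _ "[]"])
  fix X Y
  assume "X \<in> gverts C" "Y \<in> gverts C"
  then obtain p v q w where p: "gwalk G u p v" "X = cls p" and q: "gwalk G u q w" "Y = cls q"
    unfolding verts_C by blast
  have "gwalk G v (inv_path G p @ q) w"
    by (rule gwalk_appendI[OF G gwalk_inv_path[OF G p(1)] q(1)])
  from lift_path_walk[OF p(1) this]
  have "gwalk C X (lift_path C X (inv_path G p @ q)) (cls (p @ inv_path G p @ q))"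
    using p(2) by simp
  moreover have "cls ((p @ inv_path G p) @ q) = cls ([] @ q)"
    by (rule cls_homotopic[OF path_homotopic_append_right[OF G q(1) path_homotopic_cancel_right[OF G p(1)]]])
  ultimately show "\<exists>r. gwalk C X r Y"
    using q(2) by auto
qed

end

section \<open>The core of the covering defined by a subgraph\<close>

text \<open>
  The covering of \<open>G\<close> at \<open>u\<close> that belongs to the fundamental group of a connected subgraph at
  one of its vertices \<open>b\<close>, transported to \<open>u\<close> along the path \<open>c\<close>.
\<close>

locale subgraph_covering =
  fixes G :: "('v, 'd) sgraph" and V :: "'v set" and E :: "'d set"
    and b u :: 'v and c :: "'d list"
  assumes serre: "serre_graph G"
    and cl: "closed_subgraph G V E"
    and conn: "connected (dig (subgraph_on G V E))"
    and b: "b \<in> V" and c: "gwalk G b c u"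
begin

abbreviation "K \<equiv> subgraph_on G V E"

definition "S = {p. \<exists>q. gwalk K b q b \<and> path_homotopic G u u (inv_path G c @ q @ c) p}"

lemma K: "serre_graph K"
  by (rule serre_subgraph_on[OF serre cl])

lemma K_walk: "gwalk K v p w \<Longrightarrow> gwalk G v p w"
  by (simp add: gwalk_subgraph_on[OF serre cl])

lemma K_inv: "gwalk K v p w \<Longrightarrow> gwalk K w (inv_path G p) v"
  using gwalk_inv_path[OF K, of v p w] inv_path_subgraph_on[of p E G V] gwalk_arcs[of K v p w]
  by simp

lemma conj_walk: "gwalk G b q b \<Longrightarrow> gwalk G u (inv_path G c @ q @ c) u"
  by (rule gwalk_appendI[OF serre gwalk_inv_path[OF serre c] gwalk_appendI[OF serre _ c]])

sublocale covering_space G u S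
proof (rule covering_space.intro)
  show "serre_graph G" by (rule serre)
  show "u \<in> gverts G" by (rule gwalk_end[OF serre c])
  show "gwalk G u p u" if "p \<in> S" for p
    using that path_homotopic_walks(2) by (auto simp: S_def)
  have "path_homotopic G u u (inv_path G c @ [] @ c) []"
    using path_homotopic_cancel_left[OF serre c] by simp
  moreover have "gwalk K b [] b" using b by simp
  ultimately show "[] \<in> S" unfolding S_def by blast
  show "p @ q \<in> S" if "p \<in> S" "q \<in> S" for p q
  proof -
    from that obtain p' q' where p': "gwalk K b p' b" "path_homotopic G u u (inv_path G c @ p' @ c) p"
      and q': "gwalk K b q' b" "path_homotopic G u u (inv_path G c @ q' @ c) q"
      by (auto simp: S_def)
    have "path_homotopic G u u ((inv_path G c @ p') @ inv_path G (inv_path G c) @ inv_path G c @ (q' @ c))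
      ((inv_path G c @ p') @ (q' @ c))"
      by (rule path_homotopic_cancel_middle[OF serre gwalk_appendI[OF serre gwalk_inv_path[OF serre c]
            K_walk[OF p'(1)]] gwalk_inv_path[OF serre c] gwalk_appendI[OF serre K_walk[OF q'(1)] c]])
    then have "path_homotopic G u u (inv_path G c @ (p' @ q') @ c)
      ((inv_path G c @ p' @ c) @ (inv_path G c @ q' @ c))"
      using serre by (simp add: path_homotopic_sym)
    also have "path_homotopic G u u \<dots> (p @ q)"
      by (rule path_homotopic_append[OF serre p'(2) q'(2)])
    finally show ?thesis
      using gwalk_appendI[OF K p'(1) q'(1)] unfolding S_def by blast
  qed
  show "inv_path G p \<in> S" if "p \<in> S" for p
  proof -
    from that obtain p' where p': "gwalk K b p' b" "path_homotopic G u u (inv_path G c @ p' @ c) p"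
      by (auto simp: S_def)
    have "path_homotopic G u u (inv_path G c @ inv_path G p' @ c) (inv_path G p)"
      using path_homotopic_inv_path[OF serre p'(2)] serre by simp
    with K_inv[OF p'(1)] show ?thesis
      unfolding S_def by blast
  qed
  show "q \<in> S" if "p \<in> S" "path_homotopic G u u p q" for p q
    using that(1) path_homotopic_trans[OF _ that(2)] unfolding S_def by blast
qed

text \<open>The lift of \<open>K\<close> to the covering that takes \<open>b\<close> to the class of the inverse of \<open>c\<close>.\<close>

definition "emb v = cls (inv_path G c @ (SOME q. gwalk K b q v))"

abbreviation "emb_arc d \<equiv> (emb (gtail G d), d)"

abbreviation "EV \<equiv> emb ` V"

abbreviation "EE \<equiv> emb_arc ` E"

lemma emb_walk: "gwalk K b q v \<Longrightarrow> gwalk G u (inv_path G c @ q) v"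
  by (rule gwalk_appendI[OF serre gwalk_inv_path[OF serre c] K_walk])

text \<open>
  Two paths in \<open>K\<close> from \<open>b\<close> to \<open>v\<close> differ by a closed path in \<open>K\<close>, so they lead to the same
  vertex of the covering.
\<close>

lemma emb_eq:
  assumes q: "gwalk K b q v"
  shows "emb v = cls (inv_path G c @ q)"
proof -
  define r where "r = (SOME q. gwalk K b q v)"
  have r: "gwalk K b r v"
    unfolding r_def by (rule someI[of "\<lambda>q. gwalk K b q v", OF q])
  have rq: "gwalk K b (r @ inv_path G q) b"
    by (rule gwalk_appendI[OF K r K_inv[OF q]])
  have "gwalk G u (inv_path G c @ (r @ inv_path G q) @ c) u"
    by (rule conj_walk[OF K_walk[OF rq]])
  then have "inv_path G c @ (r @ inv_path G q) @ c \<in> S"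
    using rq unfolding S_def by auto
  then show ?thesis
    unfolding emb_def r_def[symmetric] cls_eq_iff[OF emb_walk[OF r] emb_walk[OF q]]
    using serre by simp
qed

lemma K_path: "v \<in> V \<Longrightarrow> \<exists>q. gwalk K b q v"
  using conn b unfolding serre_connected_iff[OF K] by simp

text \<open>
  The projection of the covering recovers \<open>v\<close> from \<open>emb v\<close>.
\<close>

lemma emb_inj: "v \<in> V \<Longrightarrow> w \<in> V \<Longrightarrow> emb v = emb w \<longleftrightarrow> v = w"
proof -
  assume "v \<in> V" "w \<in> V"
  then obtain p q where p: "gwalk K b p v" and q: "gwalk K b q w"
    using K_path by blast
  then show ?thesis
    using emb_eq[OF p] emb_eq[OF q] cls_eq_iff[OF emb_walk[OF p] emb_walk[OF q]] by auto
qed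

lemma emb_arc:
  assumes d: "d \<in> E"
  shows "emb_arc d \<in> garcs C" "ghead C (emb_arc d) = emb (ghead G d)"
    "bar C (emb_arc d) = emb_arc (bar G d)"
proof -
  have dG: "d \<in> garcs G" and t: "gtail G d \<in> V"
    using closed_subgraphD[OF cl] d by auto
  obtain q where q: "gwalk K b q (gtail G d)" using K_path[OF t] by blast
  have "gwalk K b (q @ [d]) (ghead G d)"
    using q d K closed_subgraph_head[OF serre cl d] by (auto simp: gwalk_append_iff)
  then have h: "emb (ghead G d) = cls ((inv_path G c @ q) @ [d])"
    using emb_eq[of "q @ [d]"] by simp
  note e = emb_eq[OF q] and w = emb_walk[OF q]
  show "emb_arc d \<in> garcs C" using arc_C_iff[OF w] dG e by simp
  show "ghead C (emb_arc d) = emb (ghead G d)" using head_C[OF dG w] e h by simp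
  show "bar C (emb_arc d) = emb_arc (bar G d)" using bar_C[OF dG w] e h dG serre by simp
qed

lemma closed_emb: "closed_subgraph C EV EE"
  unfolding closed_subgraph_def
proof (intro conjI ballI subsetI)
  fix X assume "X \<in> EV"
  then obtain v q where "X = emb v" and q: "gwalk K b q v" using K_path by blast
  then show "X \<in> gverts C"
    using emb_eq[OF q] emb_walk[OF q] unfolding verts_C by blast
next
  fix e assume "e \<in> EE"
  then obtain d where d: "d \<in> E" "e = emb_arc d" by blast
  then show "e \<in> garcs C" "gtail C e \<in> EV" "bar C e \<in> EE"
    using emb_arc closed_subgraphD[OF cl] by auto
qed

abbreviation "KC \<equiv> subgraph_on C EV EE"

lemma KC: "serre_graph KC"
  by (rule serre_subgraph_on[OF serre_C closed_emb])

lemma emb_iso: "graph_iso K KC emb (\<lambda>d. emb_arc d)"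
  unfolding graph_iso_def
  using emb_inj emb_arc by (auto simp: bij_betw_def inj_on_def)

lemma lift_emb:
  assumes "gwalk K v p w"
  shows "lift_path C (emb v) p = map (\<lambda>d. emb_arc d) p"
  using assms
proof (induction p arbitrary: v)
  case (Cons d p)
  then have d: "d \<in> E" "gtail G d = v" and p: "gwalk K (ghead G d) p w"
    using K by auto
  show ?case
    using Cons.IH[OF p] emb_arc(2)[OF d(1)] d(2) by simp
qed simp

text \<open>
  A reduced path between lifted vertices projects to a reduced path \<open>P\<close> in \<open>G\<close>.  As its ends
  are in \<open>K\<close> and it is closed up in the covering, \<open>P\<close> is homotopic to a path in \<open>K\<close>, and
  hence equal to the reduced form of this path.
\<close>

lemma convex_emb: "convex_subgraph C EV EE"
  unfolding convex_subgraph_def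
proof (intro conjI closed_emb ballI allI impI)
  fix X Y w
  assume X: "X \<in> EV" and Y: "Y \<in> EV" and w: "gwalk C X w Y" "reduced C w"
  obtain x p where x: "X = emb x" "gwalk K b p x" using X K_path by blast
  obtain y q where y: "Y = emb y" "gwalk K b q y" using Y K_path by blast
  define P where "P = map snd w"
  note px = emb_walk[OF x(2)] and qy = emb_walk[OF y(2)]
  have wX: "gwalk C (cls (inv_path G c @ p)) w Y"
    using w(1) x(1) emb_eq[OF x(2)] by simp
  from walk_C_lift[OF px wX] obtain y' where P: "gwalk G x P y'"
    and YP: "Y = cls ((inv_path G c @ p) @ P)" and wl: "w = lift_path C X P" and red: "reduced G P"
    unfolding P_def using emb_eq[OF x(2)] x(1) w(2) by auto
  have pP: "gwalk G u ((inv_path G c @ p) @ P) y'"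
    by (rule gwalk_appendI[OF serre px P])
  have "cls ((inv_path G c @ p) @ P) = cls (inv_path G c @ q)"
    using YP y(1) emb_eq[OF y(2)] by simp
  then have y': "y' = y" and "((inv_path G c @ p) @ P) @ inv_path G (inv_path G c @ q) \<in> S"
    using cls_eq_iff[OF pP qy] by auto
  then have "inv_path G c @ p @ P @ inv_path G q @ c \<in> S"
    using serre by simp
  then obtain r where r: "gwalk K b r b"
    and hom: "path_homotopic G u u (inv_path G c @ (r @ c))
        (inv_path G c @ ((p @ P @ inv_path G q) @ c))"
    by (auto simp: S_def)
  have "path_homotopic G b u (r @ c) ((p @ P @ inv_path G q) @ c)"
    by (rule path_homotopic_left_cancel[OF serre hom gwalk_inv_path[OF serre c]])
  then have "path_homotopic G b b (p @ P @ inv_path G q) r"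
    using path_homotopic_right_cancel[OF serre _ c] path_homotopic_sym by metis
  then have "path_homotopic G x b (P @ inv_path G q) (inv_path G p @ r)"
    by (rule path_homotopic_swap_left[OF serre _ K_walk[OF x(2)]])
  then have hP: "path_homotopic G x y P ((inv_path G p @ r) @ inv_path G (inv_path G q))"
    using path_homotopic_swap[OF serre _ gwalk_inv_path[OF serre K_walk[OF y(2)]]] by blast
  have "P = tighten G ((inv_path G p @ r) @ inv_path G (inv_path G q))"
    using tighten_homotopic[OF serre hP] tighten_reduced[OF red] by simp
  then have "set P \<subseteq> set ((inv_path G p @ r) @ inv_path G (inv_path G q))"
    using set_tighten by metis
  also have "\<dots> \<subseteq> E"
    using gwalk_arcs[OF K_inv[OF x(2)]] gwalk_arcs[OF r] gwalk_arcs[OF y(2)] serre by simp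
  finally have "gwalk K x P y"
    using P y' gwalk_end[OF K x(2)] by (simp add: gwalk_subgraph_on[OF serre cl])
  then have "w = map (\<lambda>d. emb_arc d) P" and "set P \<subseteq> E"
    using lift_emb[of x P y] wl x(1) gwalk_arcs[of K x P y] by simp_all
  then show "set w \<subseteq> EE" by auto
qed

lemma core_of_covering:
  assumes "finite_connected_graph K" "\<And>v. v \<in> V \<Longrightarrow> 2 \<le> valence K v"
  shows "compact_core C = KC"
proof (rule compact_core_eq[OF serre_C connected_C convex_emb])
  have "fin_digraph (dig K)" using assms(1) by (simp add: finite_connected_graph_def)
  then have "finite V" using fin_digraph.finite_verts[of "dig K"] by simp
  then show "finite EV" by simp
  show "connected (dig KC)"
    using finite_connected_graph_iso[OF assms(1) KC emb_iso] by (simp add: finite_connected_graph_def)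
  fix X assume "X \<in> EV"
  then show "2 \<le> valence KC X"
    using graph_iso_valence[OF emb_iso _ K] assms(2) by auto
qed

text \<open>
  The lift of a marking \<open>h\<close> that is homotopic, along \<open>c\<close>, to a marking \<open>k\<close> of \<open>K\<close> is
  homotopic to the lift of \<open>k\<close> along the lift of \<open>c\<close>, and the retraction onto the core takes
  this homotopy into the core.
\<close>

lemma restriction_cover_core:
  assumes fin: "finite_connected_graph K" and val: "\<forall>v \<in> V. 2 \<le> valence K v"
    and k: "is_gmap (rose m) K k" "vmap k () = b"
    and h: "is_gmap (rose m) G h" "vmap h () = u"
    and hom: "\<forall>d \<in> garcs (rose m). path_homotopic G b u (dmap k d @ c) (c @ dmap h d)"
    and S: "image_subgroup m G h = S"
    and D: "(D, h') = restriction_cover m (G, h)"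
  shows "marked_equiv m (K, k) (compact_core D, core_retraction D \<circ>\<^sub>g h')"
    and "graph_iso K (compact_core D) emb (\<lambda>d. emb_arc d)"
    and "serre_graph (compact_core D)"
    and "is_gmap (rose m) (compact_core D) (core_retraction D \<circ>\<^sub>g h')"
proof -
  let ?x = "cls []"
  have DC: "D = C" and h': "h' = \<lparr>vmap = \<lambda>_. ?x, dmap = \<lambda>a. lift_path C ?x (dmap h a)\<rparr>"
    using D S h(2) by (auto simp: restriction_cover_def Let_def)
  let ?r = "core_retraction C"
  have core: "compact_core C = KC"
    by (rule core_of_covering[OF fin]) (use val in blast)
  have EVne: "EV \<noteq> {}" using b by blast
  note r = core_retraction_gmap[OF serre_C connected_C convex_emb EVne core]
    and rv = core_retraction_vertex[OF serre_C connected_C convex_emb EVne core]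
    and rp = core_retraction_path[OF serre_C connected_C convex_emb EVne core]
  have coreS: "serre_graph (compact_core C)" using KC core by simp
  have u0: "gwalk G u [] u" using base by simp
  have kw: "gwalk K b (dmap k d) b" if "d \<in> garcs (rose m)" for d
    using is_gmapD(2)[OF k(1) that] k(2) by simp
  have hw: "gwalk G u (dmap h d) u" if "d \<in> garcs (rose m)" for d
    using is_gmapD(2)[OF h(1) that] h(2) by simp
  have hS: "dmap h d \<in> S" if d: "d \<in> garcs (rose m)" for d
  proof -
    have "path_homotopic G u u (inv_path G c @ dmap k d @ c) (inv_path G c @ c @ dmap h d)"
      by (rule path_homotopic_append_left[OF serre gwalk_inv_path[OF serre c] bspec[OF hom d]])
    moreover have "path_homotopic G u u ((inv_path G c @ c) @ dmap h d) ([] @ dmap h d)"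
      by (rule path_homotopic_append_right[OF serre hw[OF d] path_homotopic_cancel_left[OF serre c]])
    ultimately have "path_homotopic G u u (inv_path G c @ dmap k d @ c) (dmap h d)"
      using path_homotopic_trans by fastforce
    then show ?thesis
      unfolding S_def using kw[OF d] by blast
  qed
  have closed: "cls (dmap h d) = ?x" if "d \<in> garcs (rose m)" for d
    using cls_eq_iff[OF hw[OF that] u0] hS[OF that] by simp
  have h'_gmap: "is_gmap (rose m) C h'"
    unfolding is_gmap_def
  proof (intro conjI ballI)
    show "vmap h' v \<in> gverts C" for v
      using u0 unfolding verts_C h' by (simp del: gwalk_Nil) blast
    fix d assume d: "d \<in> garcs (rose m)"
    show "gwalk C (vmap h' (gtail (rose m) d)) (dmap h' d) (vmap h' (ghead (rose m) d))"
      using lift_path_walk[OF u0 hw[OF d]] closed[OF d] unfolding h' by simp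
    show "dmap h' (bar (rose m) d) = inv_path C (dmap h' d)"
      using lift_path_inv_path[OF u0 hw[OF d]] closed[OF d] is_gmapD(3)[OF h(1) d]
      unfolding h' by simp
  qed
  show gr: "is_gmap (rose m) (compact_core D) (core_retraction D \<circ>\<^sub>g h')"
    unfolding DC by (rule is_gmap_comp[OF serre_C coreS h'_gmap r])
  show iso: "graph_iso K (compact_core D) emb (\<lambda>d. emb_arc d)"
    unfolding DC core by (rule emb_iso)
  show "serre_graph (compact_core D)"
    unfolding DC by (rule coreS)
  have b0: "gwalk K b [] b" using b by simp
  have be: "emb b = cls (inv_path G c)" using emb_eq[OF b0] by simp
  have cw: "gwalk G u (inv_path G c) b" by (rule gwalk_inv_path[OF serre c])
  define c' where "c' = lift_path C (emb b) c"
  have cx: "cls (inv_path G c @ c) = ?x"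
    by (rule cls_homotopic[OF path_homotopic_cancel_left[OF serre c]])
  have c': "gwalk C (emb b) c' ?x"
    using lift_path_walk[OF cw c] cx unfolding c'_def be by simp
  have rb: "vmap ?r (emb b) = emb b" by (rule rv) (use b in blast)
  have "homotopic_gmaps (rose m) (compact_core C) {} (iso_gmap emb (\<lambda>d. emb_arc d) \<circ>\<^sub>g k) (?r \<circ>\<^sub>g h')"
  proof (rule homotopic_gmapsI[where c = "\<lambda>_. map_path ?r c'"])
    show "is_gmap (rose m) (compact_core C) (iso_gmap emb (\<lambda>d. emb_arc d) \<circ>\<^sub>g k)"
      unfolding core by (rule is_gmap_comp[OF K KC k(1) is_gmap_iso[OF K KC emb_iso]])
    show "is_gmap (rose m) (compact_core C) (?r \<circ>\<^sub>g h')"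
      using gr unfolding DC .
    have *: "gwalk (compact_core C) (emb b) (map_path ?r c') (vmap ?r ?x)"
      using is_gmap_walk[OF serre_C coreS r c'] rb by simp
    show "gwalk (compact_core C) (vmap (iso_gmap emb (\<lambda>d. emb_arc d) \<circ>\<^sub>g k) v) (map_path ?r c')
        (vmap (?r \<circ>\<^sub>g h') v)" for v
      using * k(2) by (simp add: h')
  next
    fix d assume d: "d \<in> garcs (rose m)"
    have kd: "emb b = cls (inv_path G c @ dmap k d)"
      by (rule emb_eq[OF kw[OF d]])
    have "cls (inv_path G c @ dmap k d @ c) = cls (inv_path G c @ c @ dmap h d)"
      by (rule cls_homotopic[OF path_homotopic_append_left[OF serre cw bspec[OF hom d]]])
    also have "\<dots> = cls ((inv_path G c @ c) @ dmap h d)" by simp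
    also have "\<dots> = cls ([] @ dmap h d)"
      by (rule cls_homotopic[OF path_homotopic_append_right[OF serre hw[OF d]
            path_homotopic_cancel_left[OF serre c]]])
    finally have "cls (inv_path G c @ dmap k d @ c) = ?x"
      using closed[OF d] by simp
    with lift_path_homotopic[OF cw bspec[OF hom d]]
    have "path_homotopic C (emb b) ?x (lift_path C (emb b) (dmap k d @ c))
        (lift_path C (emb b) (c @ dmap h d))"
      unfolding be by simp
    moreover have "lift_path C (emb b) (dmap k d @ c) = map (\<lambda>d. emb_arc d) (dmap k d) @ c'"
      using lift_path_append[OF cw K_walk[OF kw[OF d]], of c] kd lift_emb[OF kw[OF d]]
      unfolding c'_def be by simp
    moreover have "lift_path C (emb b) (c @ dmap h d) = c' @ dmap h' d"
      using lift_path_append[OF cw c, of "dmap h d"] cx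
      unfolding c'_def be h' by simp
    ultimately have "path_homotopic C (emb b) ?x (map (\<lambda>d. emb_arc d) (dmap k d) @ c') (c' @ dmap h' d)"
      by simp
    from is_gmap_homotopic[OF serre_C coreS r this]
    have "path_homotopic (compact_core C) (emb b) (vmap ?r ?x)
        (map_path ?r (map (\<lambda>d. emb_arc d) (dmap k d)) @ map_path ?r c')
        (map_path ?r c' @ map_path ?r (dmap h' d))"
      using rb by simp
    moreover have "map_path ?r (map (\<lambda>d. emb_arc d) (dmap k d)) = map (\<lambda>d. emb_arc d) (dmap k d)"
      by (rule rp) (use gwalk_arcs[OF kw[OF d]] in auto)
    ultimately show "path_homotopic (compact_core C)
        (vmap (iso_gmap emb (\<lambda>d. emb_arc d) \<circ>\<^sub>g k) (gtail (rose m) d))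
        (vmap (?r \<circ>\<^sub>g h') (ghead (rose m) d))
        (dmap (iso_gmap emb (\<lambda>d. emb_arc d) \<circ>\<^sub>g k) d @ map_path ?r c')
        (map_path ?r c' @ dmap (?r \<circ>\<^sub>g h') d)"
      using k(2) by (simp add: h')
  qed simp
  with iso show "marked_equiv m (K, k) (compact_core D, core_retraction D \<circ>\<^sub>g h')"
    unfolding DC marked_equiv_def prod.case by blast
qed

end

section \<open>Erasing vertices of valence 2\<close>

lemma kept_verts_subset: "gverts G \<noteq> {} \<Longrightarrow> kept_verts G \<subseteq> gverts G"
  by (auto simp: kept_verts_def Let_def some_in_eq)

lemma kept_verts_eq:
  "\<exists>v \<in> gverts G. valence G v \<noteq> 2 \<Longrightarrow> kept_verts G = {v \<in> gverts G. valence G v \<noteq> 2}"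
  by (auto simp: kept_verts_def Let_def)

lemma kept_verts_nonempty: "kept_verts G \<noteq> {}"
  by (auto simp: kept_verts_def Let_def)

lemma erased_valence: "v \<in> gverts G \<Longrightarrow> v \<notin> kept_verts G \<Longrightarrow> valence G v = 2"
  by (auto simp: kept_verts_def Let_def split: if_splits)

lemma valence_2_unique:
  assumes "valence G v = 2" "e \<in> out_arcs (dig G) v" "d \<in> out_arcs (dig G) v" "d' \<in> out_arcs (dig G) v"
    "d \<noteq> e" "d' \<noteq> e"
  shows "d = d'"
proof -
  from assms(1) obtain x y where "out_arcs (dig G) v = {x, y}"
    by (auto simp: out_degree_def card_2_iff)
  with assms show ?thesis by auto
qed

lemma chainsD:
  assumes "p \<in> chains G"
  shows "p \<noteq> []" "reduced G p" "d \<in> set (tl p) \<Longrightarrow> gtail G d \<notin> kept_verts G"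
    "\<exists>u \<in> kept_verts G. \<exists>v \<in> kept_verts G. gwalk G u p v"
  using assms by (auto simp: chains_def)

text \<open>A path through erased vertices has no choice: each of them offers one way to go on.\<close>

lemma chain_continuation_unique:
  assumes G: "serre_graph G" and "e \<in> garcs G"
    and "gwalk G (ghead G e) p v" "v \<in> kept_verts G" "reduced G (e # p)"
    "\<And>d. d \<in> set p \<Longrightarrow> gtail G d \<notin> kept_verts G"
    and "gwalk G (ghead G e) q w" "w \<in> kept_verts G" "reduced G (e # q)"
    "\<And>d. d \<in> set q \<Longrightarrow> gtail G d \<notin> kept_verts G"
  shows "p = q"
  using assms(2-)
proof (induction p arbitrary: e q)
  case Nil
  have "q = []"
  proof (rule ccontr)
    assume ne: "q \<noteq> []"
    then have "gtail G (hd q) \<notin> kept_verts G"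
      using Nil.prems(9)[OF hd_in_set] by blast
    moreover have "gtail G (hd q) = ghead G e"
      by (rule gwalk_hd_tail[OF G Nil.prems(6) ne])
    ultimately show False using Nil.prems(2,3) by simp
  qed
  then show ?case by simp
next
  case (Cons d p)
  have "q \<noteq> []"
  proof
    assume "q = []"
    then have "ghead G e \<in> kept_verts G" using Cons.prems(6,7) by simp
    moreover have "gtail G d \<notin> kept_verts G" "gtail G d = ghead G e"
      using Cons.prems(5)[of d] Cons.prems(2) G by simp_all
    ultimately show False by simp
  qed
  then obtain d' q' where q: "q = d' # q'" by (cases q) auto
  have d: "d \<in> garcs G" "gtail G d = ghead G e" "d' \<in> garcs G" "gtail G d' = ghead G e"
    using Cons.prems G q by auto
  have "valence G (ghead G e) = 2"
    using Cons.prems(5)[of d] Cons.prems(1) d G by (intro erased_valence) simp_all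
  moreover have "d \<noteq> bar G e" "d' \<noteq> bar G e"
    using Cons.prems q by auto
  ultimately have dd: "d = d'"
    using d G Cons.prems(1) by (intro valence_2_unique[of G "ghead G e" "bar G e" d d']) auto
  have "p = q'"
    by (rule Cons.IH[of d]) (use Cons.prems q dd G in auto)
  then show ?case using q dd by simp
qed

lemma chain_unique:
  assumes G: "serre_graph G" and p: "p \<in> chains G" and q: "q \<in> chains G" and "hd p = hd q"
  shows "p = q"
proof -
  obtain e p' where p': "p = e # p'" using chainsD(1)[OF p] by (cases p) auto
  then obtain q' where q': "q = e # q'" using chainsD(1)[OF q] assms(4) by (cases q) auto
  obtain u v where uv: "v \<in> kept_verts G" "gwalk G u p v" using chainsD(4)[OF p] by blast
  obtain u' w where uw: "w \<in> kept_verts G" "gwalk G u' q w" using chainsD(4)[OF q] by blast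
  have "p' = q'"
    by (rule chain_continuation_unique[of G e p' v q' w])
      (use G uv uw chainsD(2,3)[OF p] chainsD(2,3)[OF q] p' q' in auto)
  then show ?thesis using p' q' by simp
qed

text \<open>
  If a path is its own inverse, so is the path without its first and last arc.  The process ends
  with an arc that is its own inverse or with a backtracking.
\<close>

lemma inv_path_neq:
  assumes "serre_graph G" "reduced G p" "set p \<subseteq> garcs G" "p \<noteq> []"
  shows "inv_path G p \<noteq> p"
  using assms(2-)
proof (induction p rule: length_induct)
  case (1 p)
  show ?case
  proof
    assume inv: "inv_path G p = p"
    obtain d q where p: "p = d # q" using 1 by (cases p) auto
    show False
    proof (cases q rule: rev_cases)
      case Nil
      then show False using inv p serre_bar_neq[OF assms(1)] 1 by auto
    next
      case (snoc r e)
      then have "d = bar G e" "inv_path G r = r" using inv p by auto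
      moreover have "r \<noteq> [] \<longrightarrow> inv_path G r \<noteq> r"
        using 1 p snoc by auto
      ultimately show False
        using 1 p snoc assms(1) by auto
    qed
  qed
qed

lemma gwalk_inner_verts:
  assumes "serre_graph G" "gwalk G u p v"
  shows "map (ghead G) (butlast p) = map (gtail G) (tl p)"
  using assms(2)
proof (induction p arbitrary: u)
  case (Cons d p)
  then show ?case using assms(1) by (cases p) auto
qed simp

lemma inv_path_chain:
  assumes G: "serre_graph G" and p: "p \<in> chains G"
  shows "inv_path G p \<in> chains G"
proof -
  obtain u v where uv: "u \<in> kept_verts G" "v \<in> kept_verts G" "gwalk G u p v"
    using chainsD(4)[OF p] by blast
  have "gtail G d \<notin> kept_verts G" if d: "d \<in> set (tl (inv_path G p))" for d
  proof -
    have "tl (rev xs) = rev (butlast xs)" for xs :: "'b list"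
      by (metis butlast_rev rev_rev_ident)
    then have "set (tl (inv_path G p)) = bar G ` set (butlast p)"
      by (simp add: inv_path_def map_butlast flip: set_map)
    then obtain c where c: "c \<in> set (butlast p)" "d = bar G c" using d by auto
    then have "c \<in> garcs G" using gwalk_arcs[OF uv(3)] in_set_butlastD by fastforce
    then have "gtail G d = ghead G c" using c G by simp
    also have "\<dots> \<in> gtail G ` set (tl p)"
      using gwalk_inner_verts[OF G uv(3)] c(1) by (metis image_eqI list.set_map)
    finally show ?thesis using chainsD(3)[OF p] by auto
  qed
  moreover have "gwalk G v (inv_path G p) u" by (rule gwalk_inv_path[OF G uv(3)])
  ultimately show ?thesis
    using chainsD(1)[OF p] reduced_inv_path[OF G chainsD(2)[OF p]] uv
    by (auto simp: chains_def)
qed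

lemma erase_simps [simp]:
  "gverts (erase G) = kept_verts G" "garcs (erase G) = chains G"
  "gtail (erase G) p = gtail G (hd p)" "ghead (erase G) p = ghead G (last p)"
  "p \<in> chains G \<Longrightarrow> bar (erase G) p = inv_path G p"
  by (simp_all add: erase_def)

lemma chain_walk:
  assumes "serre_graph G" "p \<in> chains G"
  shows "gwalk G (gtail G (hd p)) p (ghead G (last p))"
    "gtail G (hd p) \<in> kept_verts G" "ghead G (last p) \<in> kept_verts G"
proof -
  obtain u v where "u \<in> kept_verts G" "v \<in> kept_verts G" "gwalk G u p v"
    using chainsD(4)[OF assms(2)] by blast
  then show "gwalk G (gtail G (hd p)) p (ghead G (last p))"
    "gtail G (hd p) \<in> kept_verts G" "ghead G (last p) \<in> kept_verts G"
    using gwalk_hd_tail[OF assms(1)] gwalk_last_head[OF assms(1)] chainsD(1)[OF assms(2)]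
    by metis+
qed

lemma serre_erase:
  assumes G: "serre_graph G"
  shows "serre_graph (erase G)"
proof (rule serre_graphI)
  fix p
  assume "p \<in> garcs (erase G)"
  then have p: "p \<in> chains G" by simp
  show "gtail (erase G) p \<in> gverts (erase G)"
    using chain_walk(2)[OF G p] by simp
  show "bar (erase G) p \<in> garcs (erase G)"
    using p inv_path_chain[OF G p] by simp
  show "bar (erase G) (bar (erase G) p) = p"
    using p inv_path_chain[OF G p] G by simp
  show "bar (erase G) p \<noteq> p"
    using p inv_path_neq[OF G chainsD(2)[OF p] gwalk_arcs[OF chain_walk(1)[OF G p]] chainsD(1)[OF p]]
    by simp
  have "last p \<in> garcs G"
    using gwalk_arcs[OF chain_walk(1)[OF G p]] chainsD(1)[OF p] by auto
  moreover have "hd (inv_path G p) = bar G (last p)"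
    using chainsD(1)[OF p] by (simp add: inv_path_def hd_rev last_map)
  ultimately show "gtail (erase G) (bar (erase G) p) = ghead (erase G) p"
    using p G by simp
next
  fix p
  assume "p \<notin> garcs (erase G)"
  then show "bar (erase G) p = p" by (simp add: erase_def)
qed

lemma subdivide_simps [simp]: "vmap subdivide v = v" "dmap subdivide p = p"
  by (simp_all add: subdivide_def)

lemma map_path_subdivide [simp]: "map_path subdivide ps = concat ps"
  by (induction ps) simp_all

lemma is_gmap_subdivide:
  assumes "serre_graph G" "gverts G \<noteq> {}"
  shows "is_gmap (erase G) G subdivide"
  using kept_verts_subset[OF assms(2)] chain_walk[OF assms(1)] by (auto simp: is_gmap_def)

lemma erase_walk:
  assumes "serre_graph G" "gverts G \<noteq> {}" "gwalk (erase G) u ps v"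
  shows "gwalk G u (concat ps) v"
  using is_gmap_walk[OF serre_erase[OF assms(1)] assms(1) is_gmap_subdivide[OF assms(1,2)] assms(3)]
  by simp

text \<open>
  The path is cut at the kept vertices through which it passes.
\<close>

lemma chain_decomposition:
  assumes G: "serre_graph G" and "reduced G p" "gwalk G u p v" "u \<in> kept_verts G" "v \<in> kept_verts G"
  shows "\<exists>ps. gwalk (erase G) u ps v \<and> concat ps = p"
  using assms(2-)
proof (induction p arbitrary: u rule: length_induct)
  case (1 p)
  show ?case
  proof (cases p)
    case Nil
    then show ?thesis using 1 by (intro exI[of _ "[]"]) auto
  next
    case (Cons d q)
    let ?P = "\<lambda>c. gtail G c \<notin> kept_verts G"
    let ?c = "d # takeWhile ?P q" and ?r = "dropWhile ?P q"
    have p: "p = ?c @ ?r" using Cons by simp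
    obtain x where x: "gwalk G u ?c x" "gwalk G x ?r v"
      using 1(3) unfolding p gwalk_append_iff[OF G] by blast
    have xk: "x \<in> kept_verts G"
    proof (cases ?r)
      case Nil
      then have "x = v" using x(2) by (metis gwalk_Nil)
      then show ?thesis using 1 by simp
    next
      case (Cons e r')
      then have "\<not> ?P (hd ?r)" by (metis hd_dropWhile list.distinct(1))
      then show ?thesis using x(2) Cons G by auto
    qed
    have red: "reduced G ?c" "reduced G ?r"
      using 1(2) unfolding p reduced_append by auto
    have "?c \<in> chains G"
      unfolding chains_def using red x(1) xk 1(4) by (auto dest: set_takeWhileD)
    moreover have "length ?r < length p"
      using Cons by (simp add: length_dropWhile_le le_imp_less_Suc)
    then obtain ps where "gwalk (erase G) x ps v" "concat ps = ?r"
      using 1(1) red(2) x(2) xk 1(5) by blast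
    moreover have "gtail G d = u" "ghead G (last ?c) = x"
      using x(1) G gwalk_last_head[OF G x(1)] by auto
    ultimately show ?thesis
      using serre_erase[OF G] p by (intro exI[of _ "?c # ps"]) auto
  qed
qed

lemma concat_chains_hd:
  assumes "set ps \<subseteq> chains G" "ps \<noteq> []"
  shows "concat ps \<noteq> []" "hd (concat ps) = hd (hd ps)"
  using assms chainsD(1) by (cases ps; force)+

text \<open>
  A cancellation can only occur where two chains meet.  Then the second chain starts with the
  same arc as the inverse of the first one, and therefore equals it.
\<close>

lemma reduced_concat_chains:
  assumes G: "serre_graph G" and "gwalk (erase G) u ps v" "reduced (erase G) ps"
  shows "reduced G (concat ps)"
  using assms(2,3)
proof (induction ps arbitrary: u)
  case (Cons p ps)
  have p: "p \<in> chains G" and ps: "gwalk (erase G) (ghead G (last p)) ps v"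
    using Cons.prems(1) serre_erase[OF G] by auto
  have set_ps: "set ps \<subseteq> chains G" using gwalk_arcs[OF ps] by simp
  have "hd (concat ps) \<noteq> bar G (last p)" if ne: "ps \<noteq> []"
  proof
    assume "hd (concat ps) = bar G (last p)"
    then have "hd (hd ps) = hd (inv_path G p)"
      using concat_chains_hd[OF set_ps ne] chainsD(1)[OF p] by (simp add: inv_path_def hd_rev last_map)
    then have "hd ps = inv_path G p"
      using chain_unique[OF G _ inv_path_chain[OF G p]] set_ps ne by (metis hd_in_set subsetD)
    then show False using Cons.prems(2) p ne by simp
  qed
  then show ?case
    using Cons.IH[OF ps] Cons.prems(2) chainsD(2)[OF p] by (cases "ps = []") simp_all
qed simp

text \<open>
  The chains can be read off one after the other, as each is determined by its first arc.
\<close>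

lemma concat_chains_inj:
  assumes G: "serre_graph G" and "set ps \<subseteq> chains G" "set qs \<subseteq> chains G" "concat ps = concat qs"
  shows "ps = qs"
  using assms(2-)
proof (induction ps arbitrary: qs)
  case Nil
  then show ?case using concat_chains_hd(1)[of qs G] by auto
next
  case (Cons p ps)
  then have "concat qs \<noteq> []" using concat_chains_hd(1)[of "p # ps" G] by simp
  then obtain q qs' where qs: "qs = q # qs'" by (cases qs) auto
  have "hd p = hd q"
    using concat_chains_hd(2)[of "p # ps" G] concat_chains_hd(2)[of qs G] Cons.prems qs by simp
  then have "p = q" using chain_unique[OF G] Cons.prems qs by simp
  then show ?case using Cons.IH[of qs'] Cons.prems qs by simp
qed

text \<open>
  Subdividing identifies the reduced paths of the two graphs that run between kept vertices,
  so it is injective on homotopy classes.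
\<close>

lemma erase_homotopic:
  assumes G: "serre_graph G" "gverts G \<noteq> {}"
    and p: "gwalk (erase G) u p v" and q: "gwalk (erase G) u q v"
    and hom: "path_homotopic G u v (concat p) (concat q)"
  shows "path_homotopic (erase G) u v p q"
proof -
  note E = serre_erase[OF G(1)] and sub = is_gmap_subdivide[OF G]
  have t: "gwalk (erase G) u (tighten (erase G) r) v"
    "path_homotopic G u v (concat r) (concat (tighten (erase G) r))"
    "reduced G (concat (tighten (erase G) r))" if "gwalk (erase G) u r v" for r
  proof -
    note rt = path_homotopic_tighten[OF E that]
    show w: "gwalk (erase G) u (tighten (erase G) r) v"
      by (rule path_homotopic_walks(2)[OF rt])
    show "path_homotopic G u v (concat r) (concat (tighten (erase G) r))"
      using is_gmap_homotopic[OF E G(1) sub rt] by simp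
    show "reduced G (concat (tighten (erase G) r))"
      by (rule reduced_concat_chains[OF G(1) w]) simp
  qed
  have "path_homotopic G u v (concat (tighten (erase G) p)) (concat (tighten (erase G) q))"
    using path_homotopic_trans[OF path_homotopic_sym[OF t(2)[OF p]]
        path_homotopic_trans[OF hom t(2)[OF q]]] .
  then have "concat (tighten (erase G) p) = concat (tighten (erase G) q)"
    by (rule reduced_homotopic_unique[OF G(1) _ t(3)[OF p] t(3)[OF q]])
  then have "tighten (erase G) p = tighten (erase G) q"
    using concat_chains_inj[OF G(1)] gwalk_arcs[OF t(1)[OF p]] gwalk_arcs[OF t(1)[OF q]] by simp
  then show ?thesis
    using path_homotopic_iff_tighten[OF E p q] by simp
qed

text \<open>
  The tracks of a homotopy in \<open>G\<close> run between kept vertices, so their reduced forms decompose into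
  chains.
\<close>

lemma erase_homotopic_gmaps:
  assumes R: "serre_graph R" and G: "serre_graph G" "gverts G \<noteq> {}"
    and f: "is_gmap R (erase G) f" "is_gmap R (erase G) f'"
    and hom: "homotopic_gmaps R G {} (subdivide \<circ>\<^sub>g f) (subdivide \<circ>\<^sub>g f')"
  shows "homotopic_gmaps R (erase G) {} f f'"
proof -
  note E = serre_erase[OF G(1)]
  from hom obtain c where hc: "homotopy_along R G c (subdivide \<circ>\<^sub>g f) (subdivide \<circ>\<^sub>g f')"
    unfolding homotopic_gmaps_iff by blast
  note c = homotopy_alongD(3)[OF hc] and d = homotopy_alongD(4)[OF hc]
  have "\<exists>q. gwalk (erase G) (vmap f v) q (vmap f' v) \<and> concat q = tighten G (c v)"
    if v: "v \<in> gverts R" for v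
  proof (rule chain_decomposition[OF G(1)])
    show "gwalk G (vmap f v) (tighten G (c v)) (vmap f' v)"
      using path_homotopic_walks(2)[OF path_homotopic_tighten[OF G(1) c[OF v]]] by simp
  qed (use is_gmapD(1)[OF f(1) v] is_gmapD(1)[OF f(2) v] in auto)
  then obtain c' where c': "\<And>v. v \<in> gverts R \<Longrightarrow> gwalk (erase G) (vmap f v) (c' v) (vmap f' v)"
    "\<And>v. v \<in> gverts R \<Longrightarrow> concat (c' v) = tighten G (c v)"
    by metis
  have cc: "path_homotopic G (vmap f v) (vmap f' v) (c v) (concat (c' v))" if v: "v \<in> gverts R" for v
    using path_homotopic_tighten[OF G(1) c[OF v]] c'(2)[OF v] by simp
  show ?thesis
  proof (rule homotopic_gmapsI[OF f, where c = c'])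
    fix e assume e: "e \<in> garcs R"
    let ?t = "gtail R e" and ?h = "ghead R e"
    have t: "?t \<in> gverts R" and h: "?h \<in> gverts R" using e R by auto
    note fe = is_gmapD(2)[OF f(1) e] and fe' = is_gmapD(2)[OF f(2) e]
    show "path_homotopic (erase G) (vmap f ?t) (vmap f' ?h) (dmap f e @ c' ?h) (c' ?t @ dmap f' e)"
    proof (rule erase_homotopic[OF G])
      show "gwalk (erase G) (vmap f ?t) (dmap f e @ c' ?h) (vmap f' ?h)"
        by (rule gwalk_appendI[OF E fe c'(1)[OF h]])
      show "gwalk (erase G) (vmap f ?t) (c' ?t @ dmap f' e) (vmap f' ?h)"
        by (rule gwalk_appendI[OF E c'(1)[OF t] fe'])
      have "path_homotopic G (vmap f ?t) (vmap f' ?h)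
          (concat (dmap f e) @ concat (c' ?h)) (concat (dmap f e) @ c ?h)"
        by (rule path_homotopic_append_left[OF G(1) erase_walk[OF G fe] path_homotopic_sym[OF cc[OF h]]])
      also have "path_homotopic G (vmap f ?t) (vmap f' ?h) (concat (dmap f e) @ c ?h)
          (c ?t @ concat (dmap f' e))"
        using d[OF e] by simp
      also have "path_homotopic G (vmap f ?t) (vmap f' ?h) (c ?t @ concat (dmap f' e))
          (concat (c' ?t) @ concat (dmap f' e))"
        by (rule path_homotopic_append_right[OF G(1) erase_walk[OF G fe'] cc[OF t]])
      finally show "path_homotopic G (vmap f ?t) (vmap f' ?h)
          (concat (dmap f e @ c' ?h)) (concat (c' ?t @ dmap f' e))"
        by simp
    qed
  qed (use c' in auto)
qed

lemma rose_bar: "i \<in> {1..n} \<Longrightarrow> bar (rose n) (i, s) = (i, \<not> s)"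
  by (simp add: rose_def)

text \<open>
  To push a marking off the erased vertices, drag its base vertex along a path \<open>t\<close> to a kept
  vertex and decompose the reduced forms of the conjugated loops into chains.
\<close>

lemma erase_marking_exists:
  fixes G :: "('a, 'b) sgraph"
  assumes G: "serre_graph G" and conn: "connected (dig G)" and g: "is_gmap (rose n) G g"
  shows "\<exists>g0. is_gmap (rose n) (erase G) g0 \<and> homotopic_gmaps (rose n) G {} (subdivide \<circ>\<^sub>g g0) g"
proof -
  note E = serre_erase[OF G]
  have ne: "gverts G \<noteq> {}" using conn unfolding serre_connected_iff[OF G] by simp
  obtain x where x: "x \<in> kept_verts G" using kept_verts_nonempty[of G] by blast
  let ?u = "vmap g ()"
  have "x \<in> gverts G" "?u \<in> gverts G"
    using x kept_verts_subset[OF ne] is_gmapD(1)[OF g] by auto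
  then obtain t where t: "gwalk G x t ?u"
    using conn unfolding serre_connected_iff[OF G] by blast
  have gw: "gwalk G ?u (dmap g d) ?u" if "d \<in> garcs (rose n)" for d
    using is_gmapD(2)[OF g that] by simp
  let ?w = "\<lambda>d. t @ dmap g d @ inv_path G t"
  have w: "gwalk G x (?w d) x" if "d \<in> garcs (rose n)" for d
    by (rule gwalk_appendI[OF G t gwalk_appendI[OF G gw[OF that] gwalk_inv_path[OF G t]]])
  have "\<exists>q. gwalk (erase G) x q x \<and> concat q = tighten G (?w (i, True))" if i: "i \<in> {1..n}" for i
  proof (rule chain_decomposition[OF G])
    show "gwalk G x (tighten G (?w (i, True))) x"
      by (rule path_homotopic_walks(2)[OF path_homotopic_tighten[OF G w]]) (use i in auto)
  qed (use x in auto)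
  then obtain q where q: "\<And>i. i \<in> {1..n} \<Longrightarrow> gwalk (erase G) x (q i) x"
    "\<And>i. i \<in> {1..n} \<Longrightarrow> concat (q i) = tighten G (?w (i, True))"
    by metis
  define g0 :: "(unit, nat \<times> bool, 'a, 'b list) gmap" where "g0 = \<lparr>vmap = \<lambda>_. x,
    dmap = \<lambda>(i, s). if s then q i else inv_path (erase G) (q i)\<rparr>"
  have g0: "is_gmap (rose n) (erase G) g0"
    unfolding is_gmap_def
  proof (intro conjI ballI)
    fix d assume "d \<in> garcs (rose n)"
    then obtain i s where d: "d = (i, s)" "i \<in> {1..n}" by auto
    show "gwalk (erase G) (vmap g0 (gtail (rose n) d)) (dmap g0 d) (vmap g0 (ghead (rose n) d))"
      using q(1)[OF d(2)] E d(1) by (simp add: g0_def)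
    show "dmap g0 (bar (rose n) d) = inv_path (erase G) (dmap g0 d)"
      using E d(1) rose_bar[OF d(2)] by (simp add: g0_def)
  qed (use x in \<open>simp add: g0_def\<close>)
  have hom: "path_homotopic G x x (concat (dmap g0 d)) (?w d)" if "d \<in> {1..n} \<times> UNIV" for d
  proof -
    from that obtain i s where d: "d = (i, s)" "i \<in> {1..n}" by blast
    have iT: "(i, True) \<in> garcs (rose n)" using d by simp
    have T: "path_homotopic G x x (concat (q i)) (?w (i, True))"
      using path_homotopic_sym[OF path_homotopic_tighten[OF G w[OF iT]]] q(2)[OF d(2)] by simp
    show ?thesis
    proof (cases s)
      case True
      then show ?thesis using T d by (simp add: g0_def)
    next
      case False
      have "concat (inv_path (erase G) (q i)) = inv_path G (concat (q i))"
        using is_gmap_inv_path[OF is_gmap_subdivide[OF G ne] gwalk_arcs[OF q(1)[OF d(2)]]] by simp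
      moreover have "dmap g (i, False) = inv_path G (dmap g (i, True))"
        using is_gmapD(3)[OF g iT] rose_bar[OF d(2)] by simp
      ultimately show ?thesis
        using path_homotopic_inv_path[OF G T] False d(1) G by (simp add: g0_def)
    qed
  qed
  have "homotopic_gmaps (rose n) G {} (subdivide \<circ>\<^sub>g g0) g"
  proof (rule homotopic_gmapsI[where c = "\<lambda>_. t"])
    show "is_gmap (rose n) G (subdivide \<circ>\<^sub>g g0)"
      by (rule is_gmap_comp[OF E G g0 is_gmap_subdivide[OF G ne]])
    fix d assume d: "d \<in> garcs (rose n)"
    have "path_homotopic G x ?u (concat (dmap g0 d) @ t) (?w d @ t)"
      by (rule path_homotopic_append_right[OF G t hom[OF d[simplified rose_simps]]])
    moreover have "path_homotopic G x ?u ((t @ dmap g d) @ inv_path G t @ t @ []) ((t @ dmap g d) @ [])"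
      by (rule path_homotopic_cancel_middle[OF G gwalk_appendI[OF G t gw[OF d]] t])
        (use gwalk_end[OF G t] in simp)
    ultimately show "path_homotopic G (vmap (subdivide \<circ>\<^sub>g g0) (gtail (rose n) d))
        (vmap g (ghead (rose n) d)) (dmap (subdivide \<circ>\<^sub>g g0) d @ t) (t @ dmap g d)"
      using path_homotopic_trans by (fastforce simp: g0_def)
  qed (use g t in \<open>auto simp: g0_def\<close>)
  with g0 show ?thesis by blast
qed

lemma erase_markedE:
  assumes "serre_graph G" "connected (dig G)" "is_gmap (rose n) G g"
  obtains g0 where "erase_marked n (G, g) = (erase G, g0)" "is_gmap (rose n) (erase G) g0"
    "homotopic_gmaps (rose n) G {} (subdivide \<circ>\<^sub>g g0) g"
  using that someI_ex[OF erase_marking_exists[OF assms]] by (auto simp: erase_marked_def)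

text \<open>
  On a circle with several vertices an isomorphism need not respect the placeholders, which are
  chosen independently in \<open>G\<close> and \<open>H\<close>; the last assumption excludes this case.
\<close>

lemma graph_iso_kept_verts:
  assumes "serre_graph G" "graph_iso G H \<alpha> \<beta>"
    and "(\<exists>v \<in> gverts G. valence G v \<noteq> 2) \<or> (\<exists>v. gverts G = {v})"
  shows "\<alpha> ` kept_verts G = kept_verts H"
proof -
  have \<alpha>: "\<alpha> ` gverts G = gverts H"
    using graph_isoD(1)[OF assms(2)] by (simp add: bij_betw_def)
  have W: "\<alpha> ` {v \<in> gverts G. valence G v \<noteq> 2} = {v \<in> gverts H. valence H v \<noteq> 2}"
    using graph_iso_valence[OF assms(2) _ assms(1)] \<alpha> by (auto simp: image_iff) (metis imageE)
  show ?thesis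
  proof (cases "\<exists>v \<in> gverts G. valence G v \<noteq> 2")
    case True
    moreover from this have "\<exists>v \<in> gverts H. valence H v \<noteq> 2"
      using W by blast
    ultimately show ?thesis
      using W by (simp add: kept_verts_eq)
  next
    case False
    with assms(3) obtain v where v: "gverts G = {v}" by blast
    have vH: "gverts H = {\<alpha> v}" using v \<alpha> by simp
    have "kept_verts G = {v}" "kept_verts H = {\<alpha> v}"
      using kept_verts_subset[of G] kept_verts_subset[of H] kept_verts_nonempty[of G]
        kept_verts_nonempty[of H] unfolding v vH by blast+
    then show ?thesis by simp
  qed
qed

lemma graph_iso_chain:
  assumes G: "serre_graph G" and H: "serre_graph H" and ne: "gverts G \<noteq> {}"
    and iso: "graph_iso G H \<alpha> \<beta>" and kept: "\<alpha> ` kept_verts G = kept_verts H"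
    and p: "p \<in> chains G"
  shows "map \<beta> p \<in> chains H"
proof -
  note i = graph_isoD[OF iso]
  have inj: "inj_on \<alpha> (gverts G)" "inj_on \<beta> (garcs G)" using i(1,2) by (auto simp: bij_betw_def)
  note w = chain_walk[OF G p]
  have arcs: "set p \<subseteq> garcs G" by (rule gwalk_arcs[OF w(1)])
  have "reduced H (map \<beta> p)"
    unfolding reduced_def
  proof (intro allI impI)
    fix j assume j: "Suc j < length (map \<beta> p)"
    then have pj: "p ! j \<in> garcs G" "p ! Suc j \<in> garcs G" using arcs by auto
    have "p ! Suc j \<noteq> bar G (p ! j)" using chainsD(2)[OF p] j by (simp add: reduced_def)
    then have "\<beta> (p ! Suc j) \<noteq> \<beta> (bar G (p ! j))"
      using inj(2) pj G by (simp add: inj_on_eq_iff)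
    then show "map \<beta> p ! Suc j \<noteq> bar H (map \<beta> p ! j)" using i(7) pj(1) j by simp
  qed
  moreover have "gtail H e \<notin> kept_verts H" if e: "e \<in> set (tl (map \<beta> p))" for e
  proof
    assume k: "gtail H e \<in> kept_verts H"
    from e obtain d where d: "d \<in> set (tl p)" "e = \<beta> d" by (auto simp flip: map_tl)
    moreover have "set (tl p) \<subseteq> garcs G" using arcs by (cases p) auto
    ultimately have dG: "d \<in> garcs G" by blast
    have "\<alpha> (gtail G d) \<in> \<alpha> ` kept_verts G" using k kept i(5)[OF dG] d by simp
    then have "gtail G d \<in> kept_verts G"
      using inj_on_image_mem_iff[OF inj(1) _ kept_verts_subset[OF ne]] dG G by simp
    then show False using chainsD(3)[OF p d(1)] by simp
  qed
  moreover have "\<exists>u \<in> kept_verts H. \<exists>v \<in> kept_verts H. gwalk H u (map \<beta> p) v"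
    using graph_iso_walk[OF G H iso w(1)] w(2,3) kept by blast
  ultimately show ?thesis
    using chainsD(1)[OF p] by (simp add: chains_def)
qed

lemma graph_iso_erase:
  assumes G: "serre_graph G" and H: "serre_graph H" and ne: "gverts G \<noteq> {}"
    and iso: "graph_iso G H \<alpha> \<beta>" and kept: "\<alpha> ` kept_verts G = kept_verts H"
  shows "graph_iso (erase G) (erase H) \<alpha> (map \<beta>)"
proof -
  note i = graph_isoD[OF iso]
  obtain \<alpha>' \<beta>' where inv: "graph_iso H G \<alpha>' \<beta>'"
    "\<And>v. v \<in> gverts G \<Longrightarrow> \<alpha>' (\<alpha> v) = v" "\<And>d. d \<in> garcs G \<Longrightarrow> \<beta>' (\<beta> d) = d"
    "\<And>v. v \<in> gverts H \<Longrightarrow> \<alpha> (\<alpha>' v) = v" "\<And>d. d \<in> garcs H \<Longrightarrow> \<beta> (\<beta>' d) = d"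
    by (rule graph_iso_inverse[OF G iso]) (rule that)
  have neH: "gverts H \<noteq> {}" using ne i(3) by blast
  have kept': "\<alpha>' ` kept_verts H = kept_verts G"
    using inv(2) kept_verts_subset[OF ne] unfolding kept[symmetric] by (force simp: image_image)
  note chain = graph_iso_chain[OF G H ne iso kept] and chain' = graph_iso_chain[OF H G neH inv(1) kept']
  have arcs: "set p \<subseteq> garcs G" if "p \<in> chains G" for p
    using gwalk_arcs[OF chain_walk(1)[OF G that]] .
  have arcsH: "set p \<subseteq> garcs H" if "p \<in> chains H" for p
    using gwalk_arcs[OF chain_walk(1)[OF H that]] .
  have b: "map \<beta>' (map \<beta> p) = p" if "p \<in> chains G" for p
    using arcs[OF that] inv(3) by (auto intro!: map_idI)
  have b': "map \<beta> (map \<beta>' p) = p" if "p \<in> chains H" for p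
    using arcsH[OF that] inv(5) by (auto intro!: map_idI)
  show ?thesis
    unfolding graph_iso_def
  proof (intro conjI ballI)
    show "bij_betw \<alpha> (gverts (erase G)) (gverts (erase H))"
      using kept i(1) kept_verts_subset[OF ne] by (auto simp: bij_betw_def inj_on_subset)
    show "bij_betw (map \<beta>) (garcs (erase G)) (garcs (erase H))"
      by (rule bij_betwI[where g = "map \<beta>'"]) (use chain chain' b b' in auto)
    fix p assume "p \<in> garcs (erase G)"
    then have p: "p \<in> chains G" by simp
    then have "hd p \<in> garcs G" "last p \<in> garcs G" "p \<noteq> []"
      using arcs[OF p] chainsD(1)[OF p] by auto
    then show "gtail (erase H) (map \<beta> p) = \<alpha> (gtail (erase G) p)"
      "ghead (erase H) (map \<beta> p) = \<alpha> (ghead (erase G) p)"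
      using i by (simp_all add: hd_map last_map)
    show "bar (erase H) (map \<beta> p) = map \<beta> (bar (erase G) p)"
      using p chain[OF p] graph_iso_inv_path[OF iso arcs[OF p]] by simp
  qed
qed

text \<open>
  The markings of the graphs with erased vertices become homotopic after subdivision, and hence
  were homotopic before.
\<close>

lemma marked_equiv_erase:
  assumes G: "serre_graph G" "connected (dig G)" and H: "serre_graph H" "connected (dig H)"
    and g: "is_gmap (rose n) G g" and equiv: "marked_equiv n (G, g) (H, h)"
    and kept: "(\<exists>v \<in> gverts G. valence G v \<noteq> 2) \<or> (\<exists>v. gverts G = {v})"
  shows "marked_equiv n (erase_marked n (G, g)) (erase_marked n (H, h))"
proof -
  from equiv obtain \<alpha> \<beta> where iso: "graph_iso G H \<alpha> \<beta>"
    and hom: "homotopic_gmaps (rose n) H {} (iso_gmap \<alpha> \<beta> \<circ>\<^sub>g g) h"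
    unfolding marked_equiv_def prod.case by blast
  have h: "is_gmap (rose n) H h" by (rule homotopic_gmaps_is_gmap(2)[OF hom])
  have neG: "gverts G \<noteq> {}" and neH: "gverts H \<noteq> {}"
    using G(2) H(2) unfolding serre_connected_iff[OF G(1)] serre_connected_iff[OF H(1)] by auto
  obtain g0 where g0: "erase_marked n (G, g) = (erase G, g0)" "is_gmap (rose n) (erase G) g0"
    "homotopic_gmaps (rose n) G {} (subdivide \<circ>\<^sub>g g0) g"
    by (rule erase_markedE[OF G g]) (rule that)
  obtain h0 where h0: "erase_marked n (H, h) = (erase H, h0)" "is_gmap (rose n) (erase H) h0"
    "homotopic_gmaps (rose n) H {} (subdivide \<circ>\<^sub>g h0) h"
    by (rule erase_markedE[OF H h]) (rule that)
  note R = serre_rose[of n]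
  note i = is_gmap_iso[OF G(1) H(1) iso]
  have isoE: "graph_iso (erase G) (erase H) \<alpha> (map \<beta>)"
    by (rule graph_iso_erase[OF G(1) H(1) neG iso graph_iso_kept_verts[OF G(1) iso kept]])
  have f: "is_gmap (rose n) (erase H) (iso_gmap \<alpha> (map \<beta>) \<circ>\<^sub>g g0)"
    by (rule is_gmap_comp[OF serre_erase[OF G(1)] serre_erase[OF H(1)] g0(2)
          is_gmap_iso[OF serre_erase[OF G(1)] serre_erase[OF H(1)] isoE]])
  have "subdivide \<circ>\<^sub>g (iso_gmap \<alpha> (map \<beta>) \<circ>\<^sub>g g0) = iso_gmap \<alpha> \<beta> \<circ>\<^sub>g (subdivide \<circ>\<^sub>g g0)"
    by (rule gmap.equality) (auto simp: fun_eq_iff map_concat)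
  moreover have "homotopic_gmaps (rose n) H {} (iso_gmap \<alpha> \<beta> \<circ>\<^sub>g (subdivide \<circ>\<^sub>g g0)) (subdivide \<circ>\<^sub>g h0)"
    by (rule homotopic_gmaps_trans[OF R H(1) homotopic_gmaps_comp_left[OF R G(1) H(1) i g0(3)]
          homotopic_gmaps_trans[OF R H(1) hom homotopic_gmaps_sym[OF R H(1) h0(3)]]])
  ultimately have "homotopic_gmaps (rose n) (erase H) {} (iso_gmap \<alpha> (map \<beta>) \<circ>\<^sub>g g0) h0"
    using erase_homotopic_gmaps[OF R H(1) neH f h0(2)] by simp
  with isoE show ?thesis
    unfolding g0(1) h0(1) marked_equiv_def prod.case by blast
qed

lemma marked_equiv_erase_trivial:
  assumes G: "serre_graph G" "connected (dig G)" and g: "is_gmap (rose n) G g"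
    and val: "\<And>v. v \<in> gverts G \<Longrightarrow> valence G v \<noteq> 2"
  shows "marked_equiv n (G, g) (erase_marked n (G, g))"
proof -
  have ne: "gverts G \<noteq> {}" using G(2) unfolding serre_connected_iff[OF G(1)] by simp
  have "{v \<in> gverts G. valence G v \<noteq> 2} = gverts G" using val by blast
  then have kept: "kept_verts G = gverts G"
    using ne by (simp add: kept_verts_def)
  obtain g0 where g0: "erase_marked n (G, g) = (erase G, g0)" "is_gmap (rose n) (erase G) g0"
    "homotopic_gmaps (rose n) G {} (subdivide \<circ>\<^sub>g g0) g"
    by (rule erase_markedE[OF G g]) (rule that)
  have single: "[d] \<in> chains G" if "d \<in> garcs G" for d
    using that G(1) kept by (auto simp: chains_def)
  have "\<exists>d \<in> garcs G. p = [d]" if p: "p \<in> chains G" for p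
  proof -
    obtain d q where dq: "p = d # q" using chainsD(1)[OF p] by (cases p) auto
    have "set p \<subseteq> garcs G" by (rule gwalk_arcs[OF chain_walk(1)[OF G(1) p]])
    moreover from this have "q = []"
      using chainsD(3)[OF p, of "hd q"] dq kept G(1) serre_tail_in[OF G(1), of "hd q"]
      by (cases q) simp_all
    ultimately show ?thesis using dq by simp
  qed
  then have chains: "chains G = (\<lambda>d. [d]) ` garcs G" using single by blast
  have iso: "graph_iso G (erase G) (\<lambda>v. v) (\<lambda>d. [d])"
    unfolding graph_iso_def using kept chains single
    by (auto simp: bij_betw_def inj_on_def)
  note E = serre_erase[OF G(1)]
  have f: "is_gmap (rose n) (erase G) (iso_gmap (\<lambda>v. v) (\<lambda>d. [d]) \<circ>\<^sub>g g)"
    by (rule is_gmap_comp[OF G(1) E g is_gmap_iso[OF G(1) E iso]])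
  have "subdivide \<circ>\<^sub>g (iso_gmap (\<lambda>v. v) (\<lambda>d. [d]) \<circ>\<^sub>g g) = g"
    by (rule gmap.equality) (auto simp: fun_eq_iff)
  then have "homotopic_gmaps (rose n) (erase G) {} (iso_gmap (\<lambda>v. v) (\<lambda>d. [d]) \<circ>\<^sub>g g) g0"
    using homotopic_gmaps_sym[OF serre_rose G(1) g0(3)]
    by (intro erase_homotopic_gmaps[OF serre_rose G(1) ne f g0(2)]) simp
  with iso show ?thesis
    unfolding g0(1) marked_equiv_def prod.case by blast
qed

section \<open>Attaching a bouquet of circles\<close>

lemma attach_bouquet_simps [simp]:
  "gverts (attach_bouquet m n G b) = gverts G"
  "garcs (attach_bouquet m n G b) = Inl ` garcs G \<union> Inr ` ({m<..n} \<times> UNIV)"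
  "gtail (attach_bouquet m n G b) (Inl d) = gtail G d"
  "ghead (attach_bouquet m n G b) (Inl d) = ghead G d"
  "gtail (attach_bouquet m n G b) (Inr x) = b"
  "ghead (attach_bouquet m n G b) (Inr x) = b"
  "bar (attach_bouquet m n G b) (Inl d) = Inl (bar G d)"
  "i \<in> {m<..n} \<Longrightarrow> bar (attach_bouquet m n G b) (Inr (i, s)) = Inr (i, \<not> s)"
  by (auto simp: attach_bouquet_def)

lemma serre_attach_bouquet:
  assumes "serre_graph G" "b \<in> gverts G"
  shows "serre_graph (attach_bouquet m n G b)"
proof (rule serre_graphI)
  fix e :: "'b + nat \<times> bool"
  assume e: "e \<notin> garcs (attach_bouquet m n G b)"
  show "bar (attach_bouquet m n G b) e = e"
  proof (cases e)
    case (Inl d)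
    then have "d \<notin> garcs G" using e by auto
    then show ?thesis
      using Inl bidirected_digraph.arev_eq[OF assms(1)] by simp
  next
    case (Inr x)
    then show ?thesis using e by (cases x) (auto simp: attach_bouquet_def)
  qed
qed (use assms serre_bar_neq[OF assms(1)] in auto)

abbreviation attach_inclusion :: "('v, 'd, 'v, 'd + nat \<times> bool) gmap" where
  "attach_inclusion \<equiv> iso_gmap (\<lambda>v. v) Inl"

lemma is_gmap_attach_inclusion:
  assumes "serre_graph G" "b \<in> gverts G"
  shows "is_gmap G (attach_bouquet m n G b) attach_inclusion"
  using assms serre_attach_bouquet[OF assms] by (auto simp: is_gmap_def)

lemma finite_connected_attach_bouquet:
  assumes G: "finite_connected_graph G" and b: "b \<in> gverts G"
  shows "finite_connected_graph (attach_bouquet m n G b)"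
proof -
  let ?A = "attach_bouquet m n G b"
  have G': "serre_graph G" "fin_digraph (dig G)" "connected (dig G)"
    using G by (auto simp: finite_connected_graph_def)
  note A = serre_attach_bouquet[OF G'(1) b, of m n]
  have "fin_digraph (dig ?A)"
  proof (rule wf_digraph.fin_digraphI[OF serre_wf[OF A]])
    show "finite (gverts ?A)" "finite (garcs ?A)"
      using fin_digraph.finite_verts[OF G'(2)] fin_digraph.finite_arcs[OF G'(2)] by simp_all
  qed
  moreover have "connected (dig ?A)"
    unfolding serre_connected_iff[OF A]
  proof (intro conjI ballI)
    show "gverts ?A \<noteq> {}" using b by auto
    fix u v assume "u \<in> gverts ?A" "v \<in> gverts ?A"
    then have "\<exists>p. gwalk G u p v"
      using G'(3) unfolding serre_connected_iff[OF G'(1)] by simp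
    then obtain p where "gwalk G u p v" ..
    from is_gmap_walk[OF G'(1) A is_gmap_attach_inclusion[OF G'(1) b] this]
    show "\<exists>p. gwalk ?A u p v" by auto
  qed
  ultimately show ?thesis
    using A by (simp add: finite_connected_graph_def)
qed

lemma valence_attach_bouquet:
  assumes "fin_digraph (dig G)"
  shows "valence (attach_bouquet m n G b) v = valence G v + (if v = b then 2 * (n - m) else 0)"
proof -
  let ?B = "if v = b then {m<..n} \<times> (UNIV :: bool set) else {}"
  have "out_arcs (dig (attach_bouquet m n G b)) v = Inl ` out_arcs (dig G) v \<union> Inr ` ?B"
    by auto
  moreover have "card (Inl ` out_arcs (dig G) v \<union> Inr ` ?B) = card (out_arcs (dig G) v) + card ?B"
    using fin_digraph.finite_out_arcs[OF assms]
    by (subst card_Un_disjoint) (auto simp: card_image)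
  ultimately show ?thesis
    by (auto simp: out_degree_def card_cartesian_product)
qed

lemma augment_marking_simps [simp]:
  "vmap (augment_marking m g) v = vmap g v"
  "i \<le> m \<Longrightarrow> dmap (augment_marking m g) (i, s) = map Inl (dmap g (i, s))"
  "\<not> i \<le> m \<Longrightarrow> dmap (augment_marking m g) (i, s) = [Inr (i, s)]"
  by (simp_all add: augment_marking_def)

lemma map_path_augment_marking:
  "set w \<subseteq> garcs (rose m) \<Longrightarrow> map_path (augment_marking m g) w = map Inl (map_path g w)"
  by (induction w) auto

lemma rose_subset:
  assumes "m \<le> n" "d \<in> garcs (rose m)"
  shows "d \<in> garcs (rose n)" "bar (rose n) d = bar (rose m) d"
  using assms by (auto simp: rose_def)

lemma is_gmap_rose_inclusion: "m \<le> n \<Longrightarrow> is_gmap (rose m) (rose n) id_gmap"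
  using rose_subset[of m n] by (auto simp: is_gmap_def)

lemma is_gmap_augment_marking:
  assumes G: "serre_graph G" and b: "b \<in> gverts G" and mn: "m \<le> n"
    and g: "is_gmap (rose m) G g" "vmap g () = b"
  shows "is_gmap (rose n) (attach_bouquet m n G b) (augment_marking m g)"
  unfolding is_gmap_def
proof (intro conjI ballI)
  let ?A = "attach_bouquet m n G b" and ?a = "augment_marking m g"
  note A = serre_attach_bouquet[OF G b, of m n] and incl = is_gmap_attach_inclusion[OF G b, of m n]
  show "vmap ?a v \<in> gverts ?A" for v using b g(2) by simp
  fix d assume "d \<in> garcs (rose n)"
  then obtain i s where d: "d = (i, s)" and i: "i \<in> {1..n}" by auto
  have "gwalk ?A b (dmap ?a d) b \<and> dmap ?a (bar (rose n) d) = inv_path ?A (dmap ?a d)"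
  proof (cases "i \<le> m")
    case True
    then have im: "(i, s) \<in> garcs (rose m)" "i \<in> {1..m}" using i by auto
    have w: "gwalk G b (dmap g (i, s)) b" using is_gmapD(2)[OF g(1) im(1)] g(2) by simp
    have "gwalk ?A b (map Inl (dmap g (i, s))) b"
      using is_gmap_walk[OF G A incl w] by simp
    moreover have "map Inl (dmap g (i, \<not> s)) = inv_path ?A (map Inl (dmap g (i, s)))"
      using is_gmap_inv_path[OF incl gwalk_arcs[OF w]] is_gmapD(3)[OF g(1) im(1)] rose_bar[OF im(2)]
      by simp
    ultimately show ?thesis
      using True d rose_bar[OF i] by simp
  next
    case False
    then show ?thesis using d i rose_bar[OF i] A b by simp
  qed
  then show "gwalk ?A (vmap ?a (gtail (rose n) d)) (dmap ?a d) (vmap ?a (ghead (rose n) d))"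
    "dmap ?a (bar (rose n) d) = inv_path ?A (dmap ?a d)"
    using g(2) by simp_all
qed

lemma based_homotopy_arc:
  assumes "homotopic_gmaps (rose m) G {()} f f'" "d \<in> garcs (rose m)"
  shows "path_homotopic G (vmap f ()) (vmap f' ()) (dmap f d) (dmap f' d)"
proof -
  from assms(1) obtain c where "homotopy_along (rose m) G c f f'" "c () = []"
    unfolding homotopic_gmaps_iff by blast
  then show ?thesis using homotopy_alongD(4)[of "rose m" G c f f' d] assms(2) by simp
qed

text \<open>
  A homotopy that is stationary at the base vertex extends by the constant homotopy on the
  bouquet.
\<close>

lemma homotopic_augment_marking:
  assumes G: "serre_graph G" and b: "b \<in> gverts G" and mn: "m \<le> n"
    and g: "vmap g () = b" "vmap g' () = b" and hom: "homotopic_gmaps (rose m) G {()} g g'"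
  shows "homotopic_gmaps (rose n) (attach_bouquet m n G b) {()} (augment_marking m g) (augment_marking m g')"
proof (rule homotopic_gmapsI[where c = "\<lambda>_. []"])
  let ?A = "attach_bouquet m n G b"
  note A = serre_attach_bouquet[OF G b, of m n] and incl = is_gmap_attach_inclusion[OF G b, of m n]
  note gm = homotopic_gmaps_is_gmap[OF hom]
  show "is_gmap (rose n) ?A (augment_marking m g)" "is_gmap (rose n) ?A (augment_marking m g')"
    using is_gmap_augment_marking[OF G b mn] gm g by blast+
  fix d assume "d \<in> garcs (rose n)"
  then obtain i s where d: "d = (i, s)" and i: "i \<in> {1..n}" by auto
  show "path_homotopic ?A (vmap (augment_marking m g) (gtail (rose n) d))
      (vmap (augment_marking m g') (ghead (rose n) d))
      (dmap (augment_marking m g) d @ []) ([] @ dmap (augment_marking m g') d)"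
  proof (cases "i \<le> m")
    case True
    then have im: "(i, s) \<in> garcs (rose m)" using i by auto
    have "path_homotopic G b b (dmap g (i, s)) (dmap g' (i, s))"
      using based_homotopy_arc[OF hom im] g by simp
    from is_gmap_homotopic[OF G A incl this] show ?thesis
      using True d g by simp
  next
    case False
    then show ?thesis using d i A b g by simp
  qed
qed (use b g in auto)

lemma pointed_marked_equiv_augment:
  assumes G: "serre_graph G" and H: "serre_graph H" and b: "b \<in> gverts G" and mn: "m \<le> n"
    and g: "vmap g () = b" "is_gmap (rose m) G g" and h: "vmap h () = c"
    and eq: "pointed_marked_equiv m (G, b, g) (H, c, h)"
  shows "pointed_marked_equiv n (attach_bouquet m n G b, b, augment_marking m g)
    (attach_bouquet m n H c, c, augment_marking m h)"
proof -
  from eq obtain \<alpha> \<beta> where iso: "graph_iso G H \<alpha> \<beta>" and \<alpha>: "\<alpha> b = c"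
    and hom: "homotopic_gmaps (rose m) H {()} (iso_gmap \<alpha> \<beta> \<circ>\<^sub>g g) h"
    unfolding pointed_marked_equiv_def prod.case by blast
  note i = graph_isoD[OF iso]
  have c: "c \<in> gverts H" using i(3)[OF b] \<alpha> by simp
  let ?\<beta> = "map_sum \<beta> (\<lambda>x. x)"
  have "graph_iso (attach_bouquet m n G b) (attach_bouquet m n H c) \<alpha> ?\<beta>"
    unfolding graph_iso_def
  proof (intro conjI)
    show "bij_betw ?\<beta> (garcs (attach_bouquet m n G b)) (garcs (attach_bouquet m n H c))"
      unfolding bij_betw_def
    proof
      have inj: "inj_on \<beta> (garcs G)" using i(2) by (simp add: bij_betw_def)
      show "inj_on ?\<beta> (garcs (attach_bouquet m n G b))"
      proof (rule inj_onI)
        fix x y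
        assume "x \<in> garcs (attach_bouquet m n G b)" "y \<in> garcs (attach_bouquet m n G b)"
          "?\<beta> x = ?\<beta> y"
        then show "x = y"
          using inj_onD[OF inj] by (cases x; cases y) (simp_all add: image_iff)
      qed
      have "\<beta> ` garcs G = garcs H" using i(2) by (simp add: bij_betw_def)
      moreover have "?\<beta> ` garcs (attach_bouquet m n G b) =
          Inl ` (\<beta> ` garcs G) \<union> Inr ` ({m<..n} \<times> UNIV)"
        by (simp add: image_Un image_image)
      ultimately show "?\<beta> ` garcs (attach_bouquet m n G b) = garcs (attach_bouquet m n H c)"
        by simp
    qed
  qed (use i \<alpha> in auto)
  moreover have "iso_gmap \<alpha> ?\<beta> \<circ>\<^sub>g augment_marking m g = augment_marking m (iso_gmap \<alpha> \<beta> \<circ>\<^sub>g g)"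
  proof (rule gmap.equality)
    have "dmap (iso_gmap \<alpha> ?\<beta> \<circ>\<^sub>g augment_marking m g) (i, s) =
      dmap (augment_marking m (iso_gmap \<alpha> \<beta> \<circ>\<^sub>g g)) (i, s)" for i s
      by (cases "i \<le> m") auto
    then show "dmap (iso_gmap \<alpha> ?\<beta> \<circ>\<^sub>g augment_marking m g) = dmap (augment_marking m (iso_gmap \<alpha> \<beta> \<circ>\<^sub>g g))"
      by (auto simp: fun_eq_iff)
  qed (auto simp: fun_eq_iff)
  moreover have "homotopic_gmaps (rose n) (attach_bouquet m n H c) {()}
      (augment_marking m (iso_gmap \<alpha> \<beta> \<circ>\<^sub>g g)) (augment_marking m h)"
    by (rule homotopic_augment_marking[OF H c mn _ h hom]) (use g \<alpha> in simp)
  ultimately show ?thesis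
    using \<alpha> unfolding pointed_marked_equiv_def prod.case by metis
qed

text \<open>
  The homotopy inverse is extended by the identity on the bouquet.  This works because all
  homotopies involved are stationary at the base vertex.
\<close>

lemma homotopy_equivalence_augment:
  fixes G :: "('a, 'b) sgraph"
  assumes G: "serre_graph G" and b: "b \<in> gverts G" and mn: "m \<le> n"
    and g: "vmap g () = b" and he: "homotopy_equivalence (rose m) G {()} g"
  shows "homotopy_equivalence (rose n) (attach_bouquet m n G b) {()} (augment_marking m g)"
proof -
  let ?A = "attach_bouquet m n G b" and ?a = "augment_marking m g"
  note A = serre_attach_bouquet[OF G b, of m n] and incl = is_gmap_attach_inclusion[OF G b, of m n]
  note rincl = is_gmap_rose_inclusion[OF mn]
  from he obtain k where gm: "is_gmap (rose m) G g" and k: "is_gmap G (rose m) k"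
    and kg: "homotopic_gmaps (rose m) (rose m) {()} (k \<circ>\<^sub>g g) id_gmap"
    and gk: "homotopic_gmaps G G {b} (g \<circ>\<^sub>g k) id_gmap"
    using g by (auto simp: homotopy_equivalence_def)
  note a = is_gmap_augment_marking[OF G b mn gm g]
  define k' :: "('a, 'b + nat \<times> bool, unit, nat \<times> bool) gmap"
    where "k' = \<lparr>vmap = vmap k, dmap = case_sum (dmap k) (\<lambda>x. [x])\<rparr>"
  have k's [simp]: "vmap k' v = ()" "dmap k' (Inl d) = dmap k d" "dmap k' (Inr x) = [x]" for v d x
    by (simp_all add: k'_def)
  have k'p: "map_path k' (map Inl p) = map_path k p" for p
    by (induction p) auto
  have kw: "gwalk (rose m) () (dmap k d) ()" if "d \<in> garcs G" for d
    using is_gmapD(2)[OF k that] by simp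
  have rw: "gwalk (rose n) () p ()" if "gwalk (rose m) () p ()" for p
    using is_gmap_walk[OF serre_rose serre_rose rincl that] by simp
  have k': "is_gmap ?A (rose n) k'"
    unfolding is_gmap_def
  proof (intro conjI ballI)
    fix e assume "e \<in> garcs ?A"
    then consider d where "e = Inl d" "d \<in> garcs G" | i s where "e = Inr (i, s)" "i \<in> {m<..n}"
      by auto
    then have "gwalk (rose n) () (dmap k' e) () \<and> dmap k' (bar ?A e) = inv_path (rose n) (dmap k' e)"
    proof cases
      case 1
      have "inv_path (rose n) (dmap k d) = inv_path (rose m) (dmap k d)"
        using is_gmap_inv_path[OF rincl gwalk_arcs[OF kw[OF 1(2)]]] by simp
      then show ?thesis using 1 rw[OF kw] is_gmapD(3)[OF k] by simp
    next
      case 2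
      then show ?thesis using rose_bar[of i n s] by simp
    qed
    then show "gwalk (rose n) (vmap k' (gtail ?A e)) (dmap k' e) (vmap k' (ghead ?A e))"
      "dmap k' (bar ?A e) = inv_path (rose n) (dmap k' e)" by simp_all
  qed simp
  have "homotopic_gmaps (rose n) (rose n) {()} (k' \<circ>\<^sub>g ?a) id_gmap"
  proof (rule homotopic_gmapsI[where c = "\<lambda>_. []"])
    show "is_gmap (rose n) (rose n) (k' \<circ>\<^sub>g ?a)"
      by (rule is_gmap_comp[OF A serre_rose a k'])
    fix d assume dn: "d \<in> garcs (rose n)"
    then obtain i s where d: "d = (i, s)" and i: "i \<in> {1..n}" by auto
    have "path_homotopic (rose n) () () (dmap (k' \<circ>\<^sub>g ?a) d) [d]"
    proof (cases "i \<le> m")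
      case True
      then have im: "(i, s) \<in> garcs (rose m)" using i by auto
      have "path_homotopic (rose m) () () (map_path k (dmap g (i, s))) [(i, s)]"
        using based_homotopy_arc[OF kg im] by simp
      from is_gmap_homotopic[OF serre_rose serre_rose rincl this] show ?thesis
        using True d k'p by simp
    next
      case False
      then show ?thesis using d i by simp
    qed
    then show "path_homotopic (rose n) (vmap (k' \<circ>\<^sub>g ?a) (gtail (rose n) d)) (vmap id_gmap (ghead (rose n) d))
        (dmap (k' \<circ>\<^sub>g ?a) d @ []) ([] @ dmap id_gmap d)" by simp
  qed (use is_gmap_id[OF serre_rose] in auto)
  moreover have "homotopic_gmaps ?A ?A {b} (?a \<circ>\<^sub>g k') id_gmap"
  proof -
    from gk obtain c where hc: "homotopy_along G G c (g \<circ>\<^sub>g k) id_gmap" and cb: "c b = []"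
      unfolding homotopic_gmaps_iff by blast
    note c = homotopy_alongD(3)[OF hc] and cd = homotopy_alongD(4)[OF hc]
    show ?thesis
    proof (rule homotopic_gmapsI[where c = "\<lambda>v. map Inl (c v)"])
      show "is_gmap ?A ?A (?a \<circ>\<^sub>g k')" by (rule is_gmap_comp[OF serre_rose A k' a])
      fix v assume "v \<in> gverts ?A"
      then show "gwalk ?A (vmap (?a \<circ>\<^sub>g k') v) (map Inl (c v)) (vmap id_gmap v)"
        using is_gmap_walk[OF G A incl c[of v]] by simp
    next
      fix e assume "e \<in> garcs ?A"
      then consider d where "e = Inl d" "d \<in> garcs G" | i s where "e = Inr (i, s)" "i \<in> {m<..n}"
        by auto
      then show "path_homotopic ?A (vmap (?a \<circ>\<^sub>g k') (gtail ?A e)) (vmap id_gmap (ghead ?A e))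
          (dmap (?a \<circ>\<^sub>g k') e @ map Inl (c (ghead ?A e))) (map Inl (c (gtail ?A e)) @ dmap id_gmap e)"
      proof cases
        case 1
        have "map_path ?a (dmap k d) = map Inl (map_path g (dmap k d))"
          by (rule map_path_augment_marking[OF gwalk_arcs[OF kw[OF 1(2)]]])
        then show ?thesis
          using is_gmap_homotopic[OF G A incl cd[OF 1(2)]] 1 by simp
      next
        case 2
        then show ?thesis using cb A b g by simp
      qed
    qed (use cb is_gmap_id[OF A] in auto)
  qed
  ultimately show ?thesis
    unfolding homotopy_equivalence_def using a k' g by auto
qed

section \<open>Representatives\<close>

text \<open>
  The members of the classes have natural numbers as arcs, but \<open>attach_bouquet\<close> leads out of this
  type.
\<close>

definition relabel_arcs :: "('v, 'd :: countable) sgraph \<Rightarrow> ('v, nat) sgraph" where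
  "relabel_arcs G =
     \<lparr>dig = \<lparr>verts = gverts G, arcs = to_nat ` garcs G, tail = gtail G \<circ> from_nat,
             head = ghead G \<circ> from_nat\<rparr>,
      bar = (\<lambda>e. if e \<in> to_nat ` garcs G then to_nat (bar G (from_nat e)) else e)\<rparr>"

lemma relabel_arcs_simps [simp]:
  "gverts (relabel_arcs G) = gverts G" "garcs (relabel_arcs G) = to_nat ` garcs G"
  "gtail (relabel_arcs G) (to_nat d) = gtail G d" "ghead (relabel_arcs G) (to_nat d) = ghead G d"
  "d \<in> garcs G \<Longrightarrow> bar (relabel_arcs G) (to_nat d) = to_nat (bar G d)"
  by (simp_all add: relabel_arcs_def)

lemma serre_relabel_arcs:
  assumes "serre_graph G"
  shows "serre_graph (relabel_arcs G)"
proof (rule serre_graphI)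
  fix e assume "e \<notin> garcs (relabel_arcs G)"
  then show "bar (relabel_arcs G) e = e" by (simp add: relabel_arcs_def)
qed (use assms serre_bar_neq[OF assms] in auto)

lemma relabel_arcs_iso:
  "serre_graph G \<Longrightarrow> graph_iso G (relabel_arcs G) (\<lambda>v. v) to_nat"
  by (auto simp: graph_iso_def bij_betw_def)

lemma L_graph_iso:
  assumes L: "L_graph n (G, b, g)" and H: "serre_graph H" and iso: "graph_iso G H \<alpha> \<beta>"
  shows "L_graph n (H, \<alpha> b, iso_gmap \<alpha> \<beta> \<circ>\<^sub>g g)"
    and "pointed_marked_equiv n (G, b, g) (H, \<alpha> b, iso_gmap \<alpha> \<beta> \<circ>\<^sub>g g)"
proof -
  note G = L_graph_serre[OF L] and b = L_graph_base[OF L] and gb = L_graph_base_eq[OF L]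
  note i = graph_isoD[OF iso]
  have L': "finite_connected_graph G" "homotopy_equivalence (rose n) G {()} g"
    "2 \<le> valence G b" "\<forall>v \<in> gverts G - {b}. 3 \<le> valence G v"
    using L by (auto simp: L_graph_def pointed_marked_graph_def)
  note val = graph_iso_valence[OF iso _ G]
  have "3 \<le> valence H w" if w: "w \<in> gverts H - {\<alpha> b}" for w
  proof -
    from w obtain v where "v \<in> gverts G" "w = \<alpha> v" using i(1) by (auto simp: bij_betw_def)
    then show ?thesis using L'(4) val w by auto
  qed
  then show "L_graph n (H, \<alpha> b, iso_gmap \<alpha> \<beta> \<circ>\<^sub>g g)"
    using finite_connected_graph_iso[OF L'(1) H iso] i(3)[OF b] gb L'(3) val[OF b]
      homotopy_equivalence_iso[OF serre_rose G H iso L'(2)]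
    by (auto simp: L_graph_def pointed_marked_graph_def)
  have "is_gmap (rose n) H (iso_gmap \<alpha> \<beta> \<circ>\<^sub>g g)"
    by (rule is_gmap_comp[OF G H L_graph_gmap[OF L] is_gmap_iso[OF G H iso]])
  from homotopic_gmaps_refl[OF this] iso
  show "pointed_marked_equiv n (G, b, g) (H, \<alpha> b, iso_gmap \<alpha> \<beta> \<circ>\<^sub>g g)"
    unfolding pointed_marked_equiv_def prod.case by blast
qed

lemma L_graph_is_K_graph:
  assumes L: "L_graph n (G, b, g)" and n: "n \<noteq> 1" and "3 \<le> valence G b"
  shows "K_graph n (G, g)"
  using assms by (auto simp: L_graph_def pointed_marked_graph_def K_graph_def marked_graph_def
      homotopy_equivalence_free)

lemma L_graph_attach_bouquet:
  assumes L: "L_graph m (G, b, g)" and mn: "m < n"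
  shows "L_graph n (attach_bouquet m n G b, b, augment_marking m g)"
    and "v \<in> gverts G \<Longrightarrow> 3 \<le> valence (attach_bouquet m n G b) v"
proof -
  have L': "finite_connected_graph G" "homotopy_equivalence (rose m) G {()} g"
    "2 \<le> valence G b" "\<forall>v \<in> gverts G - {b}. 3 \<le> valence G v"
    using L by (auto simp: L_graph_def pointed_marked_graph_def)
  note b = L_graph_base[OF L] and gb = L_graph_base_eq[OF L] and G = L_graph_serre[OF L]
  have "fin_digraph (dig G)" using L'(1) by (simp add: finite_connected_graph_def)
  note val = valence_attach_bouquet[OF this, of m n b]
  show v: "3 \<le> valence (attach_bouquet m n G b) v" if "v \<in> gverts G" for v
    using val[of v] L'(3,4) mn that by (cases "v = b") auto
  show "L_graph n (attach_bouquet m n G b, b, augment_marking m g)"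
    using finite_connected_attach_bouquet[OF L'(1) b]
      homotopy_equivalence_augment[OF G b _ gb L'(2)] mn b gb v
    by (simp add: L_graph_def pointed_marked_graph_def order_trans[OF _ v[OF b]])
qed

lemma the_elem_image:
  assumes "x \<in> X" "\<And>x. x \<in> X \<Longrightarrow> f x = y"
  shows "the_elem (f ` X) = y"
proof -
  have "f ` X = {y}" using assms by auto
  then show ?thesis by simp
qed

text \<open>
  The class of a graph has a member also if the arcs of the graph are not natural numbers.
\<close>

lemma L_class_member:
  fixes G :: "(nat, 'd :: countable) sgraph"
  assumes "L_graph n (G, b, g)"
  shows "(relabel_arcs G, b, iso_gmap (\<lambda>v. v) to_nat \<circ>\<^sub>g g) \<in> L_class n (G, b, g)"
  using L_graph_iso[OF assms serre_relabel_arcs relabel_arcs_iso] L_graph_serre[OF assms]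
  by (auto simp: L_class_def)

section \<open>Restricting an augmented marked graph\<close>

text \<open>
  If \<open>k\<close> is a homotopy inverse of \<open>g\<close>, then \<open>q\<close> is homotopic to the image under \<open>g\<close> of the image
  of \<open>q\<close> under \<open>k\<close>, as the homotopy does not move \<open>b\<close>.
\<close>

lemma homotopy_equivalence_pi1_surj:
  fixes G :: "('a, 'b) sgraph"
  assumes G: "serre_graph G" and he: "homotopy_equivalence (rose m) G {()} g"
    and b: "vmap g () = b" and q: "gwalk G b q b"
  obtains w where "gwalk (rose m) () w ()" "path_homotopic G b b (map_path g w) q"
proof -
  from he obtain k where gm: "is_gmap (rose m) G g" and k: "is_gmap G (rose m) k"
    and gk: "homotopic_gmaps G G {b} (g \<circ>\<^sub>g k) id_gmap"
    using b by (auto simp: homotopy_equivalence_def)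
  from gk obtain c where hc: "homotopy_along G G c (g \<circ>\<^sub>g k) id_gmap" and "c b = []"
    unfolding homotopic_gmaps_iff by blast
  with homotopic_gmaps_path[OF G G hc q] have "path_homotopic G b b (map_path g (map_path k q)) q"
    using b by simp
  moreover have "gwalk (rose m) () (map_path k q) ()"
    using is_gmap_walk[OF G serre_rose k q] by simp
  ultimately show thesis using that by blast
qed

text \<open>
  Only the base vertex of \<open>G\<close> can have valence 2.  So if all vertices have valence 2, then the
  base vertex is the only one and there is no choice of a placeholder.
\<close>

lemma K_class_erase_marked_eq:
  assumes L: "L_graph m (G, b, g)" and H: "finite_connected_graph H"
    and eq: "marked_equiv m (G, g) (H, h)"
  shows "K_class m (erase_marked m (H, h)) = K_class m (erase_marked m (G, g))"
proof -
  note G = L_graph_serre[OF L] and gm = L_graph_gmap[OF L]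
  have L': "connected (dig G)" "\<forall>v \<in> gverts G - {b}. 3 \<le> valence G v"
    using L by (auto simp: L_graph_def pointed_marked_graph_def finite_connected_graph_def)
  have H': "serre_graph H" "connected (dig H)"
    using H by (auto simp: finite_connected_graph_def)
  have hm: "is_gmap (rose m) H h"
    using eq homotopic_gmaps_is_gmap(2) unfolding marked_equiv_def prod.case by blast
  have kept: "(\<exists>v \<in> gverts G. valence G v \<noteq> 2) \<or> (\<exists>v. gverts G = {v})"
    using L'(2) L_graph_base[OF L] by fastforce
  obtain g0 where g0: "erase_marked m (G, g) = (erase G, g0)" "is_gmap (rose m) (erase G) g0"
    by (rule erase_markedE[OF G L'(1) gm]) (rule that)
  obtain h0 where h0: "erase_marked m (H, h) = (erase H, h0)"
    by (rule erase_markedE[OF H' hm]) (rule that)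
  show ?thesis
    using K_class_eq[OF serre_erase[OF G] serre_erase[OF H'(1)] g0(2)]
      marked_equiv_erase[OF G L'(1) H' gm eq kept] unfolding g0(1) h0 by simp
qed

text \<open>
  The copy of \<open>G\<close> in \<open>H\<close> carries a marking that is homotopic to the restriction of \<open>h\<close> along the
  track of the base vertex, so the covering that defines the restriction is one of those in
  which this copy lifts to the core.
\<close>

lemma restriction_of_augmented:
  assumes L: "L_graph m (G, b, g)" and mn: "m < n" and H: "serre_graph H"
    and eq: "marked_equiv n (attach_bouquet m n G b, augment_marking m g) (H, h)"
    and D: "restriction_cover m (H, h) = (D, h')"
  shows "K_class m (erase_marked m (compact_core D, core_retraction D \<circ>\<^sub>g h')) =
    K_class m (erase_marked m (G, g))"
proof -
  let ?A = "attach_bouquet m n G b" and ?a = "augment_marking m g"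
  have L': "finite_connected_graph G" "homotopy_equivalence (rose m) G {()} g"
    "2 \<le> valence G b" "\<forall>v \<in> gverts G - {b}. 3 \<le> valence G v"
    using L by (auto simp: L_graph_def pointed_marked_graph_def)
  note b = L_graph_base[OF L] and gb = L_graph_base_eq[OF L] and G = L_graph_serre[OF L]
    and gm = L_graph_gmap[OF L]
  have mn': "m \<le> n" using mn by simp
  note A = serre_attach_bouquet[OF G b, of m n] and incl = is_gmap_attach_inclusion[OF G b, of m n]
  from eq obtain \<alpha> \<beta> where iso: "graph_iso ?A H \<alpha> \<beta>"
    and hom: "homotopic_gmaps (rose n) H {} (iso_gmap \<alpha> \<beta> \<circ>\<^sub>g ?a) h"
    unfolding marked_equiv_def prod.case by blast
  from hom obtain c0 where hc: "homotopy_along (rose n) H c0 (iso_gmap \<alpha> \<beta> \<circ>\<^sub>g ?a) h"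
    unfolding homotopic_gmaps_iff by blast
  note hm = homotopy_alongD(2)[OF hc] and c0 = homotopy_alongD(3)[OF hc] and hd = homotopy_alongD(4)[OF hc]
  note i = graph_isoD[OF iso]
  let ?c = "c0 ()" and ?u = "vmap h ()" and ?b = "\<alpha> b"
  \<comment> \<open>\<open>\<alpha>\<close> and \<open>\<gamma>\<close> embed \<open>G\<close> into \<open>H\<close>; as the bouquet has no further vertices, the copy contains
    all vertices of \<open>H\<close>\<close>
  define \<gamma> where "\<gamma> d = \<beta> (Inl d)" for d
  define E where "E = \<gamma> ` garcs G"
  let ?K = "subgraph_on H (gverts H) E" and ?k = "iso_gmap \<alpha> \<gamma> \<circ>\<^sub>g g"
  have \<alpha>: "bij_betw \<alpha> (gverts G) (gverts H)" using i(1) by simp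
  have \<gamma>: "\<gamma> d \<in> garcs H" "gtail H (\<gamma> d) = \<alpha> (gtail G d)" "ghead H (\<gamma> d) = \<alpha> (ghead G d)"
    "bar H (\<gamma> d) = \<gamma> (bar G d)" if "d \<in> garcs G" for d
    using i(4)[of "Inl d"] i(5)[of "Inl d"] i(6)[of "Inl d"] i(7)[of "Inl d"] that
    by (simp_all add: \<gamma>_def)
  have inj: "inj_on \<gamma> (garcs G)"
    using i(2) by (auto simp: \<gamma>_def bij_betw_def inj_on_def)
  have cl: "closed_subgraph H (gverts H) E"
    using \<gamma> i(3) G H by (auto simp: closed_subgraph_def E_def)
  note K = serre_subgraph_on[OF H cl]
  have isoK: "graph_iso G ?K \<alpha> \<gamma>"
    unfolding graph_iso_def using \<alpha> inj \<gamma> by (auto simp: bij_betw_def E_def)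
  have fcK: "finite_connected_graph ?K"
    by (rule finite_connected_graph_iso[OF L'(1) K isoK])
  then have conK: "connected (dig ?K)" by (simp add: finite_connected_graph_def)
  have bH: "?b \<in> gverts H" using \<alpha> b by (auto simp: bij_betw_def)
  have cw: "gwalk H ?b ?c ?u" using c0[of "()"] gb by simp
  have valK: "\<forall>v \<in> gverts H. 2 \<le> valence ?K v"
  proof
    fix v assume v: "v \<in> gverts H"
    obtain x where x: "x \<in> gverts G" "v = \<alpha> x" using \<alpha> v by (auto simp: bij_betw_def)
    have "2 \<le> valence G x" using L'(3) bspec[OF L'(4), of x] x(1) by (cases "x = b") simp_all
    then show "2 \<le> valence ?K v" using graph_iso_valence[OF isoK x(1) G] x(2) by simp
  qed
  interpret sc: subgraph_covering H "gverts H" E ?b ?u ?c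
    by (rule subgraph_covering.intro[OF H cl conK bH cw])
  have km: "is_gmap (rose m) ?K ?k"
    by (rule is_gmap_comp[OF G K gm is_gmap_iso[OF G K isoK]])
  have heK: "homotopy_equivalence (rose m) ?K {()} ?k"
    by (rule homotopy_equivalence_iso[OF serre_rose G K isoK L'(2)]) simp
  have inclK: "is_gmap ?K H id_gmap"
    using H closed_subgraphD[OF cl] by (auto simp: is_gmap_def)
  have rincl: "is_gmap (rose m) (rose n) id_gmap" by (rule is_gmap_rose_inclusion[OF mn'])
  have conj: "path_homotopic H ?u ?u (map_path h w) (inv_path H ?c @ map_path ?k w @ ?c)"
    if w: "gwalk (rose m) () w ()" for w
  proof -
    have "map_path ?a w = map Inl (map_path g w)"
      by (rule map_path_augment_marking[OF gwalk_arcs[OF w]])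
    then have kw: "map_path (iso_gmap \<alpha> \<beta> \<circ>\<^sub>g ?a) w = map_path ?k w"
      by (simp add: \<gamma>_def)
    have "gwalk (rose n) () w ()"
      using is_gmap_walk[OF serre_rose serre_rose rincl w] by simp
    from homotopic_gmaps_path[OF serre_rose H hc this]
    have "path_homotopic H ?b ?u (map_path ?k w @ ?c) (?c @ map_path h w)"
      using gb kw by simp
    from path_homotopic_swap_left[OF H path_homotopic_sym[OF this] cw]
    show ?thesis .
  qed
  have kK: "gwalk ?K ?b (map_path ?k w) ?b" if "gwalk (rose m) () w ()" for w
    using is_gmap_walk[OF serre_rose K km that] gb by simp
  have S: "image_subgroup m H h = sc.S"
  proof (intro equalityI subsetI)
    fix p assume "p \<in> image_subgroup m H h"
    then obtain w where w: "gwalk (rose m) () w ()" "path_homotopic H ?u ?u (map_path h w) p"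
      by (auto simp: image_subgroup_def)
    have "path_homotopic H ?u ?u (inv_path H ?c @ map_path ?k w @ ?c) p"
      by (rule path_homotopic_trans[OF path_homotopic_sym[OF conj[OF w(1)]] w(2)])
    with kK[OF w(1)] show "p \<in> sc.S" unfolding sc.S_def by blast
  next
    fix p assume "p \<in> sc.S"
    then obtain q where q: "gwalk ?K ?b q ?b" "path_homotopic H ?u ?u (inv_path H ?c @ q @ ?c) p"
      unfolding sc.S_def by blast
    obtain w where w: "gwalk (rose m) () w ()" "path_homotopic ?K ?b ?b (map_path ?k w) q"
      by (rule homotopy_equivalence_pi1_surj[OF K heK _ q(1)]) (use gb in simp, rule that)
    have "path_homotopic H ?b ?b (map_path ?k w) q"
      using is_gmap_homotopic[OF K H inclK w(2)] by simp
    then have "path_homotopic H ?u ?u (inv_path H ?c @ map_path ?k w @ ?c) (inv_path H ?c @ q @ ?c)"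
      by (intro path_homotopic_append_left[OF H gwalk_inv_path[OF H cw]]
          path_homotopic_append_right[OF H cw])
    then have "path_homotopic H ?u ?u (map_path h w) p"
      using path_homotopic_trans[OF conj[OF w(1)]] path_homotopic_trans[OF _ q(2)] by blast
    with w(1) show "p \<in> image_subgroup m H h" by (auto simp: image_subgroup_def)
  qed
  have hrm: "is_gmap (rose m) H h"
    using is_gmap_comp[OF serre_rose H rincl hm] rose_subset[OF mn']
    by (auto simp: is_gmap_def)
  have khom: "\<forall>d \<in> garcs (rose m). path_homotopic H ?b ?u (dmap ?k d @ ?c) (?c @ dmap h d)"
  proof
    fix d assume d: "d \<in> garcs (rose m)"
    obtain i s where "d = (i, s)" "i \<le> m" using d by auto
    then have "dmap (iso_gmap \<alpha> \<beta> \<circ>\<^sub>g ?a) d = dmap ?k d" by (simp add: \<gamma>_def)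
    then show "path_homotopic H ?b ?u (dmap ?k d @ ?c) (?c @ dmap h d)"
      using hd[OF rose_subset(1)[OF mn' d]] gb by simp
  qed
  have kb: "vmap ?k () = ?b" using gb by simp
  note core = sc.restriction_cover_core[OF fcK valK km kb hrm refl khom S D[symmetric]]
  have coreG: "graph_iso G (compact_core D) (sc.emb \<circ> \<alpha>) ((\<lambda>d. sc.emb_arc d) \<circ> \<gamma>)"
    by (rule graph_iso_comp[OF isoK core(2)])
  have fcD: "finite_connected_graph (compact_core D)"
    by (rule finite_connected_graph_iso[OF L'(1) core(3) coreG])
  have "marked_equiv m (G, g) (?K, ?k)"
    unfolding marked_equiv_def prod.case using isoK homotopic_gmaps_refl[OF km] by blast
  then have equiv: "marked_equiv m (G, g) (compact_core D, core_retraction D \<circ>\<^sub>g h')"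
    by (rule marked_equiv_trans[OF K core(3) _ core(1)])
  show ?thesis
    by (rule K_class_erase_marked_eq[OF L fcD equiv])
qed

section \<open>The square of maps commutes\<close>

lemma augmentation_L_class:
  fixes G :: "(nat, nat) sgraph"
  assumes L: "L_graph m (G, b, g)" and mn: "m < n"
  shows "augmentation m n (L_class m (G, b, g)) =
    L_class n (attach_bouquet m n G b, b, augment_marking m g)"
  unfolding augmentation_def
proof (rule the_elem_image)
  note G = L_graph_serre[OF L] and gm = L_graph_gmap[OF L] and b = L_graph_base[OF L]
    and gb = L_graph_base_eq[OF L]
  show "(G, b, g) \<in> L_class m (G, b, g)"
    using L pointed_marked_equiv_refl[OF G gm] by (simp add: L_class_def)
  fix x assume x: "x \<in> L_class m (G, b, g)"
  obtain H c h where xH: "x = (H, c, h)" by (cases x) auto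
  then have LH: "L_graph m (H, c, h)" and eq: "pointed_marked_equiv m (G, b, g) (H, c, h)"
    using x by (auto simp: L_class_def)
  note H = L_graph_serre[OF LH] and c = L_graph_base[OF LH]
  have mn': "m \<le> n" using mn by simp
  have bA: "b \<in> gverts (attach_bouquet m n G b)" using b by simp
  have "L_class n (attach_bouquet m n G b, b, augment_marking m g) =
      L_class n (attach_bouquet m n H c, c, augment_marking m h)"
    by (rule L_class_eq[OF serre_attach_bouquet[OF G b] serre_attach_bouquet[OF H c]
          is_gmap_augment_marking[OF G b mn' gm gb] bA
          pointed_marked_equiv_augment[OF G H b mn' gb gm L_graph_base_eq[OF LH] eq]])
  then show "(case x of (G, b, g) \<Rightarrow> L_class n (attach_bouquet m n G b, b, augment_marking m g)) =
      L_class n (attach_bouquet m n G b, b, augment_marking m g)"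
    using xH by simp
qed

lemma forgetful_L_class:
  fixes G :: "(nat, nat) sgraph"
  assumes L: "L_graph m (G, b, g)"
  shows "forgetful m (L_class m (G, b, g)) = K_class m (erase_marked m (G, g))"
  unfolding forgetful_def
proof (rule the_elem_image)
  note G = L_graph_serre[OF L] and gm = L_graph_gmap[OF L] and b = L_graph_base[OF L]
  show "(G, b, g) \<in> L_class m (G, b, g)"
    using L pointed_marked_equiv_refl[OF G gm] by (simp add: L_class_def)
  fix x assume x: "x \<in> L_class m (G, b, g)"
  obtain H c h where xH: "x = (H, c, h)" by (cases x) auto
  then have LH: "L_graph m (H, c, h)" and eq: "pointed_marked_equiv m (G, b, g) (H, c, h)"
    using x by (auto simp: L_class_def)
  have "finite_connected_graph H"
    using LH by (simp add: L_graph_def pointed_marked_graph_def)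
  from K_class_erase_marked_eq[OF L this pointed_marked_equiv_free[OF eq]]
  show "(case x of (G, b, g) \<Rightarrow> K_class m (erase_marked m (G, g))) = K_class m (erase_marked m (G, g))"
    using xH by simp
qed

text \<open>
  An equivalent marked graph has no vertices of valence 2 either, so erasing them does not
  change its class.
\<close>

lemma forgetful_L_class_trivalent:
  fixes G :: "(nat, 'd :: countable) sgraph"
  assumes L: "L_graph n (G, b, g)" and val: "\<And>v. v \<in> gverts G \<Longrightarrow> 3 \<le> valence G v"
  shows "forgetful n (L_class n (G, b, g)) = K_class n (G, g)"
  unfolding forgetful_def
proof (rule the_elem_image[OF L_class_member[OF L]])
  note G = L_graph_serre[OF L] and gm = L_graph_gmap[OF L]
  fix x assume x: "x \<in> L_class n (G, b, g)"
  obtain H c h where xH: "x = (H, c, h)" by (cases x) auto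
  then have LH: "L_graph n (H, c, h)" and eq: "pointed_marked_equiv n (G, b, g) (H, c, h)"
    using x by (auto simp: L_class_def)
  note H = L_graph_serre[OF LH] and hm = L_graph_gmap[OF LH]
  have conn: "connected (dig H)"
    using LH by (simp add: L_graph_def pointed_marked_graph_def finite_connected_graph_def)
  obtain \<alpha> \<beta> where iso: "graph_iso G H \<alpha> \<beta>"
    using eq unfolding pointed_marked_equiv_def prod.case by blast
  have valH: "valence H w \<noteq> 2" if w: "w \<in> gverts H" for w
  proof -
    from w obtain v where v: "v \<in> gverts G" "w = \<alpha> v"
      using graph_isoD(1)[OF iso] by (auto simp: bij_betw_def)
    then show ?thesis using val[OF v(1)] graph_iso_valence[OF iso v(1) G] by simp
  qed
  obtain h0 where h0: "erase_marked n (H, h) = (erase H, h0)"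
    by (rule erase_markedE[OF H conn hm]) (rule that)
  have "K_class n (H, h) = K_class n (erase_marked n (H, h))"
    using K_class_eq[OF H serre_erase[OF H] hm] marked_equiv_erase_trivial[OF H conn hm valH] h0 by simp
  moreover have "K_class n (G, g) = K_class n (H, h)"
    by (rule K_class_eq[OF G H gm pointed_marked_equiv_free[OF eq]])
  ultimately show "(case x of (G, b, g) \<Rightarrow> K_class n (erase_marked n (G, g))) = K_class n (G, g)"
    using xH by simp
qed

lemma restriction_K_class_augmented:
  fixes G :: "(nat, nat) sgraph"
  assumes L: "L_graph m (G, b, g)" and m: "0 < m" and mn: "m < n"
  shows "restriction m (K_class n (attach_bouquet m n G b, augment_marking m g)) =
    K_class m (erase_marked m (G, g))"
  unfolding restriction_def
proof (rule the_elem_image)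
  let ?A = "attach_bouquet m n G b" and ?a = "augment_marking m g"
  note LA = L_graph_attach_bouquet(1)[OF L mn] and valA = L_graph_attach_bouquet(2)[OF L mn]
  note A = L_graph_serre[OF LA] and b = L_graph_base[OF L]
  have KA: "L_graph n (relabel_arcs ?A, b, iso_gmap (\<lambda>v. v) to_nat \<circ>\<^sub>g ?a)"
    and eq: "pointed_marked_equiv n (?A, b, ?a) (relabel_arcs ?A, b, iso_gmap (\<lambda>v. v) to_nat \<circ>\<^sub>g ?a)"
    using L_class_member[OF LA] by (simp_all add: L_class_def)
  have "valence (relabel_arcs ?A) b = valence ?A b"
    using graph_iso_valence[OF relabel_arcs_iso[OF A] _ A, of b] b by simp
  then have "K_graph n (relabel_arcs ?A, iso_gmap (\<lambda>v. v) to_nat \<circ>\<^sub>g ?a)"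
    using L_graph_is_K_graph[OF KA] valA[OF b] m mn by simp
  then show "(relabel_arcs ?A, iso_gmap (\<lambda>v. v) to_nat \<circ>\<^sub>g ?a) \<in> K_class n (?A, ?a)"
    using pointed_marked_equiv_free[OF eq] by (simp add: K_class_def)
  fix x assume x: "x \<in> K_class n (?A, ?a)"
  obtain H h where xH: "x = (H, h)" by (cases x) auto
  then have H: "serre_graph H" and eq: "marked_equiv n (?A, ?a) (H, h)"
    using x K_graph_serre by (auto simp: K_class_def)
  obtain D h' where D: "restriction_cover m (H, h) = (D, h')" by (cases "restriction_cover m (H, h)") auto
  show "(let (C, g) = restriction_cover m x
      in K_class m (erase_marked m (compact_core C, core_retraction C \<circ>\<^sub>g g))) =
      K_class m (erase_marked m (G, g))"
    using restriction_of_augmented[OF L mn H eq D] xH D by simp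
qed

theorem lemma3:
  fixes m n :: nat
  assumes "0 < m" and "m < n"
  shows "(\<forall>X \<in> L_vertices m.
            restriction m (forgetful n (augmentation m n X)) = forgetful m X) \<and>
         (\<forall>\<sigma> \<in> L_simplices m.
            restriction m ` forgetful n ` augmentation m n ` \<sigma> = forgetful m ` \<sigma>)"
proof -
  have vertices: "restriction m (forgetful n (augmentation m n X)) = forgetful m X"
    if X: "X \<in> L_vertices m" for X
  proof -
    from X obtain x :: "(nat, nat) sgraph \<times> nat \<times> (nat, nat) marking"
      where x: "L_graph m x" "X = L_class m x"
      unfolding L_vertices_def by blast
    obtain G b g where xG: "x = (G, b, g)" by (cases x) auto
    have L: "L_graph m (G, b, g)" using x xG by simp
    note LA = L_graph_attach_bouquet[OF L assms(2)]
    have "forgetful n (augmentation m n X) = K_class n (attach_bouquet m n G b, augment_marking m g)"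
      using augmentation_L_class[OF L assms(2)] forgetful_L_class_trivalent[OF LA(1)] LA(2) x xG by simp
    then show ?thesis
      using restriction_K_class_augmented[OF L assms] forgetful_L_class[OF L] x xG by simp
  qed
  have "\<sigma> \<subseteq> L_vertices m" if "\<sigma> \<in> L_simplices m" for \<sigma>
    using that by (simp add: L_simplices_def flag_simplices_def)
  then have "restriction m ` forgetful n ` augmentation m n ` \<sigma> = forgetful m ` \<sigma>"
    if "\<sigma> \<in> L_simplices m" for \<sigma>
    using that vertices unfolding image_image by (intro image_cong) auto
  with vertices show ?thesis by blast
qed

end
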